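(* Let $m\ge2$ and let the real toll sequence $(t_n)_{n\ge0}$ satisfy $t_n\sim n^\beta L(n)$ with $\beta>1$, where $L$ is slowly varying. Let $X_n$ be the corresponding additive functional on $m$-ary search trees on $n$ keys under the random permutation model. Then $$\frac{X_n}{n^\beta L(n)}\xrightarrow{\ \mathcal L\ }Y(\beta)$$ with convergence of all moments, where $\mathcal L(Y(\beta))$ is the unique distribution with finite second moment satisfying $$Y\stackrel{\mathcal L}{=}\sum_{j=1}^mS_j^\beta Y_j+1 .$$
   Context: Random permutation model and additive functionals. Fix an integer $m\ge 2$. From a sequence of $n$ distinct keys one builds an $m$-ary search tree $T$ with $|T|=n$ keys: if $n<m$, all keys are stored in the root (for $n=0$ the tree is empty; if $n\le m-1$ all subtrees of the root are empty); if $n\ge m$, the first $m-1$ keys are stored in the root in increasing order $\sigma_1<\dots<\sigma_{m-1}$, and for $1\le j\le m$ the remaining keys lying strictly between $\sigma_{j-1}$ and $\sigma_j$ (with $\sigma_0=-\infty$, $\sigma_m=+\infty$), taken in their original order, recursively form the $j$th subtree $L_j(T)$. Given a real sequence $(t_n)_{n\ge0}$ (toll sequence), the additive functional $f$ is defined by $f(T)=t_{|T|}$ if $0\le |T|\le m-2$ (arbitrary initial values) and $f(T)=\sum_{i=1}^m f(L_i(T))+t_{|T|}$ if $|T|\ge m-1$. $X_n:=f(T_n)$, where $T_n$ is the tree built from a uniformly random permutation of $\{1,\dots,n\}$. In the distributional equation, $Y_1,\dots,Y_m$ are independent copies of $Y$, and $(S_1,\dots,S_m)$ is uniformly distributed on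 the simplex $\{s_j\ge0,\ \sum_{j=1}^m s_j=1\}$ and independent of $(Y_1,\dots,Y_m)$. A slowly varying function is a positive measurable function $L$ on $[1,\infty)$ with $L(cx)/L(x)\to1$ as $x\to\infty$ for every $c>0$. $\xrightarrow{\mathcal L}$ and $\stackrel{\mathcal L}{=}$ denote convergence and equality in distribution. *)

theory Defs
  imports "HOL-Probability.Probability" "HOL-Combinatorics.Multiset_Permutations"
begin

section \<open>Search trees and additive functionals\<close>

datatype 'a mtree = Empty | Node (keys: "'a list") (subtrees: "'a mtree list")

fun num_keys :: "'a mtree \<Rightarrow> nat" where
  "num_keys Empty = 0"
| "num_keys (Node ks ts) = length ks + sum_list (map num_keys ts)"

text \<open>With zero-based indices, \<open>in_gap ks j x\<close> says that \<open>x\<close> lies strictly between the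
  \<open>j\<close>th and the \<open>(j+1)\<close>st key of \<open>ks\<close>, where the keys are padded by \<open>- \<infinity>\<close> and \<open>+ \<infinity>\<close>.\<close>

definition in_gap :: "'a::linorder list \<Rightarrow> nat \<Rightarrow> 'a \<Rightarrow> bool" where
  "in_gap ks j x \<longleftrightarrow> (j = 0 \<or> ks ! (j - 1) < x) \<and> (j = length ks \<or> x < ks ! j)"

text \<open>The disjunct \<open>m < 2\<close> is there only to make the recursion terminate; the function is
  meaningful for \<open>m \<ge> 2\<close> and lists of distinct keys.\<close>

function search_tree :: "nat \<Rightarrow> 'a::linorder list \<Rightarrow> 'a mtree" where
  "search_tree m xs =
     (if xs = [] then Empty
      else if length xs < m \<or> m < 2 then Node (sort xs) (replicate m Empty)
      else (let ks = sort (take (m - 1) xs)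
            in Node ks (map (\<lambda>j. search_tree m (filter (in_gap ks j) (drop (m - 1) xs))) [0..<m])))"
  by pat_completeness auto
termination
  by (relation "Wellfounded.measure (\<lambda>(m, xs). length xs)")
     (auto intro!: le_less_trans[OF length_filter_le])

declare search_tree.simps [simp del]

fun additive_functional :: "nat \<Rightarrow> (nat \<Rightarrow> real) \<Rightarrow> 'a mtree \<Rightarrow> real" where
  "additive_functional m t Empty = t 0"
| "additive_functional m t (Node ks ts) =
     (let n = num_keys (Node ks ts)
      in if n \<le> m - 2 then t n
         else sum_list (map (additive_functional m t) ts) + t n)"

text \<open>The law of \<open>X\<^sub>n\<close> under the random permutation model.\<close>

definition X_pmf :: "nat \<Rightarrow> (nat \<Rightarrow> real) \<Rightarrow> nat \<Rightarrow> real pmf" where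
  "X_pmf m t n =
     map_pmf (\<lambda>xs. additive_functional m t (search_tree m xs)) (pmf_of_set (permutations_of_set {1..n}))"


section \<open>Slow variation\<close>

text \<open>Measurability is Lebesgue measurability, which includes the Borel case.\<close>

definition slowly_varying :: "(real \<Rightarrow> real) \<Rightarrow> bool" where
  "slowly_varying L \<longleftrightarrow>
     (\<forall>x\<ge>1. L x > 0) \<and> L \<in> borel_measurable (lebesgue_on {1..}) \<and>
     (\<forall>c>0. ((\<lambda>x. L (c * x) / L x) \<longlongrightarrow> 1) at_top)"


section \<open>The distributional equation\<close>

text \<open>The uniform distribution on \<open>{s. (\<forall>j<m. s\<^sub>j \<ge> 0) \<and> (\<Sum>j<m. s\<^sub>j) = 1}\<close>. This set is
  Lebesgue-null in dimension \<open>m\<close>, so it is parametrised by its first \<open>m - 1\<close> coordinates, which are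
  uniformly distributed with respect to \<open>(m - 1)\<close>-dimensional Lebesgue measure.\<close>

definition uniform_simplex :: "nat \<Rightarrow> (nat \<Rightarrow> real) measure" where
  "uniform_simplex m =
     (let R = Pi\<^sub>M {..<m - 1} (\<lambda>_. lborel)
      in distr (uniform_measure R {s \<in> space R. (\<forall>j<m - 1. 0 \<le> s j) \<and> (\<Sum>j<m - 1. s j) \<le> 1})
           (Pi\<^sub>M {..<m} (\<lambda>_. borel))
           (\<lambda>s. \<lambda>j\<in>{..<m}. if j < m - 1 then s j else 1 - (\<Sum>i<m - 1. s i)))"

text \<open>\<open>\<mu>\<close> is the law of a \<open>Y\<close> with finite second moment such that \<open>Y\<close> and
  \<open>(\<Sum>j<m. S\<^sub>j powr \<beta> * Y\<^sub>j) + 1\<close> are equal in distribution; the product measure expresses that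
  \<open>Y\<^sub>0, \<dots>, Y\<^sub>m\<^sub>-\<^sub>1\<close> are independent copies of \<open>Y\<close>, independent of \<open>S\<close>.\<close>

definition fixed_point_law :: "nat \<Rightarrow> real \<Rightarrow> real measure \<Rightarrow> bool" where
  "fixed_point_law m \<beta> \<mu> \<longleftrightarrow>
     real_distribution \<mu> \<and> integrable \<mu> (\<lambda>y. y\<^sup>2) \<and>
     \<mu> = distr (uniform_simplex m \<Otimes>\<^sub>M Pi\<^sub>M {..<m} (\<lambda>_. \<mu>)) borel
           (\<lambda>(s, y). (\<Sum>j<m. s j powr \<beta> * y j) + 1)"

end

theory Submission
  imports Defs
begin

text \<open>
  Conditionally on the sizes of the subtrees of the root, which form a uniform composition of
  \<open>n - (m - 1)\<close> into \<open>m\<close> parts, \<open>X\<^sub>n\<close> is a sum of independent copies of smaller \<open>X\<^sub>i\<close> plus the toll.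
  Write \<open>b\<^sub>n = n\<^sup>\<beta> L(n)\<close>. By the uniform convergence theorem for slowly varying functions the
  weights \<open>b\<^sub>i / b\<^sub>n\<close> are uniformly close to \<open>(i / n)\<^sup>\<beta>\<close>, and the composition divided by \<open>n\<close> is
  coupled with a uniform point \<open>S\<close> of the simplex. Because \<open>\<beta> > 1\<close>, \<open>E (\<Sum> S\<^sub>j\<^sup>\<beta>) < 1\<close>, so the
  distance \<open>sup\<^sub>u |f(u) - g(u)| / |u|\<close> between characteristic functions is contracted: it tends to
  \<open>0\<close> between \<open>X\<^sub>n / b\<^sub>n\<close> and any solution with finite first moment. This gives convergence and, with
  the toll \<open>n\<^sup>\<beta>\<close>, also uniqueness. Convexity of \<open>x\<^sup>k\<close> and the same contraction bound
  \<open>E |X\<^sub>n / b\<^sub>n|\<^sup>k\<close>, which gives convergence of moments and tightness; a solution of the equation for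
  characteristic functions, obtained by iteration, is therefore the characteristic function of a
  subsequential limit.
\<close>

section \<open>The recursion for the law of the additive functional\<close>

text \<open>The distance \<open>sup |f(u) - g(u)| / |u|\<close> fits the recursion for two reasons:
  replacing \<open>u\<close> by \<open>u * s\<close> multiplies it by \<open>s\<close>, and the
  difference of two products of numbers of modulus at most 1 is at most the sum of the differences.
  One step of the recursion therefore multiplies it by \<open>E (\<Sum> S_j^\<beta>)\<close>, which
  is below 1 because \<open>s^\<beta> < s\<close> on \<open>(0,1)\<close>. Homogeneity of degree 1
  in \<open>u\<close> is enough, so \<open>X_n\<close> is never centred. The obstacle is the
  sequence \<open>b\<close>: uniform convergence controls \<open>b_i / b_n\<close> only while
  \<open>i / n\<close> stays away from 0. Smaller indices are handled by a Potter bound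
  \<open>b_i <= 2 sqrt(i/n) b_n\<close>, and the finitely many indices below its threshold by
  \<open>b_n \<longrightarrow> \<infinity>\<close>. The contraction holds only on average: a root
  with one huge subtree has total weight close to 1. For the \<open>k\<close>th moment Jensen's
  inequality leaves the \<open>k\<close>th power of the total weight; all factors but one are
  bounded by a number close to 1, and only the last one is averaged.\<close>

definition compositions :: "nat \<Rightarrow> nat \<Rightarrow> (nat \<Rightarrow> nat) set" where
  "compositions m N = {i. (\<forall>j\<ge>m. i j = 0) \<and> (\<Sum>j<m. i j) = N}"

lemma compositions_le: "i \<in> compositions m N \<Longrightarrow> i j \<le> N"
  by (cases "j < m") (auto simp: compositions_def intro!: member_le_sum)

text \<open>Passing to lists of length \<open>m\<close> with prescribed sum makes the stars-and-bars
  count \<open>card_length_sum_list\<close> available.\<close>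

lemma bij_betw_compositions:
  "bij_betw (\<lambda>l j. if j < m then l ! j else 0) {l::nat list. length l = m \<and> sum_list l = N} (compositions m N)"
proof (rule bij_betw_byWitness[where f' = "\<lambda>i. map i [0..<m]"])
  show "\<forall>l\<in>{l. length l = m \<and> sum_list l = N}. map (\<lambda>j. if j < m then l ! j else 0) [0..<m] = l"
    by (auto intro!: nth_equalityI)
qed (auto simp: compositions_def fun_eq_iff sum_list_sum_nth atLeast0LessThan)

lemma card_compositions: "card (compositions m N) = (N + m - 1) choose N"
  using bij_betw_same_card[OF bij_betw_compositions] card_length_sum_list by metis

lemma finite_compositions [simp]: "finite (compositions m N)"
proof -
  have "compositions m N \<subseteq> PiE_dflt {..<m} 0 (\<lambda>_. {..N})"
    by (auto simp: PiE_dflt_def compositions_le) (auto simp: compositions_def)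
  then show ?thesis
    by (rule finite_subset) auto
qed

lemma compositions_nonempty [simp]: "m > 0 \<Longrightarrow> compositions m N \<noteq> {}"
proof -
  assume "m > 0"
  then have "(\<lambda>j. if j = 0 then N else 0) \<in> compositions m N"
    by (auto simp: compositions_def sum.delta)
  then show ?thesis by blast
qed

section \<open>Ranks of the root keys and sizes of the gaps between them\<close>

lemma downward_closed_eq_lessThan:
  fixes S :: "nat set"
  assumes "finite S" "\<And>i j. i \<le> j \<Longrightarrow> j \<in> S \<Longrightarrow> i \<in> S"
  shows "S = {..<card S}"
proof (cases "S = {}")
  case False
  have "S = {..Max S}"
    using assms(2)[OF _ Max_in[OF assms(1) False]] Max_ge[OF assms(1)] by blast
  then show ?thesis
    by (metis card_atMost lessThan_Suc_atMost)
qed auto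

text \<open>By sortedness the indices whose entry lies below \<open>x\<close> form an initial
  segment, and there are as many of them as elements of \<open>K\<close> below
  \<open>x\<close>.\<close>

lemma sorted_nth_less_iff:
  fixes K :: "'a::linorder set"
  assumes "finite K" "i < card K"
  shows "sorted_list_of_set K ! i < x \<longleftrightarrow> i < card {y \<in> K. y < x}"
proof -
  define ks where "ks = sorted_list_of_set K"
  have ks: "sorted ks" "distinct ks" "set ks = K" "length ks = card K"
    using assms by (auto simp: ks_def)
  define S where "S = {i. i < card K \<and> ks ! i < x}"
  have "bij_betw ((!) ks) S {y \<in> K. y < x}"
    unfolding bij_betw_def
  proof
    show "inj_on ((!) ks) S"
      using ks by (auto simp: S_def inj_on_def nth_eq_iff_index_eq)
    show "(!) ks ` S = {y \<in> K. y < x}"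
      unfolding S_def by (subst (2) ks(3)[symmetric]) (auto simp: set_conv_nth ks(4))
  qed
  then have "card S = card {y \<in> K. y < x}"
    by (rule bij_betw_same_card)
  moreover have "S = {..<card S}"
  proof (rule downward_closed_eq_lessThan)
    show "i \<in> S" if "i \<le> j" "j \<in> S" for i j
      using that ks sorted_nth_mono[OF ks(1), of i j] by (auto simp: S_def)
  qed (simp add: S_def)
  ultimately have "i \<in> S \<longleftrightarrow> i < card {y \<in> K. y < x}"
    by (metis lessThan_iff)
  then show ?thesis
    using assms by (simp add: S_def ks_def)
qed

text \<open>Both tests of \<open>in_gap\<close> become inequalities for the number \<open>c\<close>
  of keys below \<open>x\<close>: the left one says \<open>j <= c\<close>, the right one
  \<open>c <= j\<close>. As \<open>x\<close> is not a key, not being above a key means being below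
  it.\<close>

lemma in_gap_iff_card:
  fixes K :: "'a::linorder set"
  assumes "finite K" "j \<le> card K" "x \<notin> K"
  shows "in_gap (sorted_list_of_set K) j x \<longleftrightarrow> card {y \<in> K. y < x} = j"
proof -
  define c where "c = card {y \<in> K. y < x}"
  have c: "c \<le> card K"
    unfolding c_def using assms by (intro card_mono) auto
  have "j = 0 \<or> sorted_list_of_set K ! (j - 1) < x \<longleftrightarrow> j \<le> c"
    using sorted_nth_less_iff[OF assms(1), of "j - 1" x] assms(2) by (cases "j = 0") (auto simp: c_def)
  moreover have "j = card K \<or> x < sorted_list_of_set K ! j \<longleftrightarrow> c \<le> j"
  proof (cases "j < card K")
    case True
    then have "sorted_list_of_set K ! j \<in> K"
      using assms(1) by (metis nth_mem set_sorted_list_of_set length_sorted_list_of_set)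
    then have "sorted_list_of_set K ! j \<noteq> x"
      using assms(3) by auto
    then show ?thesis
      using sorted_nth_less_iff[OF assms(1) True, of x] True by (auto simp: c_def not_less)
  qed (use assms c in auto)
  ultimately show ?thesis
    using c by (auto simp: in_gap_def c_def[symmetric])
qed

text \<open>By \<open>in_gap_iff_card\<close> this is the set of those elements that go to the \<open>j\<close>th subtree.\<close>

definition gap :: "'a::linorder set \<Rightarrow> 'a set \<Rightarrow> nat \<Rightarrow> 'a set" where
  "gap A K j = {x \<in> A - K. card {y \<in> K. y < x} = j}"

lemma finite_gap [simp]: "finite A \<Longrightarrow> finite (gap A K j)"
  by (auto simp: gap_def)

lemma sum_card_gap:
  assumes "finite A" "K \<subseteq> A" "card K < m"
  shows "(\<Sum>j<m. card (gap A K j)) = card A - card K"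
proof -
  have "(\<Sum>j<m. card (gap A K j)) = card (\<Union>j<m. gap A K j)"
    using assms by (intro card_UN_disjoint[symmetric]) (auto simp: gap_def)
  also have "(\<Union>j<m. gap A K j) = A - K"
  proof -
    have "card {y \<in> K. y < x} < m" for x
      using card_mono[of K "{y \<in> K. y < x}"] assms finite_subset by fastforce
    then show ?thesis by (auto simp: gap_def)
  qed
  also have "card (A - K) = card A - card K"
    using assms by (meson card_Diff_subset finite_subset)
  finally show ?thesis .
qed

text \<open>Below the \<open>j\<close>th key, counted from 0, lie the \<open>j\<close> smaller keys
  and the elements of the gaps \<open>0\<close> to \<open>j\<close>, and nothing else.\<close>

lemma rank_of_key:
  assumes "finite A" "K \<subseteq> A" "j < card K"
  shows "card {x \<in> A. x < sorted_list_of_set K ! j} = j + (\<Sum>i\<le>j. card (gap A K i))"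
proof -
  have [simp]: "finite K" using assms finite_subset by blast
  define ks where "ks = sorted_list_of_set K"
  have ks: "sorted ks" "distinct ks" "set ks = K" "length ks = card K"
    using assms by (auto simp: ks_def)
  have inK: "{x \<in> K. x < ks ! j} = (!) ks ` {..<j}"
  proof -
    have "ks ! i < ks ! j \<longleftrightarrow> i < j" if "i < card K" for i
      using ks assms(3) that
      by (metis sorted_wrt_nth_less strict_sorted_iff linorder_neqE_nat order_less_asym order_less_irrefl)
    then have "{x \<in> (!) ks ` {..<card K}. x < ks ! j} = (!) ks ` {..<j}"
      using assms(3) by auto
    moreover have "(!) ks ` {..<card K} = K"
      using ks by (auto simp: set_conv_nth)
    ultimately show ?thesis
      by simp
  qed
  have card_inK: "card {x \<in> K. x < ks ! j} = j"
    unfolding inK using ks assms(3) by (subst card_image) (auto simp: inj_on_def nth_eq_iff_index_eq)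
  have notK: "{x \<in> A - K. x < ks ! j} = (\<Union>i\<le>j. gap A K i)"
  proof -
    have "x < ks ! j \<longleftrightarrow> card {y \<in> K. y < x} \<le> j" if "x \<notin> K" for x
    proof -
      have "ks ! j \<noteq> x" using that ks assms(3) nth_mem by metis
      then have "x < ks ! j \<longleftrightarrow> \<not> ks ! j < x" by auto
      then show ?thesis
        using sorted_nth_less_iff[of K j x] assms(3) by (simp add: ks_def not_less)
    qed
    then show ?thesis by (auto simp: gap_def)
  qed
  have "{x \<in> A. x < ks ! j} = {x \<in> K. x < ks ! j} \<union> {x \<in> A - K. x < ks ! j}"
    using assms by auto
  then have "card {x \<in> A. x < ks ! j} = card {x \<in> K. x < ks ! j} + card {x \<in> A - K. x < ks ! j}"
    using assms by (simp only:, subst card_Un_disjoint) auto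
  also have "card {x \<in> A - K. x < ks ! j} = (\<Sum>i\<le>j. card (gap A K i))"
    unfolding notK using assms by (intro card_UN_disjoint) (auto simp: gap_def)
  finally show ?thesis
    using card_inK by (simp add: ks_def)
qed

lemma inj_rank:
  fixes A :: "'a::linorder set"
  assumes "finite A"
  shows "inj_on (\<lambda>x. card {y \<in> A. y < x}) A"
proof (rule linorder_inj_onI)
  fix x y assume "x < y" "x \<in> A" "y \<in> A"
  then have "card {z \<in> A. z < x} < card {z \<in> A. z < y}"
    using assms by (intro psubset_card_mono) auto
  then show "card {z \<in> A. z < x} \<noteq> card {z \<in> A. z < y}" by simp
qed auto

definition gap_cards :: "nat \<Rightarrow> 'a::linorder set \<Rightarrow> 'a set \<Rightarrow> nat \<Rightarrow> nat" where
  "gap_cards m A K j = (if j < m then card (gap A K j) else 0)"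

text \<open>The gap sizes determine the ranks of the keys, hence the keys.\<close>

lemma bij_betw_gap_cards:
  fixes A :: "'a::linorder set"
  assumes "finite A" "m \<ge> 1" "card A \<ge> m - 1"
  shows "bij_betw (gap_cards m A) {K. K \<subseteq> A \<and> card K = m - 1} (compositions m (card A + 1 - m))"
proof -
  let ?I = "{K. K \<subseteq> A \<and> card K = m - 1}"
  have inj: "inj_on (gap_cards m A) ?I"
  proof (rule inj_on_inverseI)
    fix K assume K: "K \<in> ?I"
    have [simp]: "finite K" using K assms finite_subset by blast
    let ?r = "\<lambda>x. card {y \<in> A. y < x}"
    have r: "?r (sorted_list_of_set K ! j) = j + (\<Sum>i\<le>j. gap_cards m A K i)" if "j < m - 1" for j
    proof -
      have "(\<Sum>i\<le>j. gap_cards m A K i) = (\<Sum>i\<le>j. card (gap A K i))"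
        using that by (intro sum.cong) (auto simp: gap_cards_def)
      then show ?thesis
        using rank_of_key[of A K j] that assms K by auto
    qed
    show "{x \<in> A. \<exists>j<m - 1. ?r x = j + (\<Sum>i\<le>j. gap_cards m A K i)} = K"
    proof (intro equalityI subsetI)
      fix x assume "x \<in> K"
      then obtain j where "j < m - 1" "x = sorted_list_of_set K ! j"
        using K by (metis (mono_tags, lifting) \<open>finite K\<close> in_set_conv_nth length_sorted_list_of_set mem_Collect_eq set_sorted_list_of_set)
      then show "x \<in> {x \<in> A. \<exists>j<m - 1. ?r x = j + (\<Sum>i\<le>j. gap_cards m A K i)}"
        using r \<open>x \<in> K\<close> K by auto
    next
      fix x assume "x \<in> {x \<in> A. \<exists>j<m - 1. ?r x = j + (\<Sum>i\<le>j. gap_cards m A K i)}"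
      then obtain j where j: "x \<in> A" "j < m - 1" "?r x = ?r (sorted_list_of_set K ! j)"
        using r by auto
      moreover have "sorted_list_of_set K ! j \<in> K"
        using j K by (metis (mono_tags, lifting) \<open>finite K\<close> length_sorted_list_of_set mem_Collect_eq nth_mem set_sorted_list_of_set)
      ultimately show "x \<in> K"
        using inj_onD[OF inj_rank[OF assms(1)], of x "sorted_list_of_set K ! j"] K by auto
    qed
  qed
  have sub: "gap_cards m A ` ?I \<subseteq> compositions m (card A + 1 - m)"
    using sum_card_gap[of A _ m] assms by (auto simp: compositions_def gap_cards_def)
  \<comment> \<open>Surjectivity is by counting: there are as many possible key sets as
    compositions, so the injection is onto.\<close>
  have "card ?I = card A choose (m - 1)"
    using assms by (simp add: n_subsets)
  also have "\<dots> = card A choose (card A - (m - 1))"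
    using assms by (intro binomial_symmetric) auto
  also have "\<dots> = card (compositions m (card A + 1 - m))"
    using assms by (simp add: card_compositions Suc_diff_le)
  finally have "gap_cards m A ` ?I = compositions m (card A + 1 - m)"
    by (intro card_subset_eq sub) (simp_all only: finite_compositions card_image[OF inj])
  then show ?thesis using inj by (simp add: bij_betw_def)
qed

text \<open>Needed because \<open>additive_functional\<close> evaluates the toll at
  \<open>num_keys\<close>. No key is lost on the way down: the strict tests of \<open>in_gap\<close>
  could only drop ties, which distinctness excludes.\<close>

lemma num_keys_search_tree:
  assumes "distinct xs" "m \<ge> 2"
  shows "num_keys (search_tree m xs) = length xs"
  using assms
proof (induction "length xs" arbitrary: xs rule: less_induct)
  case less
  show ?case
  proof (cases "xs = [] \<or> length xs < m")
    case True
    then show ?thesis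
      by (auto simp: search_tree.simps[of m xs] sum_list_replicate)
  next
    case False
    define K where "K = set (take (m - 1) xs)"
    define ys where "ys = drop (m - 1) xs"
    have K: "finite K" "K \<subseteq> set xs" "card K = m - 1"
      using False less.prems(1) unfolding K_def
      by (auto dest: in_set_takeD simp: distinct_card)
    have ys: "distinct ys" "set ys = set xs - K" "length ys = length xs - (m - 1)"
      using less.prems(1) set_take_disj_set_drop_if_distinct[of xs "m - 1" "m - 1"] set_append[of "take (m - 1) xs" "drop (m - 1) xs"]
      unfolding ys_def K_def by (auto simp del: set_append)
    have sort: "sort (take (m - 1) xs) = sorted_list_of_set K"
      using less.prems by (simp add: K_def sorted_list_of_set_sort_remdups distinct_remdups_id)
    have "num_keys (search_tree m (filter (in_gap (sorted_list_of_set K) j) ys)) = card (gap (set xs) K j)"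
      if "j < m" for j
    proof -
      have "length (filter (in_gap (sorted_list_of_set K) j) ys) < length xs"
        using False less.prems(2) length_filter_le[of "in_gap (sorted_list_of_set K) j" ys]
        unfolding ys(3) by linarith
      then have "num_keys (search_tree m (filter (in_gap (sorted_list_of_set K) j) ys))
          = length (filter (in_gap (sorted_list_of_set K) j) ys)"
        using less.prems ys by (intro less.hyps) auto
      also have "\<dots> = card (set (filter (in_gap (sorted_list_of_set K) j) ys))"
        using ys by (intro distinct_card[symmetric]) auto
      also have "set (filter (in_gap (sorted_list_of_set K) j) ys) = gap (set xs) K j"
        using in_gap_iff_card[OF K(1), of j] K that ys by (auto simp: gap_def)
      finally show ?thesis .
    qed
    then have "(\<Sum>j\<leftarrow>[0..<m]. num_keys (search_tree m (filter (in_gap (sorted_list_of_set K) j) ys)))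
        = (\<Sum>j<m. card (gap (set xs) K j))"
      by (simp add: sum_list_distinct_conv_sum_set atLeast0LessThan)
    also have "\<dots> = length xs - (m - 1)"
      using sum_card_gap[of "set xs" K m] K less.prems by (simp add: distinct_card)
    finally show ?thesis
      using False less.prems unfolding search_tree.simps[of m xs] sort ys_def
      by (auto simp: Let_def comp_def K(3))
  qed
qed

lemma additive_functional_search_tree:
  assumes "distinct (as @ bs)" "m \<ge> 2" "length as = m - 1"
  shows "additive_functional m t (search_tree m (as @ bs)) =
    (\<Sum>j<m. additive_functional m t (search_tree m (filter (in_gap (sorted_list_of_set (set as)) j) bs)))
      + t (length (as @ bs))"
proof -
  have sort: "sort as = sorted_list_of_set (set as)"
    using assms by (simp add: sorted_list_of_set_sort_remdups distinct_remdups_id)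
  \<comment> \<open>With exactly \<open>m - 1\<close> keys the tree comes from the other branch of
    \<open>search_tree\<close>, but its \<open>m\<close> empty subtrees fit the general form; each
    of them contributes \<open>t 0\<close>.\<close>
  have *: "search_tree m (as @ bs) = Node (sorted_list_of_set (set as))
      (map (\<lambda>j. search_tree m (filter (in_gap (sorted_list_of_set (set as)) j) bs)) [0..<m])"
  proof (cases "bs = []")
    case True
    have "search_tree m [] = Empty" by (simp add: search_tree.simps)
    with True show ?thesis
      using assms by (auto simp: search_tree.simps[of m as] search_tree.simps[of m "[]"] sort map_replicate_const)
  next
    case False
    then have "\<not> length (as @ bs) < m"
      using assms by (cases bs) auto
    with False show ?thesis
      using assms by (subst search_tree.simps) (simp add: sort Let_def)
  qed
  have "num_keys (search_tree m (as @ bs)) = length (as @ bs)"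
    using assms by (intro num_keys_search_tree)
  then show ?thesis
    using assms(2,3) unfolding *
    by (simp add: Let_def comp_def sum_list_distinct_conv_sum_set atLeast0LessThan)
qed

section \<open>Random permutations: independent restrictions to blocks, and the set of the first
  entries\<close>

lemma map_pmf_filter_permutations:
  fixes r :: nat
  assumes "finite A" "\<And>i j. i < r \<Longrightarrow> j < r \<Longrightarrow> i \<noteq> j \<Longrightarrow> B i \<inter> B j = {}"
  shows "map_pmf (\<lambda>xs j. if j < r then filter (\<lambda>x. x \<in> B j) xs else []) (pmf_of_set (permutations_of_set A))
    = Pi_pmf {..<r} [] (\<lambda>j. pmf_of_set (permutations_of_set {x \<in> A. x \<in> B j}))"
  using assms
proof (induction r arbitrary: A)
  case (Suc r)
  \<comment> \<open>Block \<open>r\<close> is split off first. By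
    \<open>partition_random_permutations\<close> the rest is an independent uniform permutation, and
    its restrictions to the earlier blocks are those of the whole list because the blocks are
    disjoint.\<close>
  define F where "F = (\<lambda>r xs (j::nat). if j < r then filter (\<lambda>x. x \<in> B j) xs else [])"
  have F_Suc: "F (Suc r) xs = (\<lambda>(y, f). f(r := y)) (apsnd (F r) (partition (\<lambda>x. x \<in> B r) xs))" for xs
  proof
    fix j
    have "filter (\<lambda>x. x \<in> B j) (filter (\<lambda>x. x \<notin> B r) xs) = filter (\<lambda>x. x \<in> B j) xs" if "j < r"
      using Suc.prems(2)[of j r] that unfolding filter_filter by (intro filter_cong) auto
    then show "F (Suc r) xs j = (\<lambda>(y, f). f(r := y)) (apsnd (F r) (partition (\<lambda>x. x \<in> B r) xs)) j"
      by (auto simp: F_def less_Suc_eq comp_def)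
  qed
  have IH: "map_pmf (F r) (pmf_of_set (permutations_of_set {x \<in> A. x \<notin> B r}))
      = Pi_pmf {..<r} [] (\<lambda>j. pmf_of_set (permutations_of_set {x \<in> A. x \<in> B j}))"
  proof -
    have "{x \<in> {x \<in> A. x \<notin> B r}. x \<in> B j} = {x \<in> A. x \<in> B j}" if "j < r" for j
      using Suc.prems(2)[of j r] that by auto
    then show ?thesis
      unfolding F_def using Suc.prems by (subst Suc.IH) (auto intro!: Pi_pmf_cong)
  qed
  have "map_pmf (F (Suc r)) (pmf_of_set (permutations_of_set A))
      = map_pmf (\<lambda>(y, f). f(r := y)) (map_pmf (apsnd (F r))
          (map_pmf (partition (\<lambda>x. x \<in> B r)) (pmf_of_set (permutations_of_set A))))"
    unfolding map_pmf_comp by (intro map_pmf_cong refl) (rule F_Suc)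
  also have "\<dots> = Pi_pmf (insert r {..<r}) [] (\<lambda>j. pmf_of_set (permutations_of_set {x \<in> A. x \<in> B j}))"
    unfolding partition_random_permutations[OF Suc.prems(1)] pair_map_pmf2[symmetric] IH
    by (rule Pi_pmf_insert[symmetric]) auto
  finally show ?case
    by (simp add: F_def lessThan_Suc)
qed (simp add: map_pmf_const)

lemma pmf_of_set_Times:
  assumes "finite A" "A \<noteq> {}" "finite B" "B \<noteq> {}"
  shows "pmf_of_set (A \<times> B) = pair_pmf (pmf_of_set A) (pmf_of_set B)"
proof (rule pmf_eqI)
  fix p show "pmf (pmf_of_set (A \<times> B)) p = pmf (pair_pmf (pmf_of_set A) (pmf_of_set B)) p"
    using assms by (cases p) (simp add: pmf_pair indicator_def card_cartesian_product)
qed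

lemma permutations_with_prefix_set:
  assumes "finite A" "K \<subseteq> A"
  shows "{xs \<in> permutations_of_set A. set (take (card K) xs) = K}
    = (\<lambda>(as, bs). as @ bs) ` (permutations_of_set K \<times> permutations_of_set (A - K))"
    (is "?L = ?R")
proof (intro equalityI subsetI)
  fix xs assume xs: "xs \<in> ?L"
  define as where "as = take (card K) xs"
  define bs where "bs = drop (card K) xs"
  have ab: "xs = as @ bs" by (simp add: as_def bs_def)
  have "set as = K" "set (as @ bs) = A" "distinct (as @ bs)"
    using xs unfolding ab[symmetric] by (auto simp: permutations_of_set_def as_def)
  then have "as \<in> permutations_of_set K" "bs \<in> permutations_of_set (A - K)"
    by (auto simp: permutations_of_set_def)
  then show "xs \<in> ?R" using ab by auto
next
  fix xs assume "xs \<in> ?R"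
  then obtain as bs where "xs = as @ bs" "as \<in> permutations_of_set K" "bs \<in> permutations_of_set (A - K)"
    by auto
  moreover from this have "length as = card K"
    by (metis distinct_card permutations_of_setD)
  ultimately show "xs \<in> ?L"
    using assms by (auto simp: permutations_of_set_def)
qed

lemma inj_on_append_permutations:
  "inj_on (\<lambda>(as, bs). as @ bs) (permutations_of_set K \<times> X)"
  by (auto simp: inj_on_def permutations_of_set_def) (metis append_eq_append_conv distinct_card)+

text \<open>Permutations are classified by the set \<open>K\<close> of their first \<open>k\<close>
  entries. All classes have the same size \<open>fact k * fact (card A - k)\<close>, so the uniform
  law is a uniform choice of \<open>K\<close> followed by a uniform choice inside its class.\<close>

lemma pmf_of_set_permutations_split:
  assumes "finite A" "k \<le> card A"
  shows "pmf_of_set (permutations_of_set A) = pmf_of_set {K. K \<subseteq> A \<and> card K = k} \<bind>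
    (\<lambda>K. map_pmf (\<lambda>(as, bs). as @ bs)
       (pair_pmf (pmf_of_set (permutations_of_set K)) (pmf_of_set (permutations_of_set (A - K)))))"
proof -
  let ?B = "\<lambda>K. {xs \<in> permutations_of_set A. set (take k xs) = K}"
  let ?I = "{K. K \<subseteq> A \<and> card K = k}"
  let ?P = "\<lambda>K. permutations_of_set K \<times> permutations_of_set (A - K)"
  have B: "?B K = (\<lambda>(as, bs). as @ bs) ` ?P K" if "K \<in> ?I" for K
    using permutations_with_prefix_set[OF assms(1), of K] that by auto
  have fin: "finite K" if "K \<in> ?I" for K
    using that assms finite_subset by blast
  have "card (?B K) = fact k * fact (card A - k)" if "K \<in> ?I" for K
  proof -
    have "card (A - K) = card A - k"
      using that fin[OF that] by (auto simp: card_Diff_subset)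
    then show ?thesis
      using that fin[OF that] assms
      by (simp add: B card_image inj_on_append_permutations card_cartesian_product)
  qed
  moreover have "?I \<noteq> {}"
    using obtain_subset_with_card_n[OF assms(2)] by blast
  moreover have "?B K \<noteq> {}" if "K \<in> ?I" for K
    using fin[OF that] assms by (auto simp: B[OF that])
  moreover have "(\<Union>K\<in>?I. ?B K) = permutations_of_set A"
    using assms by (auto simp: permutations_of_set_def distinct_card dest: in_set_takeD)
  ultimately have "pmf_of_set (permutations_of_set A) = pmf_of_set ?I \<bind> (\<lambda>K. pmf_of_set (?B K))"
    using assms
    by (subst pmf_of_set_UN[symmetric, where n = "fact k * fact (card A - k)"])
      (auto simp: disjoint_family_on_def)
  also have "\<dots> = pmf_of_set ?I \<bind> (\<lambda>K. map_pmf (\<lambda>(as, bs). as @ bs)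
       (pair_pmf (pmf_of_set (permutations_of_set K)) (pmf_of_set (permutations_of_set (A - K)))))"
  proof (intro bind_pmf_cong refl)
    fix K assume "K \<in> set_pmf (pmf_of_set ?I)"
    then have K: "K \<in> ?I"
      using \<open>?I \<noteq> {}\<close> assms by simp
    show "pmf_of_set (?B K) = map_pmf (\<lambda>(as, bs). as @ bs)
       (pair_pmf (pmf_of_set (permutations_of_set K)) (pmf_of_set (permutations_of_set (A - K))))"
      using fin[OF K] assms unfolding B[OF K]
      by (subst map_pmf_of_set_inj[symmetric, OF inj_on_append_permutations])
        (auto simp: pmf_of_set_Times)
  qed
  finally show ?thesis .
qed

text \<open>\<open>X_pmf\<close> for arbitrary key sets: a subtree is built on a gap, which is in
  general not of the form \<open>{1..n}\<close>.\<close>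

definition random_functional :: "nat \<Rightarrow> (nat \<Rightarrow> real) \<Rightarrow> 'a::linorder set \<Rightarrow> real pmf" where
  "random_functional m t A =
     map_pmf (\<lambda>xs. additive_functional m t (search_tree m xs)) (pmf_of_set (permutations_of_set A))"

text \<open>Given the set \<open>K\<close> of root keys, the other keys come in uniformly random
  order, and their restrictions to the disjoint gaps are independent. The order of the root keys is
  forgotten, since the root is sorted.\<close>

lemma random_functional_rec:
  fixes A :: "'a::linorder set"
  assumes "finite A" "m \<ge> 2" "card A \<ge> m - 1"
  shows "random_functional m t A = pmf_of_set {K. K \<subseteq> A \<and> card K = m - 1} \<bind>
    (\<lambda>K. map_pmf (\<lambda>y. (\<Sum>j<m. y j) + t (card A))
       (Pi_pmf {..<m} (t 0) (\<lambda>j. random_functional m t (gap A K j))))"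
proof -
  let ?I = "{K. K \<subseteq> A \<and> card K = m - 1}"
  let ?f = "\<lambda>xs. additive_functional m t (search_tree m xs)"
  have "?I \<noteq> {}"
    using obtain_subset_with_card_n[OF assms(3)] by blast
  have "random_functional m t A = pmf_of_set ?I \<bind>
    (\<lambda>K. map_pmf ?f (map_pmf (\<lambda>(as, bs). as @ bs)
       (pair_pmf (pmf_of_set (permutations_of_set K)) (pmf_of_set (permutations_of_set (A - K))))))"
    unfolding random_functional_def pmf_of_set_permutations_split[OF assms(1,3)] map_bind_pmf ..
  also have "\<dots> = pmf_of_set ?I \<bind>
    (\<lambda>K. map_pmf (\<lambda>y. (\<Sum>j<m. y j) + t (card A))
       (Pi_pmf {..<m} (t 0) (\<lambda>j. random_functional m t (gap A K j))))"
  proof (intro bind_pmf_cong refl)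
    fix K assume "K \<in> set_pmf (pmf_of_set ?I)"
    then have K: "K \<subseteq> A" "card K = m - 1" "finite K"
      using \<open>?I \<noteq> {}\<close> assms finite_subset by auto
    define split where "split = (\<lambda>bs (j::nat). if j < m then filter (\<lambda>x. x \<in> gap A K j) bs else [])"
    have gap: "in_gap (sorted_list_of_set K) j x \<longleftrightarrow> x \<in> gap A K j" if "j < m" "x \<in> A - K" for j x
      using in_gap_iff_card[OF K(3), of j x] that K by (auto simp: gap_def)
    have f: "?f (as @ bs) = (\<Sum>j<m. ?f (split bs j)) + t (card A)"
      if "as \<in> permutations_of_set K" "bs \<in> permutations_of_set (A - K)" for as bs
    proof -
      have "distinct (as @ bs)" "set as = K" "set (as @ bs) = A" "length as = m - 1" "set bs = A - K"
        using that K by (auto simp: permutations_of_set_def distinct_card)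
      moreover from this have "length (as @ bs) = card A"
        by (metis distinct_card)
      moreover have "filter (in_gap (sorted_list_of_set K) j) bs = split bs j" if "j < m" for j
        using gap[OF that] \<open>set bs = A - K\<close> that by (auto simp: split_def intro!: filter_cong)
      ultimately show ?thesis
        using additive_functional_search_tree[of as bs m t] assms by simp
    qed
    have "map_pmf ?f (map_pmf (\<lambda>(as, bs). as @ bs)
        (pair_pmf (pmf_of_set (permutations_of_set K)) (pmf_of_set (permutations_of_set (A - K)))))
      = map_pmf (\<lambda>p. (\<Sum>j<m. ?f (split (snd p) j)) + t (card A))
        (pair_pmf (pmf_of_set (permutations_of_set K)) (pmf_of_set (permutations_of_set (A - K))))"
      unfolding map_pmf_comp using assms K by (intro map_pmf_cong refl) (auto simp: f)
    also have "\<dots> = map_pmf (\<lambda>bs. (\<Sum>j<m. ?f (split bs j)) + t (card A))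
        (map_pmf snd (pair_pmf (pmf_of_set (permutations_of_set K)) (pmf_of_set (permutations_of_set (A - K)))))"
      unfolding map_pmf_comp ..
    also have "\<dots> = map_pmf (\<lambda>y. (\<Sum>j<m. y j) + t (card A)) (map_pmf (\<lambda>h. ?f \<circ> h)
        (map_pmf split (pmf_of_set (permutations_of_set (A - K)))))"
      unfolding map_snd_pair_pmf map_pmf_comp by (simp add: comp_def)
    also have "map_pmf split (pmf_of_set (permutations_of_set (A - K)))
        = Pi_pmf {..<m} [] (\<lambda>j. pmf_of_set (permutations_of_set {x \<in> A - K. x \<in> gap A K j}))"
      unfolding split_def using assms by (intro map_pmf_filter_permutations) (auto simp: gap_def)
    also have "\<dots> = Pi_pmf {..<m} [] (\<lambda>j. pmf_of_set (permutations_of_set (gap A K j)))"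
      by (intro Pi_pmf_cong) (auto simp: gap_def intro!: arg_cong[where f = "\<lambda>A. pmf_of_set (permutations_of_set A)"])
    \<comment> \<open>The default \<open>[]\<close> of the lists turns into the default
      \<open>t 0\<close> because the functional of the empty tree is \<open>t 0\<close>.\<close>
    also have "map_pmf (\<lambda>h. ?f \<circ> h) \<dots> = Pi_pmf {..<m} (t 0) (\<lambda>j. random_functional m t (gap A K j))"
      unfolding random_functional_def by (intro Pi_pmf_map[symmetric]) (auto simp: search_tree.simps)
    finally show "map_pmf ?f (map_pmf (\<lambda>(as, bs). as @ bs)
        (pair_pmf (pmf_of_set (permutations_of_set K)) (pmf_of_set (permutations_of_set (A - K)))))
      = map_pmf (\<lambda>y. (\<Sum>j<m. y j) + t (card A))
       (Pi_pmf {..<m} (t 0) (\<lambda>j. random_functional m t (gap A K j)))" .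
  qed
  finally show ?thesis .
qed

lemma finite_set_pmf_X_pmf [simp]: "finite (set_pmf (X_pmf m t n))"
  by (simp add: X_pmf_def)

lemma compositions_less:
  assumes "i \<in> compositions m (n + 1 - m)" "m \<ge> 2" "n \<ge> m - 1"
  shows "i j < n"
  using compositions_le[OF assms(1), of j] assms(2,3) by linarith

lemma additive_functional_search_tree_small:
  assumes "length xs < m - 1"
  shows "additive_functional m t (search_tree m xs) = t (length xs)"
proof (cases "xs = []")
  case False
  then have "search_tree m xs = Node (sort xs) (replicate m Empty)"
    using assms by (auto simp: search_tree.simps[of m xs])
  then show ?thesis
    using assms by (simp add: sum_list_replicate Let_def)
qed (simp add: search_tree.simps)

text \<open>Two claims in one induction: that the law depends only on the number of keys is what
  allows the laws on the smaller gaps to be replaced by \<open>X_pmf\<close>, and then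
  \<open>bij_betw_gap_cards\<close> turns the uniform key set into a uniform composition.\<close>

lemma random_functional_eq_X_pmf:
  fixes A :: "nat set"
  assumes "finite A" "m \<ge> 2"
  shows "random_functional m t A = X_pmf m t (card A) \<and> (card A \<ge> m - 1 \<longrightarrow>
    random_functional m t A = pmf_of_set (compositions m (card A + 1 - m)) \<bind>
    (\<lambda>i. map_pmf (\<lambda>y. (\<Sum>j<m. y j) + t (card A)) (Pi_pmf {..<m} (t 0) (\<lambda>j. X_pmf m t (i j)))))"
  using assms
proof (induction "card A" arbitrary: A rule: less_induct)
  case less
  have X: "X_pmf m t n = random_functional m t {1..n}" for n
    by (simp add: X_pmf_def random_functional_def)
  show ?case
  proof (cases "card A \<ge> m - 1")
    case False
    have "random_functional m t B = return_pmf (t (card A))" if "finite B" "card B = card A" for B :: "nat set"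
    proof -
      have "random_functional m t B = map_pmf (\<lambda>xs. t (card A)) (pmf_of_set (permutations_of_set B))"
        unfolding random_functional_def
      proof (intro map_pmf_cong refl)
        fix xs assume "xs \<in> set_pmf (pmf_of_set (permutations_of_set B))"
        then have "xs \<in> permutations_of_set B"
          using that by simp
        then have "length xs = card A"
          using that by (metis distinct_card permutations_of_setD)
        then show "additive_functional m t (search_tree m xs) = t (card A)"
          using False by (simp add: additive_functional_search_tree_small)
      qed
      then show ?thesis by simp
    qed
    from this[of A] this[of "{1..card A}"] show ?thesis
      using False less.prems by (simp add: X)
  next
    case True
    let ?H = "\<lambda>i. map_pmf (\<lambda>y. (\<Sum>j<m. y j) + t (card A)) (Pi_pmf {..<m} (t 0) (\<lambda>j. X_pmf m t (i j)))"
    have *: "random_functional m t B = pmf_of_set (compositions m (card A + 1 - m)) \<bind> ?H"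
      if B: "finite B" "card B = card A" for B :: "nat set"
    proof -
      let ?I = "{K. K \<subseteq> B \<and> card K = m - 1}"
      have "?I \<noteq> {}"
        using obtain_subset_with_card_n[of "m - 1" B] B True by auto
      have "random_functional m t B = pmf_of_set ?I \<bind> (\<lambda>K. map_pmf (\<lambda>y. (\<Sum>j<m. y j) + t (card B))
          (Pi_pmf {..<m} (t 0) (\<lambda>j. random_functional m t (gap B K j))))"
        using B True less.prems by (intro random_functional_rec) auto
      also have "\<dots> = pmf_of_set ?I \<bind> (\<lambda>K. ?H (gap_cards m B K))"
      proof (intro bind_pmf_cong refl)
        fix K assume "K \<in> set_pmf (pmf_of_set ?I)"
        then have K: "K \<subseteq> B" "card K = m - 1"
          using \<open>?I \<noteq> {}\<close> B by auto
        have "random_functional m t (gap B K j) = X_pmf m t (gap_cards m B K j)" if "j < m" for j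
        proof -
          have "card (gap B K j) \<le> card (B - K)"
            using B by (intro card_mono) (auto simp: gap_def)
          also have "\<dots> < card A"
            using K B less.prems True finite_subset[OF K(1) B(1)] by (subst card_Diff_subset) auto
          finally show ?thesis
            using less.hyps[of "gap B K j"] B less.prems that by (auto simp: gap_cards_def)
        qed
        then show "map_pmf (\<lambda>y. (\<Sum>j<m. y j) + t (card B))
            (Pi_pmf {..<m} (t 0) (\<lambda>j. random_functional m t (gap B K j))) = ?H (gap_cards m B K)"
          unfolding B by (intro arg_cong[where f = "map_pmf _"] Pi_pmf_cong) auto
      qed
      also have "\<dots> = map_pmf (gap_cards m B) (pmf_of_set ?I) \<bind> ?H"
        by (simp add: bind_map_pmf)
      also have "map_pmf (gap_cards m B) (pmf_of_set ?I) = pmf_of_set (compositions m (card A + 1 - m))"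
        using bij_betw_gap_cards[of B m] B True less.prems \<open>?I \<noteq> {}\<close> by (intro map_pmf_of_set_bij_betw) auto
      finally show ?thesis .
    qed
    \<comment> \<open>The right-hand side of \<open>*\<close> involves only \<open>card A\<close>,
      so \<open>A\<close> and \<open>{1..card A}\<close> give the same law.\<close>
    from *[of A] *[of "{1..card A}"] show ?thesis
      using less.prems by (simp add: X)
  qed
qed

lemma X_pmf_rec:
  assumes "m \<ge> 2" "n \<ge> m - 1"
  shows "X_pmf m t n = pmf_of_set (compositions m (n + 1 - m)) \<bind>
    (\<lambda>i. map_pmf (\<lambda>y. (\<Sum>j<m. y j) + t n) (Pi_pmf {..<m} (t 0) (\<lambda>j. X_pmf m t (i j))))"
  using random_functional_eq_X_pmf[of "{1..n}" m t] assms by (auto simp del: One_nat_def)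

section \<open>Slow variation\<close>

text \<open>Continuity of the measure from below: the sets increase to the whole interval, since
  every point satisfies \<open>P k\<close> from some \<open>k\<close> on.\<close>

lemma measure_Collect_all_ge_tendsto:
  fixes P :: "nat \<Rightarrow> real \<Rightarrow> bool"
  assumes meas: "\<And>k. {c. P k c} \<in> sets lebesgue"
    and ev: "\<And>c. c \<in> {a..b} \<Longrightarrow> eventually (\<lambda>k. P k c) sequentially"
    and "a \<le> (b::real)"
  shows "(\<lambda>n. measure lebesgue {c \<in> {a..b}. \<forall>k\<ge>n. P k c}) \<longlonglongrightarrow> b - a"
    and "{c \<in> {a..b}. \<forall>k\<ge>n. P k c} \<in> lmeasurable"
proof -
  let ?V = "\<lambda>n. {c \<in> {a..b}. \<forall>k\<ge>n. P k c}"
  have V: "?V n = {a..b} \<inter> (\<Inter>k\<in>{n..}. {c. P k c})" for n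
    by auto
  have sets: "?V n \<in> sets lebesgue" for n
    unfolding V using meas by (intro sets.Int sets.countable_INT') auto
  then show "{c \<in> {a..b}. \<forall>k\<ge>n. P k c} \<in> lmeasurable" for n
    by (rule fmeasurableI2[OF lmeasurable_interval(1)[of a b], rotated]) auto
  have U: "(\<Union>n. ?V n) = {a..b}"
    using ev by (auto simp: eventually_sequentially)
  have "(\<lambda>n. measure lebesgue (?V n)) \<longlonglongrightarrow> measure lebesgue (\<Union>n. ?V n)"
  proof (rule Lim_measure_incseq)
    show "range ?V \<subseteq> sets lebesgue"
      using sets by (rule image_subsetI)
    show "incseq ?V"
      by (rule incseq_SucI) auto
    show "emeasure lebesgue (\<Union>n. ?V n) \<noteq> \<infinity>"
      unfolding U by (simp add: emeasure_lborel_cbox_eq flip: box_real)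
  qed
  also have "measure lebesgue (\<Union>n. ?V n) = b - a"
    unfolding U using \<open>a \<le> b\<close> by simp
  finally show "(\<lambda>n. measure lebesgue {c \<in> {a..b}. \<forall>k\<ge>n. P k c}) \<longlonglongrightarrow> b - a" .
qed

text \<open>The Csiszar-Erdos proof: if the claim fails along \<open>x\<^sub>n\<close>, \<open>c\<^sub>n\<close>, then almost every \<open>v\<close> satisfies
  \<open>L(v x\<^sub>n) \<approx> L(x\<^sub>n)\<close> and almost every \<open>w\<close> satisfies \<open>L(w c\<^sub>n x\<^sub>n) \<approx> L(c\<^sub>n x\<^sub>n)\<close>, so that
  \<open>v = c\<^sub>n w\<close> for some such \<open>v\<close>, \<open>w\<close>.\<close>

lemma slowly_varying_uniform:
  assumes L: "slowly_varying L" and "\<epsilon> > 0"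
  shows "\<exists>X\<ge>1. \<forall>x\<ge>X. \<forall>c\<in>{1..2}. \<bar>ln (L (c * x)) - ln (L x)\<bar> < \<epsilon>"
proof (rule ccontr)
  assume "\<not> ?thesis"
  then have "\<forall>n::nat. \<exists>x c. x \<ge> max 1 (real n) \<and> c \<in> {1..2} \<and> \<bar>ln (L (c * x)) - ln (L x)\<bar> \<ge> \<epsilon>"
    by (metis max.cobounded1 not_less)
  then obtain x c where xc: "\<And>n::nat. x n \<ge> max 1 (real n)" "\<And>n. c n \<in> {1..2}"
    "\<And>n. \<bar>ln (L (c n * x n)) - ln (L (x n))\<bar> \<ge> \<epsilon>"
    by metis
  have c: "c n \<ge> 1" "c n \<le> 2" for n using xc(2)[of n] by auto
  have x1: "x n \<ge> 1" for n using xc(1)[of n] by simp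
  have cx1: "c n * x n \<ge> 1" for n using c(1)[of n] x1[of n] by (metis mult_mono' mult_1 zero_le_one)
  \<comment> \<open>\<open>L\<close> is constrained only on \<open>[1,\<infinity>)\<close>;
    extending it by 1 gives a positive function that is measurable on the whole line.\<close>
  define M where "M y = (if y \<in> {1..} then L y else 1)" for y
  have M_eq: "M y = L y" if "y \<ge> 1" for y using that by (simp add: M_def)
  have M_pos: "M y > 0" for y
    using L by (simp add: M_def slowly_varying_def)
  have M_meas: "M \<in> borel_measurable lebesgue"
  proof -
    have "L \<in> borel_measurable (lebesgue_on {1..})"
      using L by (simp add: slowly_varying_def)
    then show ?thesis
      unfolding M_def by (subst (asm) measurable_restrict_space_iff[of _ _ 1]) auto
  qed
  define h where "h = (\<lambda>x c. \<bar>ln (M (x * c)) - ln (M x)\<bar>)"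
  have h_meas: "{c. h x c < \<epsilon> / 2} \<in> sets lebesgue" for x
  proof -
    have [measurable]: "(\<lambda>c. M (x * c)) \<in> borel_measurable lebesgue"
      using measurable_compose[OF lebesgue_measurable_scaling[of x] M_meas] by simp
    have "h x \<in> borel_measurable lebesgue"
      unfolding h_def by measurable
    from borel_measurable_less[OF this borel_measurable_const[of "\<epsilon> / 2"]] show ?thesis
      by simp
  qed
  have h_lim: "eventually (\<lambda>k. h (y k) d < \<epsilon> / 2) sequentially"
    if d: "d \<ge> 1" and y: "filterlim y at_top sequentially" "\<And>k. y k \<ge> 1" for d y
  proof -
    have "((\<lambda>x. L (d * x) / L x) \<longlongrightarrow> 1) at_top"
      using L d by (simp add: slowly_varying_def)
    then have "(\<lambda>k. L (d * y k) / L (y k)) \<longlonglongrightarrow> 1"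
      using y(1) by (rule filterlim_compose)
    then have "(\<lambda>k. \<bar>ln (L (d * y k) / L (y k))\<bar>) \<longlonglongrightarrow> \<bar>ln 1\<bar>"
      by (intro tendsto_intros) auto
    moreover have "\<bar>ln (L (d * y k) / L (y k))\<bar> = h (y k) d" for k
    proof -
      have "d * y k \<ge> 1" using d y(2)[of k] by (metis mult_mono' mult_1 zero_le_one)
      then show ?thesis
        using M_pos[of "d * y k"] M_pos[of "y k"] y(2)[of k]
        by (simp add: h_def ln_div M_eq mult.commute)
    qed
    ultimately have "(\<lambda>k. h (y k) d) \<longlonglongrightarrow> 0" by simp
    then show ?thesis
      using \<open>\<epsilon> > 0\<close> by (intro order_tendstoD) auto
  qed
  have x_lim: "filterlim x at_top sequentially"
    using xc(1) by (intro filterlim_at_top_mono[OF filterlim_real_sequentially]) auto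
  have cx_lim: "filterlim (\<lambda>n. c n * x n) at_top sequentially"
  proof (rule filterlim_at_top_mono[OF x_lim])
    show "\<forall>\<^sub>F n in sequentially. x n \<le> c n * x n"
      using c(1) x1 by (intro always_eventually allI) (metis mult_1 mult_right_mono order_trans zero_le_one)
  qed
  \<comment> \<open>The products \<open>c n * w\<close> of two numbers from \<open>[1,2]\<close> lie
    in \<open>[1,4]\<close>, hence the larger interval for \<open>V n\<close>.\<close>
  define V where "V n = {d \<in> {1..4}. \<forall>k\<ge>n. h (x k) d < \<epsilon> / 2}" for n
  define W where "W n = {d \<in> {1..2}. \<forall>k\<ge>n. h (c k * x k) d < \<epsilon> / 2}" for n
  have lims: "(\<lambda>n. measure lebesgue (V n)) \<longlonglongrightarrow> 4 - 1" "(\<lambda>n. measure lebesgue (W n)) \<longlonglongrightarrow> 2 - 1"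
    unfolding V_def W_def
    by (intro measure_Collect_all_ge_tendsto h_meas h_lim x_lim cx_lim x1 cx1; simp)+
  \<comment> \<open>The two bounds lie below the limits 3 and 1, but their sum exceeds 3, the length
    of \<open>[1,4]\<close>. This rules out that \<open>V n\<close> and the dilate of
    \<open>W n\<close> by \<open>c n >= 1\<close> are disjoint.\<close>
  have "eventually (\<lambda>n. measure lebesgue (V n) > 5 / 2) sequentially"
    "eventually (\<lambda>n. measure lebesgue (W n) > 3 / 4) sequentially"
    by (rule order_tendstoD(1)[OF lims(1)], simp) (rule order_tendstoD(1)[OF lims(2)], simp)
  then have "eventually (\<lambda>n. measure lebesgue (V n) > 5 / 2 \<and> measure lebesgue (W n) > 3 / 4) sequentially"
    by (rule eventually_conj)
  then obtain n where n: "measure lebesgue (V n) > 5 / 2" "measure lebesgue (W n) > 3 / 4"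
    using eventually_happens'[OF sequentially_bot] by blast
  have lm: "V n \<in> lmeasurable" "W n \<in> lmeasurable"
    unfolding V_def W_def by (intro measure_Collect_all_ge_tendsto(2) h_meas h_lim x_lim cx_lim x1 cx1; simp)+
  define cW where "cW = (\<lambda>d. c n *\<^sub>R d) ` W n"
  have cW: "cW \<in> lmeasurable" "measure lebesgue cW = c n * measure lebesgue (W n)"
  proof -
    have "cW = (*\<^sub>R) (1 / c n) -` W n \<inter> space lebesgue"
    proof (intro equalityI subsetI)
      fix v assume "v \<in> (*\<^sub>R) (1 / c n) -` W n \<inter> space lebesgue"
      then have "v / c n \<in> W n" by simp
      moreover have "v = c n *\<^sub>R (v / c n)" using c(1)[of n] by simp
      ultimately show "v \<in> cW" unfolding cW_def by blast
    qed (use c(1)[of n] in \<open>auto simp: cW_def\<close>)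
    also have "\<dots> \<in> sets lebesgue"
      using lm by (intro measurable_sets[OF lebesgue_measurable_scaling]) (auto simp: fmeasurable_def)
    finally have "cW \<in> sets lebesgue" .
    moreover have "emeasure lebesgue cW = c n * emeasure lebesgue (W n)"
      "measure lebesgue cW = c n * measure lebesgue (W n)"
      using emeasure_lebesgue_affine[of "c n" 0 "W n"] measure_lebesgue_affine[of "c n" 0 "W n"] c(1)[of n]
      by (auto simp: cW_def)
    ultimately show "cW \<in> lmeasurable" "measure lebesgue cW = c n * measure lebesgue (W n)"
      using lm by (auto simp: fmeasurable_def ennreal_mult_less_top)
  qed
  have "V n \<inter> cW \<noteq> {}"
  proof
    assume "V n \<inter> cW = {}"
    then have "measure lebesgue (V n) + measure lebesgue cW = measure lebesgue (V n \<union> cW)"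
      using lm cW by (intro measure_Un_AE[symmetric]) (auto simp: fmeasurable_def)
    also have "V n \<union> cW \<subseteq> {1..4}"
    proof -
      have "1 \<le> c n * d \<and> c n * d \<le> 4" if "d \<in> {1..2}" for d
        using c[of n] that mult_mono[of 1 "c n" 1 d] mult_mono[of "c n" 2 d 2] by auto
      then show ?thesis by (auto simp: V_def W_def cW_def)
    qed
    then have "measure lebesgue (V n \<union> cW) \<le> measure lebesgue {1..4::real}"
      using lm cW by (intro measure_mono_fmeasurable) auto
    finally have "measure lebesgue (V n) + c n * measure lebesgue (W n) \<le> 3"
      using cW by simp
    moreover have "measure lebesgue (W n) \<le> c n * measure lebesgue (W n)"
      using c(1)[of n] by (simp add: mult_le_cancel_right1)
    ultimately show False using n by linarith
  qed
  then obtain w where w: "w \<in> W n" "c n * w \<in> V n"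
    by (auto simp: cW_def)
  \<comment> \<open>Both estimates compare with the value of \<open>M\<close> at the common point
    \<open>w * c n * x n\<close>; the triangle inequality then contradicts the choice of
    \<open>x n\<close> and \<open>c n\<close>.\<close>
  have "h (c n * x n) w < \<epsilon> / 2" "h (x n) (c n * w) < \<epsilon> / 2"
    using w by (auto simp: V_def W_def)
  then have "\<bar>ln (M (c n * x n)) - ln (M (x n))\<bar> < \<epsilon>"
    by (simp add: h_def mult_ac) argo
  then show False
    using xc(3)[of n] x1[of n] cx1[of n] by (simp add: M_eq)
qed

text \<open>Each of \<open>k\<close> successive doublings costs at most \<open>\<epsilon>\<close>.
  The threshold \<open>X\<close> does not depend on \<open>k\<close>, so \<open>k\<close> may later
  grow with \<open>x / y\<close>.\<close>

lemma slowly_varying_dyadic: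
  assumes L: "slowly_varying L" and "\<epsilon> > 0"
  shows "\<exists>X\<ge>1. \<forall>(k::nat) (y::real) x. X \<le> y \<longrightarrow> y \<le> x \<longrightarrow> x \<le> 2 ^ k * y \<longrightarrow> \<bar>ln (L x) - ln (L y)\<bar> \<le> real k * \<epsilon>"
proof -
  obtain X where X: "X \<ge> 1" "\<And>x c. x \<ge> X \<Longrightarrow> c \<in> {1..2} \<Longrightarrow> \<bar>ln (L (c * x)) - ln (L x)\<bar> < \<epsilon>"
    using slowly_varying_uniform[OF assms] by blast
  have bound: "\<bar>ln (L x) - ln (L y)\<bar> \<le> real k * \<epsilon>" if "X \<le> y" "y \<le> x" "x \<le> 2 ^ k * y" for k :: nat and y x
    using that
  proof (induction k arbitrary: y)
    case (Suc k)
    show ?case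
    proof (cases "x \<le> 2 * y")
      case True
      then have "\<bar>ln (L (x / y * y)) - ln (L y)\<bar> < \<epsilon>"
        using Suc.prems X(1) by (intro X(2)) (auto simp: field_simps)
      moreover have "\<epsilon> \<le> real (Suc k) * \<epsilon>"
        using \<open>\<epsilon> > 0\<close> by simp
      ultimately show ?thesis
        using Suc.prems X(1) by simp
    next
      case False
      then have "\<bar>ln (L x) - ln (L (2 * y))\<bar> \<le> real k * \<epsilon>"
        using Suc.prems X(1) by (intro Suc.IH) auto
      moreover have "\<bar>ln (L (2 * y)) - ln (L y)\<bar> < \<epsilon>"
        using Suc.prems by (intro X(2)) auto
      ultimately show ?thesis
        by (simp add: algebra_simps)
    qed
  qed auto
  show ?thesis
    by (intro exI[of _ X] conjI allI impI X(1)) (rule bound)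
qed

text \<open>The value at \<open>0\<close> is arbitrary but positive, since the law of an empty subtree is normalised too.\<close>

definition normalizer :: "real \<Rightarrow> (real \<Rightarrow> real) \<Rightarrow> nat \<Rightarrow> real" where
  "normalizer \<beta> L n = (if n = 0 then 1 else real n powr \<beta> * L (real n))"

text \<open>With error \<open>ln 2 / 2\<close> per doubling, \<open>L\<close> changes at most by a
  factor \<open>sqrt 2\<close> per doubling, that is by about \<open>sqrt (x / y)\<close> in total.
  As \<open>\<beta> > 1\<close>, the power contributes at most \<open>y / x\<close>, which leaves
  \<open>sqrt (y / x)\<close>; the constant 2 absorbs the rounding of the number of
  doublings.\<close>

lemma slowly_varying_potter:
  assumes L: "slowly_varying L" and "\<beta> > 1"
  shows "\<exists>X\<ge>1. \<forall>y x. X \<le> y \<longrightarrow> y \<le> x \<longrightarrow> y powr \<beta> * L y \<le> 2 * sqrt (y / x) * (x powr \<beta> * L x)"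
proof -
  obtain X where X: "X \<ge> 1" "\<And>(k::nat) y x. X \<le> y \<Longrightarrow> y \<le> x \<Longrightarrow> x \<le> 2 ^ k * y \<Longrightarrow>
      \<bar>ln (L x) - ln (L y)\<bar> \<le> real k * (ln 2 / 2)"
    using slowly_varying_dyadic[OF L, of "ln 2 / 2"] by force
  have bound: "y powr \<beta> * L y \<le> 2 * sqrt (y / x) * (x powr \<beta> * L x)" if xy: "X \<le> y" "y \<le> x" for y x
  proof -
    have pos: "0 < y" "0 < x" "0 < L y" "0 < L x"
      using xy X(1) L by (auto simp: slowly_varying_def)
    define l where "l = ln (x / y) / ln 2"
    have "l \<ge> 0" using xy pos by (simp add: l_def)
    define k where "k = nat \<lceil>l\<rceil>"
    have k: "l \<le> real k" "real k \<le> l + 1"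
      using \<open>l \<ge> 0\<close> by (auto simp: k_def)
    have "ln (x / y) \<le> real k * ln 2"
      using k(1) by (simp add: l_def field_simps)
    then have "exp (ln (x / y)) \<le> exp (ln (2 ^ k))"
      by (simp add: ln_realpow)
    then have "x \<le> 2 ^ k * y"
      using pos by (simp add: field_simps)
    then have "ln (L y) - ln (L x) \<le> real k * (ln 2 / 2)"
      using X(2)[OF xy] by (smt (verit))
    also have "\<dots> \<le> (l + 1) * (ln 2 / 2)"
      using k(2) by (intro mult_right_mono) auto
    also have "\<dots> = ln (x / y) / 2 + ln 2 / 2"
      by (simp add: l_def field_simps)
    also have "\<dots> \<le> ln (x / y) / 2 + ln 2" by simp
    finally have "ln (L y) \<le> ln (L x) + ln (x / y) / 2 + ln 2" by simp
    moreover have "\<beta> * ln (y / x) \<le> 1 * ln (y / x)"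
      using \<open>\<beta> > 1\<close> xy pos by (intro mult_right_mono_neg) auto
    ultimately have "\<beta> * ln y + ln (L y) \<le> ln 2 + ln (y / x) / 2 + (\<beta> * ln x + ln (L x))"
      using pos by (simp add: ln_div algebra_simps) argo
    then have "ln (y powr \<beta> * L y) \<le> ln (2 * sqrt (y / x) * (x powr \<beta> * L x))"
      using pos by (simp add: ln_mult ln_sqrt ln_powr)
    then show ?thesis
      using pos by (subst (asm) ln_le_cancel_iff) auto
  qed
  show ?thesis
    by (intro exI[of _ X] conjI allI impI X(1)) (rule bound)
qed

lemma normalizer_pos: "slowly_varying L \<Longrightarrow> normalizer \<beta> L n > 0"
  by (auto simp: normalizer_def slowly_varying_def)

text \<open>The Potter bound with \<open>y = X\<close> fixed gives growth at least of order
  \<open>sqrt n\<close>.\<close>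

lemma normalizer_at_top:
  assumes L: "slowly_varying L" and "\<beta> > 1"
  shows "filterlim (normalizer \<beta> L) at_top sequentially"
proof -
  obtain X where X: "X \<ge> 1" "\<And>y x. X \<le> y \<Longrightarrow> y \<le> x \<Longrightarrow> y powr \<beta> * L y \<le> 2 * sqrt (y / x) * (x powr \<beta> * L x)"
    using slowly_varying_potter[OF assms] by blast
  define C where "C = X powr \<beta> * L X / (2 * sqrt X)"
  have C: "C > 0" using X(1) L by (auto simp: C_def slowly_varying_def)
  have "filterlim (\<lambda>n. C * sqrt (real n)) at_top sequentially"
    by (intro filterlim_tendsto_pos_mult_at_top[OF tendsto_const C]
        filterlim_compose[OF sqrt_at_top filterlim_real_sequentially])
  moreover have "eventually (\<lambda>n. C * sqrt (real n) \<le> normalizer \<beta> L n) sequentially"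
    using eventually_ge_at_top[of "nat \<lceil>X\<rceil>"]
  proof eventually_elim
    case (elim n)
    then have n: "X \<le> real n" by linarith
    then have "n > 0" using X(1) by auto
    have "X powr \<beta> * L X \<le> 2 * sqrt (X / real n) * (real n powr \<beta> * L (real n))"
      using X(2)[OF order_refl n] .
    then show ?case
      using \<open>n > 0\<close> X(1) by (simp add: C_def normalizer_def real_sqrt_divide field_simps)
  qed
  ultimately show ?thesis
    by (rule filterlim_at_top_mono)
qed

text \<open>Three ranges of \<open>i\<close>. For \<open>i >= \<eta> * n\<close> the quotient
  \<open>L i / L n\<close> is close to 1, as boundedly many doublings separate \<open>i\<close> from
  \<open>n\<close>. Below that both terms are small separately: the power because
  \<open>i / n <= \<eta>\<close>, the weight by the Potter bound if \<open>i >= X0\<close>, and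
  otherwise because finitely many values are divided by a divergent sequence.\<close>

lemma normalizer_ratio:
  assumes L: "slowly_varying L" and "\<beta> > 1" and "\<epsilon> > 0"
  shows "eventually (\<lambda>n. \<forall>i\<le>n. \<bar>normalizer \<beta> L i / normalizer \<beta> L n - (real i / real n) powr \<beta>\<bar> \<le> \<epsilon>) sequentially"
proof -
  let ?b = "normalizer \<beta> L"
  note b_pos = normalizer_pos[OF L, of \<beta>]
  define \<delta> where "\<delta> = min \<epsilon> (1/2)"
  have \<delta>: "0 < \<delta>" "\<delta> \<le> \<epsilon>" "\<delta> \<le> 1/2" using \<open>\<epsilon> > 0\<close> by (auto simp: \<delta>_def)
  \<comment> \<open>Chosen such that the Potter factor \<open>2 * sqrt \<eta>\<close> equals
    \<open>\<delta>\<close>.\<close>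
  define \<eta> where "\<eta> = (\<delta> / 2)\<^sup>2"
  have "\<delta> * \<delta> \<le> \<delta> * 1"
    using \<delta> by (intro mult_left_mono) auto
  then have \<eta>: "0 < \<eta>" "2 * sqrt \<eta> = \<delta>" "\<eta> \<le> \<delta>"
    using \<delta> by (simp_all add: \<eta>_def power_divide real_sqrt_divide) (simp add: power2_eq_square)
  obtain k :: nat where k: "1 / \<eta> < 2 ^ k"
    using real_arch_pow[of 2 "1 / \<eta>"] by auto
  \<comment> \<open>At most \<open>k\<close> doublings lead from \<open>i\<close> to
    \<open>n\<close> in the first range, so the total error stays below
    \<open>ln (1 + \<delta>)\<close>.\<close>
  define \<epsilon>' where "\<epsilon>' = ln (1 + \<delta>) / real (Suc k)"
  have "\<epsilon>' > 0" using \<delta> by (simp add: \<epsilon>'_def)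
  obtain X1 where X1: "X1 \<ge> 1" "\<And>(k::nat) y x. X1 \<le> y \<Longrightarrow> y \<le> x \<Longrightarrow> x \<le> 2 ^ k * y \<Longrightarrow> \<bar>ln (L x) - ln (L y)\<bar> \<le> real k * \<epsilon>'"
    using slowly_varying_dyadic[OF L \<open>\<epsilon>' > 0\<close>] by blast
  obtain X0 where X0: "X0 \<ge> 1" "\<And>y x. X0 \<le> y \<Longrightarrow> y \<le> x \<Longrightarrow> y powr \<beta> * L y \<le> 2 * sqrt (y / x) * (x powr \<beta> * L x)"
    using slowly_varying_potter[OF L \<open>\<beta> > 1\<close>] by blast
  define M where "M = Max (?b ` {..nat \<lceil>X0\<rceil>})"
  have M: "?b i \<le> M" if "real i < X0" for i
    unfolding M_def using that by (intro Max_ge imageI) (simp, simp, linarith)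
  have "eventually (\<lambda>n. ?b n \<ge> M / \<delta>) sequentially"
    using normalizer_at_top[OF L \<open>\<beta> > 1\<close>] by (simp add: filterlim_at_top)
  moreover have "eventually (\<lambda>n::nat. n \<ge> nat \<lceil>X1 / \<eta>\<rceil>) sequentially"
    by (rule eventually_ge_at_top)
  ultimately show ?thesis
  proof eventually_elim
    case (elim n)
    have n: "real n * \<eta> \<ge> X1"
      using elim(2) \<eta>(1) by (simp add: field_simps)
    then have n0: "n > 0" using X1(1) by (cases n) auto
    show ?case
    proof (intro allI impI)
      fix i assume "i \<le> n"
      show "\<bar>?b i / ?b n - (real i / real n) powr \<beta>\<bar> \<le> \<epsilon>"
      proof (cases "real i \<ge> \<eta> * real n")
        case True
        then have i: "X1 \<le> real i" using n by (simp add: mult.commute)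
        then have i0: "i > 0" using X1(1) by (cases i) auto
        have Lpos: "L (real i) > 0" "L (real n) > 0"
          using L i0 n0 by (auto simp: slowly_varying_def)
        have "real n \<le> 1 / \<eta> * real i"
          using True \<eta>(1) by (simp add: field_simps)
        also have "\<dots> \<le> 2 ^ k * real i"
          using k by (intro mult_right_mono) auto
        finally have "\<bar>ln (L (real n)) - ln (L (real i))\<bar> \<le> real k * \<epsilon>'"
          using X1(2)[OF i, of "real n" k] \<open>i \<le> n\<close> by simp
        also have "\<dots> \<le> ln (1 + \<delta>)"
          using \<delta> by (simp add: \<epsilon>'_def field_simps)
        finally have *: "\<bar>ln (L (real i) / L (real n))\<bar> \<le> ln (1 + \<delta>)"
          using Lpos by (simp add: ln_div abs_minus_commute)
        have "L (real i) / L (real n) \<le> 1 + \<delta>"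
        proof -
          have "ln (L (real i) / L (real n)) \<le> ln (1 + \<delta>)"
            using * by linarith
          then show ?thesis
            using Lpos \<delta> by (subst (asm) ln_le_cancel_iff) auto
        qed
        moreover have "1 - \<delta> \<le> L (real i) / L (real n)"
        proof -
          have "ln (1 / (1 + \<delta>)) \<le> ln (L (real i) / L (real n))"
            using * \<delta> by (simp add: ln_div)
          then have "1 / (1 + \<delta>) \<le> L (real i) / L (real n)"
            using Lpos \<delta> by (subst (asm) ln_le_cancel_iff) auto
          moreover have "1 - \<delta> \<le> 1 / (1 + \<delta>)"
            using \<delta> by (simp add: field_simps)
          ultimately show ?thesis by linarith
        qed
        ultimately have r: "\<bar>L (real i) / L (real n) - 1\<bar> \<le> \<delta>" by linarith
        have "?b i / ?b n - (real i / real n) powr \<beta> = (real i / real n) powr \<beta> * (L (real i) / L (real n) - 1)"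
          using i0 n0 Lpos by (simp add: normalizer_def powr_divide field_simps)
        also have "\<bar>\<dots>\<bar> \<le> 1 * \<delta>"
          unfolding abs_mult using \<open>i \<le> n\<close> n0 \<open>\<beta> > 1\<close> r
          by (intro mult_mono) (auto intro!: powr_le1)
        finally show ?thesis using \<delta> by simp
      next
        case False
        then have "real i / real n \<le> \<eta>"
          using n0 by (simp add: field_simps)
        have "(real i / real n) powr \<beta> \<le> (real i / real n) powr 1"
          using \<open>i \<le> n\<close> n0 \<open>\<beta> > 1\<close> by (intro powr_mono') auto
        then have p: "(real i / real n) powr \<beta> \<le> \<delta>"
          using \<open>real i / real n \<le> \<eta>\<close> \<eta>(3) by (simp add: order_trans)
        have "?b i / ?b n \<le> \<delta>"
        proof (cases "X0 \<le> real i")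
          case True
          then have "i > 0" using X0(1) by (cases i) auto
          have "?b i \<le> 2 * sqrt (real i / real n) * ?b n"
            using X0(2)[OF True, of "real n"] \<open>i \<le> n\<close> n0 \<open>i > 0\<close> by (simp add: normalizer_def)
          also have "\<dots> \<le> 2 * sqrt \<eta> * ?b n"
            using \<open>real i / real n \<le> \<eta>\<close> b_pos[of n] by (intro mult_right_mono) auto
          finally show ?thesis
            unfolding \<eta>(2) using b_pos[of n] by (simp add: pos_divide_le_eq)
        next
          case False
          then have "?b i \<le> M" by (intro M) auto
          also have "M \<le> \<delta> * ?b n"
            using elim(1) \<delta> by (simp add: field_simps)
          finally show ?thesis using b_pos[of n] by (simp add: field_simps)
        qed
        moreover have "0 \<le> ?b i / ?b n" "0 \<le> (real i / real n) powr \<beta>"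
          using b_pos[of i] b_pos[of n] by auto
        ultimately show ?thesis using p \<delta> by linarith
      qed
    qed
  qed
qed

section \<open>Uniform compositions and the uniform distribution on the simplex\<close>

definition std_simplex :: "nat \<Rightarrow> (nat \<Rightarrow> real) set" where
  "std_simplex m = {s. (\<forall>j<m. 0 \<le> s j) \<and> (\<Sum>j<m. s j) = 1}"

lemma std_simplex_le_1: "s \<in> std_simplex m \<Longrightarrow> j < m \<Longrightarrow> s j \<le> 1"
  using member_le_sum[of j "{..<m}" s] by (auto simp: std_simplex_def)

section \<open>Grid cells and the volume of the corner\<close>

definition corner :: "nat \<Rightarrow> (nat \<Rightarrow> real) set" where
  "corner k = {s \<in> space (Pi\<^sub>M {..<k} (\<lambda>_. lborel)). (\<forall>j<k. 0 \<le> s j) \<and> (\<Sum>j<k. s j) \<le> 1}"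

text \<open>The entry \<open>i k\<close> is ignored: for \<open>i\<close> in \<open>compositions (Suc k) N\<close> it is determined by the others.\<close>

definition cell :: "nat \<Rightarrow> nat \<Rightarrow> (nat \<Rightarrow> nat) \<Rightarrow> (nat \<Rightarrow> real) set" where
  "cell k n i = (\<Pi>\<^sub>E j\<in>{..<k}. {real (i j) / real n..<(real (i j) + 1) / real n})"

lemma sets_cell [measurable]: "cell k n i \<in> sets (Pi\<^sub>M {..<k} (\<lambda>_. lborel))"
  unfolding cell_def by (intro sets_PiM_I_finite) auto

lemma sets_corner [measurable]: "corner k \<in> sets (Pi\<^sub>M {..<k} (\<lambda>_. lborel))"
proof -
  have "corner k = (\<Pi>\<^sub>E j\<in>{..<k}. {0..}) \<inter> {s \<in> space (Pi\<^sub>M {..<k} (\<lambda>_. lborel)). (\<Sum>j<k. s j) \<le> 1}"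
    by (auto simp: corner_def space_PiM PiE_iff extensional_def)
  also have "\<dots> \<in> sets (Pi\<^sub>M {..<k} (\<lambda>_. lborel))"
    by (intro sets.Int sets_PiM_I_finite borel_measurable_le borel_measurable_sum) (auto intro!: measurable_component_singleton)
  finally show ?thesis .
qed

lemma emeasure_cell:
  assumes "n > 0"
  shows "emeasure (Pi\<^sub>M {..<k} (\<lambda>_. lborel)) (cell k n i) = ennreal ((1 / real n) ^ k)"
proof -
  interpret product_sigma_finite "\<lambda>_::nat. lborel :: real measure" ..
  have "emeasure (Pi\<^sub>M {..<k} (\<lambda>_. lborel)) (cell k n i) = (\<Prod>j<k. ennreal (1 / real n))"
    unfolding cell_def using assms
    by (subst emeasure_PiM) (auto intro!: prod.cong simp: divide_right_mono simp flip: diff_divide_distrib)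
  then show ?thesis by (simp add: ennreal_power)
qed

lemma floor_eq_if_in_cell:
  assumes "n > 0" "s \<in> cell k n i" "j < k"
  shows "i j = nat \<lfloor>real n * s j\<rfloor>"
proof -
  have "real (i j) / real n \<le> s j" "s j < (real (i j) + 1) / real n"
    using assms by (auto simp: cell_def PiE_iff)
  then have "\<lfloor>real n * s j\<rfloor> = int (i j)"
    using assms(1) by (intro floor_unique) (auto simp: field_simps)
  then show ?thesis by simp
qed

lemma compositions_eqI:
  assumes "i \<in> compositions (Suc k) N" "i' \<in> compositions (Suc k) N" "\<And>j. j < k \<Longrightarrow> i j = i' j"
  shows "i = i'"
proof
  fix j
  have "(\<Sum>j<k. i j) = (\<Sum>j<k. i' j)"
    using assms(3) by (intro sum.cong) auto
  then have "i k = i' k"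
    using assms(1,2) by (auto simp: compositions_def)
  then show "i j = i' j"
    using assms by (cases "j < k"; cases "j = k") (auto simp: compositions_def)
qed

lemma disjoint_cells:
  assumes "n > 0"
  shows "disjoint_family_on (cell k n) (compositions (Suc k) N)"
  unfolding disjoint_family_on_def
  using floor_eq_if_in_cell[OF assms] compositions_eqI by (metis disjoint_iff)

text \<open>The coordinates of the upper vertex of the cell add up to at most
  \<open>((n - k) + k) / n = 1\<close>. The total \<open>n - k\<close> is also the number of keys
  left after the \<open>k = m - 1\<close> root keys, which is why these cells match the
  recursion.\<close>

lemma cell_subset_corner:
  assumes "n > 0" "n \<ge> k" "i \<in> compositions (Suc k) (n - k)"
  shows "cell k n i \<subseteq> corner k"
proof
  fix s assume s: "s \<in> cell k n i"
  have b: "real (i j) / real n \<le> s j" "s j < (real (i j) + 1) / real n" if "j < k" for j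
    using s that by (auto simp: cell_def PiE_iff)
  have "0 \<le> s j" if "j < k" for j
    using b(1)[OF that] by (rule order_trans[rotated]) auto
  moreover have "(\<Sum>j<k. s j) \<le> (\<Sum>j<k. (real (i j) + 1) / real n)"
    using b(2) by (intro sum_mono) (auto intro: less_imp_le)
  then have "(\<Sum>j<k. s j) \<le> (real (\<Sum>j<k. i j) + k) / real n"
    by (simp add: sum.distrib flip: sum_divide_distrib)
  moreover have "(\<Sum>j<k. i j) \<le> n - k"
    using assms(3) by (simp add: compositions_def)
  then have "(\<Sum>j<k. i j) + k \<le> n"
    using assms(2) by simp
  then have "real (\<Sum>j<k. i j) + k \<le> n"
    by (simp only: of_nat_add[symmetric] of_nat_le_iff)
  then have "(real (\<Sum>j<k. i j) + k) / real n \<le> 1"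
    using assms(1) by simp
  ultimately show "s \<in> corner k"
    using s by (auto simp: corner_def cell_def space_PiM)
qed

text \<open>The cell is found by rounding \<open>n * s j\<close> down; the ignored last part takes
  up what is missing to the total, which is now \<open>n\<close> because the rounded coordinates can
  add up to that much.\<close>

lemma corner_subset_cells:
  assumes "n > 0"
  shows "corner k \<subseteq> (\<Union>i\<in>compositions (Suc k) n. cell k n i)"
proof
  fix s assume s: "s \<in> corner k"
  define f where "f j = nat \<lfloor>real n * s j\<rfloor>" for j
  have f: "real (f j) \<le> real n * s j" "real n * s j < real (f j) + 1" if "j < k" for j
  proof -
    have "0 \<le> real n * s j" using s that by (auto simp: corner_def)
    then show "real (f j) \<le> real n * s j" "real n * s j < real (f j) + 1"
      by (auto simp: f_def)
  qed
  have "real (\<Sum>j<k. f j) \<le> (\<Sum>j<k. real n * s j)"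
    unfolding of_nat_sum using f by (intro sum_mono) auto
  also have "\<dots> = real n * (\<Sum>j<k. s j)"
    by (simp add: sum_distrib_left)
  also have "\<dots> \<le> real n * 1"
    using s by (intro mult_left_mono) (auto simp: corner_def)
  finally have sum: "(\<Sum>j<k. f j) \<le> n" by linarith
  define i where "i j = (if j < k then f j else if j = k then n - (\<Sum>j<k. f j) else 0)" for j
  have "i \<in> compositions (Suc k) n"
    using sum by (auto simp: compositions_def i_def)
  moreover have "s \<in> cell k n i"
    using s f assms by (auto simp: corner_def cell_def space_PiM PiE_iff i_def field_simps)
  ultimately show "s \<in> (\<Union>i\<in>compositions (Suc k) n. cell k n i)" by blast
qed

lemma emeasure_cells:
  assumes "n > 0"
  shows "emeasure (Pi\<^sub>M {..<k} (\<lambda>_. lborel)) (\<Union>i\<in>compositions (Suc k) N. cell k n i)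
    = ennreal (real (card (compositions (Suc k) N)) * (1 / real n) ^ k)"
proof -
  have "emeasure (Pi\<^sub>M {..<k} (\<lambda>_. lborel)) (\<Union>i\<in>compositions (Suc k) N. cell k n i)
     = (\<Sum>i\<in>compositions (Suc k) N. emeasure (Pi\<^sub>M {..<k} (\<lambda>_. lborel)) (cell k n i))"
    using disjoint_cells[OF assms] by (intro sum_emeasure[symmetric]) auto
  then show ?thesis
    by (simp add: emeasure_cell[OF assms] ennreal_mult' ennreal_of_nat_eq_real_of_nat)
qed

definition corner_content :: "nat \<Rightarrow> real" where
  "corner_content k = measure (Pi\<^sub>M {..<k} (\<lambda>_. lborel)) (corner k)"

text \<open>The cells for total \<open>n - k\<close> are disjoint and fit into the corner, those for
  total \<open>n\<close> cover it. Each has volume \<open>(1 / n) ^ k\<close>, so counting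
  compositions bounds the volume from both sides.\<close>

lemma
  assumes "n > 0"
  shows emeasure_corner: "emeasure (Pi\<^sub>M {..<k} (\<lambda>_. lborel)) (corner k) = ennreal (corner_content k)"
    and corner_content_le: "corner_content k \<le> real ((n + k) choose k) * (1 / real n) ^ k"
    and corner_content_ge: "n \<ge> k \<Longrightarrow> real (n choose k) * (1 / real n) ^ k \<le> corner_content k"
proof -
  have card: "card (compositions (Suc k) N) = (N + k) choose k" for N
    using binomial_symmetric[of N "N + k"] by (simp add: card_compositions)
  have "emeasure (Pi\<^sub>M {..<k} (\<lambda>_. lborel)) (corner k)
      \<le> emeasure (Pi\<^sub>M {..<k} (\<lambda>_. lborel)) (\<Union>i\<in>compositions (Suc k) n. cell k n i)"
    using corner_subset_cells[OF assms] by (intro emeasure_mono) auto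
  then have le: "emeasure (Pi\<^sub>M {..<k} (\<lambda>_. lborel)) (corner k) \<le> ennreal (real ((n + k) choose k) * (1 / real n) ^ k)"
    by (simp add: emeasure_cells[OF assms] card)
  then show eq: "emeasure (Pi\<^sub>M {..<k} (\<lambda>_. lborel)) (corner k) = ennreal (corner_content k)"
    unfolding corner_content_def by (intro emeasure_eq_ennreal_measure) (auto simp: top_unique)
  show "corner_content k \<le> real ((n + k) choose k) * (1 / real n) ^ k"
    using le unfolding eq by (subst (asm) ennreal_le_iff) auto
  assume nk: "n \<ge> k"
  have "emeasure (Pi\<^sub>M {..<k} (\<lambda>_. lborel)) (\<Union>i\<in>compositions (Suc k) (n - k). cell k n i)
      \<le> emeasure (Pi\<^sub>M {..<k} (\<lambda>_. lborel)) (corner k)"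
    using cell_subset_corner[OF assms nk] by (intro emeasure_mono) auto
  then show "real (n choose k) * (1 / real n) ^ k \<le> corner_content k"
    unfolding emeasure_cells[OF assms] eq card using nk
    by (subst (asm) ennreal_le_iff) (auto simp: corner_content_def)
qed

lemma corner_content_pos: "corner_content k > 0"
proof -
  have "0 < real (Suc k choose k) * (1 / real (Suc k)) ^ k" by simp
  also have "\<dots> \<le> corner_content k" by (intro corner_content_ge) auto
  finally show ?thesis .
qed

text \<open>Number of cells known to lie inside the corner divided by the number of covering
  cells.\<close>

definition grid_ratio :: "nat \<Rightarrow> nat \<Rightarrow> real" where
  "grid_ratio k n = real (n choose k) / real ((n + k) choose k)"

lemma grid_ratio_tendsto: "grid_ratio k \<longlonglongrightarrow> 1"
proof -
  have eq: "grid_ratio k n = (\<Prod>i<k. (real n - real i) / (real (n + k) - real i))" for n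
    by (simp add: grid_ratio_def binomial_gbinomial gbinomial_prod_rev prod_dividef atLeast0LessThan)
  have "(\<lambda>n. (real n - real i) / (real (n + k) - real i)) \<longlonglongrightarrow> 1" for i
    by real_asymp
  then have "(\<lambda>n. \<Prod>i<k. (real n - real i) / (real (n + k) - real i)) \<longlonglongrightarrow> (\<Prod>i<k. 1)"
    by (intro tendsto_prod)
  then show ?thesis by (simp add: eq[abs_def])
qed

text \<open>The right-hand side is the probability that a uniform point of the corner hits an inner
  cell. Replacing the volume of the corner by that of the covering cells makes it smaller.\<close>

lemma grid_ratio_le:
  assumes "n > 0" "n \<ge> k"
  shows "grid_ratio k n \<le> real (n choose k) * (1 / real n) ^ k / corner_content k"
proof -
  have B: "real ((n + k) choose k) > 0"
    using zero_less_binomial[of k "n + k"] by (simp del: zero_less_binomial)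
  have "corner_content k * real n ^ k \<le> real ((n + k) choose k)"
    using corner_content_le[OF assms(1), of k] assms(1) by (simp add: field_simps)
  then have "real (n choose k) / real ((n + k) choose k) \<le> real (n choose k) / (corner_content k * real n ^ k)"
    using corner_content_pos[of k] assms(1) B by (intro divide_left_mono) auto
  then show ?thesis
    by (simp add: grid_ratio_def power_divide mult.commute)
qed

definition extend_corner :: "nat \<Rightarrow> (nat \<Rightarrow> real) \<Rightarrow> nat \<Rightarrow> real" where
  "extend_corner m s = (\<lambda>j\<in>{..<m}. if j < m - 1 then s j else 1 - (\<Sum>i<m - 1. s i))"

lemma uniform_simplex_altdef:
  "uniform_simplex m = distr (uniform_measure (Pi\<^sub>M {..<m - 1} (\<lambda>_. lborel)) (corner (m - 1)))
     (Pi\<^sub>M {..<m} (\<lambda>_. borel)) (extend_corner m)"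
  by (simp add: uniform_simplex_def Let_def corner_def extend_corner_def[abs_def])

lemma measurable_extend_corner [measurable]:
  "extend_corner m \<in> Pi\<^sub>M {..<m - 1} (\<lambda>_. lborel) \<rightarrow>\<^sub>M Pi\<^sub>M {..<m} (\<lambda>_. borel)"
  unfolding extend_corner_def[abs_def]
proof (rule measurable_restrict)
  fix j assume "j \<in> {..<m}"
  have "(\<lambda>s. s i) \<in> borel_measurable (Pi\<^sub>M {..<m - 1} (\<lambda>_. lborel))" if "i < m - 1" for i
    using measurable_component_singleton[of i "{..<m-1}" "\<lambda>_. lborel"] that by simp
  then show "(\<lambda>s. if j < m - 1 then s j else 1 - (\<Sum>i<m - 1. s i)) \<in> borel_measurable (Pi\<^sub>M {..<m - 1} (\<lambda>_. lborel))"
    by (cases "j < m - 1") (auto intro!: borel_measurable_diff borel_measurable_sum)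
qed

lemma measurable_extend_corner' [measurable]:
  "extend_corner m \<in> uniform_measure (Pi\<^sub>M {..<m - 1} (\<lambda>_. lborel)) (corner (m - 1)) \<rightarrow>\<^sub>M Pi\<^sub>M {..<m} (\<lambda>_. borel)"
  using measurable_extend_corner by (simp cong: measurable_cong_sets)

lemma extend_corner_in_std_simplex:
  assumes "s \<in> corner (m - 1)" "m > 0"
  shows "extend_corner m s \<in> std_simplex m"
proof -
  have "{..<m} = insert (m - 1) {..<m - 1}" using assms by auto
  then have "(\<Sum>j<m. extend_corner m s j) = extend_corner m s (m - 1) + (\<Sum>j<m - 1. extend_corner m s j)"
    by (metis finite_lessThan lessThan_iff less_irrefl sum.insert)
  also have "(\<Sum>j<m - 1. extend_corner m s j) = (\<Sum>j<m - 1. s j)"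
    by (intro sum.cong) (auto simp: extend_corner_def)
  finally show ?thesis
    using assms by (auto simp: std_simplex_def corner_def extend_corner_def)
qed

lemma sets_uniform_simplex [simp, measurable_cong]: "sets (uniform_simplex m) = sets (Pi\<^sub>M {..<m} (\<lambda>_. borel))"
  by (simp add: uniform_simplex_altdef)

lemma prob_space_uniform_corner: "prob_space (uniform_measure (Pi\<^sub>M {..<k} (\<lambda>_. lborel)) (corner k))"
  using emeasure_corner[of 1 k] corner_content_pos[of k] by (intro prob_space_uniform_measure) auto

lemma prob_space_uniform_simplex: "prob_space (uniform_simplex m)"
  unfolding uniform_simplex_altdef
  by (intro prob_space.prob_space_distr prob_space_uniform_corner measurable_extend_corner')

lemma sets_std_simplex [measurable]:
  "{s \<in> space (Pi\<^sub>M {..<m} (\<lambda>_. borel)). s \<in> std_simplex m} \<in> sets (Pi\<^sub>M {..<m} (\<lambda>_. borel))"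
proof -
  have "{s \<in> space (Pi\<^sub>M {..<m} (\<lambda>_. borel)). s \<in> std_simplex m}
     = (\<Pi>\<^sub>E j\<in>{..<m}. {0..}) \<inter> {s \<in> space (Pi\<^sub>M {..<m} (\<lambda>_. borel)). (\<Sum>j<m. s j) = 1}"
    by (auto simp: std_simplex_def space_PiM PiE_iff extensional_def)
  also have "\<dots> \<in> sets (Pi\<^sub>M {..<m} (\<lambda>_. borel))"
    by (intro sets.Int sets_PiM_I_finite borel_measurable_eq borel_measurable_sum)
      (auto intro!: measurable_component_singleton)
  finally show ?thesis .
qed

lemma AE_uniform_simplex:
  assumes "m > 0"
  shows "AE s in uniform_simplex m. s \<in> std_simplex m"
  unfolding uniform_simplex_altdef
proof (subst AE_distr_iff)
  show "AE s in uniform_measure (Pi\<^sub>M {..<m - 1} (\<lambda>_. lborel)) (corner (m - 1)). extend_corner m s \<in> std_simplex m"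
    using extend_corner_in_std_simplex assms by (intro AE_uniform_measureI) auto
qed (rule measurable_extend_corner' sets_std_simplex)+

section \<open>Averages over compositions against integrals over the simplex\<close>

definition average :: "'a set \<Rightarrow> ('a \<Rightarrow> 'b::real_vector) \<Rightarrow> 'b" where
  "average A f = (1 / real (card A)) *\<^sub>R (\<Sum>x\<in>A. f x)"

lemma norm_average_le:
  fixes f :: "'a \<Rightarrow> 'b::real_normed_vector"
  assumes "A \<noteq> {}" "finite A" "\<And>x. x \<in> A \<Longrightarrow> norm (f x) \<le> K"
  shows "norm (average A f) \<le> K"
proof -
  have "norm (\<Sum>x\<in>A. f x) \<le> real (card A) * K"
    using assms(3) by (intro sum_norm_bound) auto
  moreover have "card A > 0" using assms by (simp add: card_gt_0_iff)
  ultimately show ?thesis by (simp add: average_def field_simps)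
qed

text \<open>A uniform point \<open>S\<close> of the simplex, conditioned to lie in a grid cell inside the simplex,
  rounds down to a uniform composition; the conditioning event has probability close to \<open>1\<close>.\<close>

lemma average_compositions_approx:
  fixes F :: "(nat \<Rightarrow> nat) \<Rightarrow> 'b::{banach, second_countable_topology}"
  assumes m: "m \<ge> 2" "n \<ge> m - 1"
    and G [measurable]: "G \<in> borel_measurable (Pi\<^sub>M {..<m} (\<lambda>_. borel))"
    and F_le: "\<And>i. i \<in> compositions m (n + 1 - m) \<Longrightarrow> norm (F i) \<le> K"
    and G_le: "\<And>s. s \<in> std_simplex m \<Longrightarrow> norm (G s) \<le> K"
    and close: "\<And>i s. i \<in> compositions m (n + 1 - m) \<Longrightarrow> s \<in> std_simplex m \<Longrightarrow>
      (\<And>j. j < m \<Longrightarrow> \<bar>real (i j) / real n - s j\<bar> \<le> real m / real n) \<Longrightarrow> norm (F i - G s) \<le> \<epsilon>"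
    and "\<epsilon> \<ge> 0"
  shows "norm (average (compositions m (n + 1 - m)) F - (\<integral>s. G s \<partial>uniform_simplex m))
    \<le> \<epsilon> + 2 * K * (1 - grid_ratio (m - 1) n)"
proof -
  define k where "k = m - 1"
  have mk: "m = Suc k" "n \<ge> k" "k > 0" "n > 0" using m by (auto simp: k_def)
  have N: "n + 1 - m = n - k" using mk by simp
  let ?R = "Pi\<^sub>M {..<k} (\<lambda>_. lborel) :: (nat \<Rightarrow> real) measure"
  let ?C = "compositions m (n + 1 - m)"
  define P where "P = uniform_measure ?R (corner k)"
  interpret P: prob_space P
    unfolding P_def by (rule prob_space_uniform_corner)
  have sets_P [measurable_cong, simp]: "sets P = sets ?R" by (simp add: P_def)
  note c_pos = corner_content_pos[of k]
  have "?C \<noteq> {}" using mk by simp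
  then have card_pos: "card ?C > 0" by (simp add: card_gt_0_iff)
  have K: "K \<ge> 0"
    using \<open>?C \<noteq> {}\<close> F_le norm_ge_zero order_trans by blast
  define q where "q = (1 / real n) ^ k / corner_content k"
  have prob_cell: "P.prob (cell k n i) = q" if "i \<in> ?C" for i
  proof -
    have "corner k \<inter> cell k n i = cell k n i"
      using cell_subset_corner[of n k i] that mk N by auto
    then show ?thesis
      unfolding P_def q_def using emeasure_corner[of n k] emeasure_cell[of n k i] mk c_pos
      by (simp add: measure_uniform_measure measure_def divide_ennreal del: ennreal_power power_divide)
  qed
  define p where "p = real (card ?C) * q"
  have card_C: "card ?C = n choose k"
    using mk N binomial_symmetric[of k n] by (simp add: card_compositions)
  have p_ge: "grid_ratio k n \<le> p"
    using grid_ratio_le[of n k] mk(2-4) by (simp only: p_def q_def card_C times_divide_eq_right)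
  have p_le: "p \<le> 1"
    unfolding p_def q_def card_C using corner_content_ge[of n k] mk(2-4) c_pos by (simp add: field_simps)
  define E where "E = extend_corner m"
  have E_meas [measurable]: "E \<in> P \<rightarrow>\<^sub>M Pi\<^sub>M {..<m} (\<lambda>_. borel)"
    unfolding E_def P_def k_def by (rule measurable_extend_corner')
  have int_G: "(\<integral>s. G s \<partial>uniform_simplex m) = (\<integral>s. G (E s) \<partial>P)"
    unfolding uniform_simplex_altdef k_def[symmetric] P_def[symmetric] E_def[symmetric]
    by (rule integral_distr) measurable
  have AE_corner: "AE s in P. s \<in> corner k"
    unfolding P_def by (intro AE_uniform_measureI) auto
  have E_simplex: "E s \<in> std_simplex m" if "s \<in> corner k" for s
    using extend_corner_in_std_simplex[of s m] that mk by (simp add: E_def)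
  \<comment> \<open>On a cell \<open>H\<close> is \<open>F\<close> at the composition obtained by
    rounding down, and 0 off the cells; \<open>U\<close> is the indicator of the union of the
    cells.\<close>
  define H where "H s = (\<Sum>i\<in>?C. indicator (cell k n i) s *\<^sub>R F i)" for s
  define U where "U s = (\<Sum>i\<in>?C. indicator (cell k n i) s :: real)" for s
  have in_cell: "H s = F i \<and> U s = 1" if "i \<in> ?C" "s \<in> cell k n i" for i s
  proof -
    have ind: "indicator (cell k n i') s = (if i' = i then 1 else 0 :: real)" if "i' \<in> ?C" for i'
      using disjoint_cells[of n k "n - k"] that \<open>i \<in> ?C\<close> \<open>s \<in> cell k n i\<close> mk N
      by (auto simp: disjoint_family_on_def indicator_def)
    have "H s = (\<Sum>i'\<in>?C. if i' = i then F i' else 0)"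
      unfolding H_def by (intro sum.cong refl) (simp add: ind)
    moreover have "U s = (\<Sum>i'\<in>?C. if i' = i then 1 else 0)"
      unfolding U_def by (intro sum.cong refl) (simp add: ind)
    ultimately show ?thesis
      using that by simp
  qed
  have not_in_cell: "H s = 0 \<and> U s = 0" if "\<And>i. i \<in> ?C \<Longrightarrow> s \<notin> cell k n i" for s
    using that by (simp add: H_def U_def)
  \<comment> \<open>Inside a cell closeness applies to the rounded point; on the uncovered rest of
    the corner \<open>H\<close> vanishes and \<open>G\<close> is at most \<open>K\<close>.\<close>
  have bound: "norm (H s - G (E s)) \<le> \<epsilon> + K * (1 - U s)" if s: "s \<in> corner k" for s
  proof (cases "\<exists>i\<in>?C. s \<in> cell k n i")
    case True
    then obtain i where i: "i \<in> ?C" "s \<in> cell k n i" by blast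
    have b: "real (i j) \<le> real n * s j" "real n * s j \<le> real (i j) + 1" if "j < k" for j
      using i(2) that mk by (auto simp: cell_def PiE_iff field_simps intro: less_imp_le)
    have "\<bar>real (i j) / real n - E s j\<bar> \<le> real m / real n" if "j < m" for j
    proof -
      have "\<bar>real (i j) - real n * E s j\<bar> \<le> real m"
      proof (cases "j < k")
        case True
        then show ?thesis
          using b[OF True] mk by (simp add: E_def extend_corner_def)
      next
        case False
        \<comment> \<open>The last coordinate collects the rounding errors of all others, a number
          between 0 and \<open>k\<close>, and loses the \<open>k\<close> root keys, so it is off by
          at most \<open>k\<close>. This explains the tolerance \<open>m / n\<close> instead of
          \<open>1 / n\<close>.\<close>
        then have j: "j = k" using that mk by simp
        have "(\<Sum>j<k. i j) + i k = n - k"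
          using i(1) mk N by (simp add: compositions_def)
        then have ik: "real (i k) = real n - real k - (\<Sum>j<k. real (i j))"
          using mk(2) by (simp flip: of_nat_sum)
        have "(\<Sum>j<k. real (i j)) \<le> (\<Sum>j<k. real n * s j)"
          using b by (intro sum_mono) auto
        moreover have "(\<Sum>j<k. real n * s j) \<le> (\<Sum>j<k. real (i j) + 1)"
          using b by (intro sum_mono) auto
        ultimately show ?thesis
          using mk by (simp add: j ik E_def extend_corner_def sum.distrib sum_distrib_left algebra_simps)
      qed
      moreover have "real (i j) / real n - E s j = (real (i j) - real n * E s j) / real n"
        using mk(4) by (simp add: diff_divide_distrib)
      ultimately show ?thesis
        by (simp add: divide_right_mono)
    qed
    then have "norm (F i - G (E s)) \<le> \<epsilon>"
      using i E_simplex[OF s] by (intro close)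
    then show ?thesis
      using in_cell[OF i] by simp
  next
    case False
    then show ?thesis
      using not_in_cell[of s] G_le[OF E_simplex[OF s]] \<open>\<epsilon> \<ge> 0\<close> by auto
  qed
  have [measurable]: "H \<in> borel_measurable P" "U \<in> borel_measurable P"
    unfolding H_def U_def by measurable
  have int_cell: "has_bochner_integral P (indicator (cell k n i) :: _ \<Rightarrow> real) q" if "i \<in> ?C" for i
    using has_bochner_integral_real_indicator[of "cell k n i" P] prob_cell[OF that]
      P.emeasure_finite[of "cell k n i"]
    by (simp add: less_top[symmetric])
  have HBI_H: "has_bochner_integral P H (\<Sum>i\<in>?C. q *\<^sub>R F i)"
    unfolding H_def by (intro has_bochner_integral_sum has_bochner_integral_scaleR_left int_cell)
  have HBI_U: "has_bochner_integral P U p"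
  proof -
    have "has_bochner_integral P U (\<Sum>i\<in>?C. q)"
      unfolding U_def by (intro has_bochner_integral_sum int_cell)
    then show ?thesis by (simp add: p_def)
  qed
  have int_GE: "integrable P (\<lambda>s. G (E s))"
    using AE_corner E_simplex G_le by (intro P.integrable_const_bound[of _ K]) (auto elim!: eventually_mono)
  have H_avg: "(\<integral>s. H s \<partial>P) = p *\<^sub>R average ?C F"
    using HBI_H card_pos
    by (simp add: has_bochner_integral_iff p_def average_def flip: scaleR_sum_right)
  have "norm ((\<integral>s. H s \<partial>P) - (\<integral>s. G (E s) \<partial>P)) = norm (\<integral>s. H s - G (E s) \<partial>P)"
    using HBI_H int_GE by (simp add: has_bochner_integral_iff)
  also have "\<dots> \<le> (\<integral>s. norm (H s - G (E s)) \<partial>P)"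
    by (rule integral_norm_bound)
  also have "\<dots> \<le> (\<integral>s. \<epsilon> + K * (1 - U s) \<partial>P)"
    using HBI_H HBI_U int_GE AE_corner bound
    by (intro integral_mono_AE) (auto simp: has_bochner_integral_iff elim!: eventually_mono)
  also have "\<dots> = \<epsilon> + K * (1 - p)"
    using HBI_U by (simp add: has_bochner_integral_iff P.prob_space)
  finally have A: "norm ((\<integral>s. H s \<partial>P) - (\<integral>s. G (E s) \<partial>P)) \<le> \<epsilon> + K * (1 - p)" .
  \<comment> \<open>The integral of \<open>H\<close> is only \<open>p\<close> times the average.
    This second loss of \<open>K * (1 - p)\<close>, besides the one on the uncovered set, gives the
    factor 2.\<close>
  have "norm (average ?C F - (\<integral>s. H s \<partial>P)) = norm ((1 - p) *\<^sub>R average ?C F)"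
    by (simp add: H_avg scaleR_left_diff_distrib)
  also have "\<dots> \<le> (1 - p) * K"
    using p_le norm_average_le[OF \<open>?C \<noteq> {}\<close> finite_compositions F_le]
    by (auto intro!: mult_left_mono)
  finally have B: "norm (average ?C F - (\<integral>s. H s \<partial>P)) \<le> (1 - p) * K" .
  have "norm (average ?C F - (\<integral>s. G (E s) \<partial>P)) \<le> (1 - p) * K + (\<epsilon> + K * (1 - p))"
    using norm_triangle_mono[OF B A] by (simp add: algebra_simps)
  also have "\<dots> = \<epsilon> + 2 * K * (1 - p)"
    by (simp add: algebra_simps)
  also have "\<dots> \<le> \<epsilon> + 2 * K * (1 - grid_ratio k n)"
    using p_ge K by (intro add_left_mono mult_left_mono) auto
  finally show ?thesis
    by (simp add: int_G k_def)
qed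

section \<open>The contraction factor\<close>

lemma sum_powr_le_1:
  assumes "s \<in> std_simplex m" "\<beta> \<ge> 1"
  shows "(\<Sum>j<m. s j powr \<beta>) \<le> 1"
proof -
  have "(\<Sum>j<m. s j powr \<beta>) \<le> (\<Sum>j<m. s j)"
  proof (intro sum_mono)
    fix j assume "j \<in> {..<m}"
    then show "s j powr \<beta> \<le> s j"
      using powr_mono'[of 1 \<beta> "s j"] assms std_simplex_le_1[OF assms(1), of j]
      by (cases "s j = 0") (auto simp: std_simplex_def)
  qed
  then show ?thesis using assms by (simp add: std_simplex_def)
qed

definition contraction_factor :: "nat \<Rightarrow> real \<Rightarrow> real" where
  "contraction_factor m \<beta> = (\<integral>s. (\<Sum>j<m. s j powr \<beta>) \<partial>uniform_simplex m)"

lemma measurable_component_uniform_simplex: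
  "j < m \<Longrightarrow> (\<lambda>s. s j) \<in> borel_measurable (Pi\<^sub>M {..<m} (\<lambda>_. borel))"
  by (rule measurable_component_singleton) simp

lemma borel_measurable_sum_powr [measurable]:
  "(\<lambda>s. \<Sum>j<m. s j powr \<beta> :: real) \<in> borel_measurable (Pi\<^sub>M {..<m} (\<lambda>_. borel))"
  using measurable_component_uniform_simplex[of _ m]
  by (intro borel_measurable_sum powr_real_measurable) auto

lemma integrable_sum_powr:
  assumes "m > 0" "\<beta> \<ge> 1"
  shows "integrable (uniform_simplex m) (\<lambda>s. \<Sum>j<m. s j powr \<beta>)"
proof -
  interpret prob_space "uniform_simplex m" by (rule prob_space_uniform_simplex)
  show ?thesis
    using AE_uniform_simplex[OF assms(1)] sum_powr_le_1 assms
    by (intro integrable_const_bound[of _ 1]) (auto elim!: eventually_mono simp: sum_nonneg)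
qed

lemma contraction_factor_nonneg: "contraction_factor m \<beta> \<ge> 0"
  unfolding contraction_factor_def by (intro integral_nonneg_AE) (auto simp: sum_nonneg)

text \<open>If the expectation reached its upper bound 1, then \<open>s 0\<close> would almost
  surely not lie strictly between 0 and 1, since \<open>s powr \<beta> < s\<close> there. A grid
  cell inside the corner contradicts this, having positive probability.\<close>

lemma contraction_factor_less_1:
  assumes m: "m \<ge> 2" and \<beta>: "\<beta> > 1"
  shows "contraction_factor m \<beta> < 1"
proof (rule ccontr)
  interpret prob_space "uniform_simplex m" by (rule prob_space_uniform_simplex)
  let ?f = "\<lambda>s. \<Sum>j<m. s j powr \<beta>"
  have int: "integrable (uniform_simplex m) ?f"
    using m \<beta> by (intro integrable_sum_powr) auto
  have le: "AE s in uniform_simplex m. 0 \<le> 1 - ?f s"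
    using AE_uniform_simplex[of m] sum_powr_le_1[of _ m \<beta>] m \<beta> by (auto elim!: eventually_mono)
  assume "\<not> contraction_factor m \<beta> < 1"
  moreover have "(\<integral>s. 1 - ?f s \<partial>uniform_simplex m) = 1 - contraction_factor m \<beta>"
    using int by (simp add: contraction_factor_def prob_space)
  moreover have "0 \<le> (\<integral>s. 1 - ?f s \<partial>uniform_simplex m)"
    using le by (rule integral_nonneg_AE)
  ultimately have "(\<integral>s. 1 - ?f s \<partial>uniform_simplex m) = 0" by linarith
  then have Z: "AE s in uniform_simplex m. 1 - ?f s = 0"
    using integral_nonneg_eq_0_iff_AE[OF _ le] int by simp
  have pos: "1 - ?f s > 0" if s: "s \<in> std_simplex m" and s0: "0 < s 0" "s 0 < 1" for s
  proof -
    have "s j powr \<beta> \<le> s j" if "j < m" for j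
      using powr_mono'[of 1 \<beta> "s j"] \<beta> std_simplex_le_1[OF s that] s that
      by (cases "s j = 0") (auto simp: std_simplex_def)
    moreover have "s 0 powr \<beta> < s 0 powr 1"
      using \<beta> s0 by (intro powr_less_mono') auto
    ultimately have "?f s < (\<Sum>j<m. s j)"
      using m s0 by (intro sum_strict_mono_ex1) auto
    then show ?thesis using s by (simp add: std_simplex_def)
  qed
  from AE_uniform_simplex[of m] m have "AE s in uniform_simplex m. s \<in> std_simplex m"
    by simp
  with Z have "AE s in uniform_simplex m. \<not> (0 < s 0 \<and> s 0 < 1)"
  proof eventually_elim
    case (elim s)
    then show ?case using pos[of s] by auto
  qed
  moreover have "{s \<in> space (Pi\<^sub>M {..<m} (\<lambda>_. borel)). \<not> (0 < s 0 \<and> s 0 < (1::real))} \<in> sets (Pi\<^sub>M {..<m} (\<lambda>_. borel))"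
  proof -
    have "(\<lambda>s. s 0) -` (- {0<..<1::real}) \<inter> space (Pi\<^sub>M {..<m} (\<lambda>_. borel)) \<in> sets (Pi\<^sub>M {..<m} (\<lambda>_. borel))"
      using m by (intro measurable_sets[OF measurable_component_uniform_simplex]) auto
    also have "(\<lambda>s. s 0) -` (- {0<..<1::real}) \<inter> space (Pi\<^sub>M {..<m} (\<lambda>_. borel))
        = {s \<in> space (Pi\<^sub>M {..<m} (\<lambda>_. borel)). \<not> (0 < s 0 \<and> s 0 < (1::real))}"
      by auto
    finally show ?thesis .
  qed
  ultimately have AE: "AE s in uniform_measure (Pi\<^sub>M {..<m - 1} (\<lambda>_. lborel)) (corner (m - 1)).
      \<not> (0 < extend_corner m s 0 \<and> extend_corner m s 0 < 1)"
    unfolding uniform_simplex_altdef by (subst (asm) AE_distr_iff) (rule measurable_extend_corner', assumption)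
  define k where "k = m - 1"
  have "k > 0" using m by (simp add: k_def)
  \<comment> \<open>The cell of mesh \<open>1 / (2 * k)\<close> with all lower coordinates
    \<open>1 / (2 * k)\<close>: its first coordinate stays in \<open>(0,1)\<close>, and its
    \<open>k\<close> ones add up to \<open>2 * k - k\<close>, so it lies in the corner.\<close>
  define i where "i j = (if j < k then 1 else if j = k then 0 else (0::nat))" for j
  have i: "i \<in> compositions (Suc k) (2 * k - k)"
    by (auto simp: compositions_def i_def)
  let ?A = "cell k (2 * k) i"
  have sub: "?A \<subseteq> corner k"
    using \<open>k > 0\<close> i by (intro cell_subset_corner) auto
  have "0 < s 0 \<and> s 0 < 1" if "s \<in> ?A" for s
  proof -
    have "1 / real (2 * k) \<le> s 0" "s 0 < (1 + 1) / real (2 * k)"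
      using that \<open>k > 0\<close> by (auto simp: cell_def PiE_iff i_def)
    moreover have "0 < 1 / real (2 * k)" "(1 + 1) / real (2 * k) \<le> 1"
      using \<open>k > 0\<close> by (auto simp: field_simps)
    ultimately show ?thesis by linarith
  qed
  then have "0 < extend_corner m s 0 \<and> extend_corner m s 0 < 1" if "s \<in> ?A" for s
    using that \<open>k > 0\<close> by (simp add: extend_corner_def k_def)
  then have "AE s in uniform_measure (Pi\<^sub>M {..<k} (\<lambda>_. lborel)) (corner k). s \<notin> ?A"
    using AE unfolding k_def[symmetric] by (auto elim!: eventually_mono)
  then have "measure (uniform_measure (Pi\<^sub>M {..<k} (\<lambda>_. lborel)) (corner k)) ?A = 0"
    by (subst prob_space.prob_eq_0[OF prob_space_uniform_corner]) auto
  moreover have "corner k \<inter> ?A = ?A" using sub by auto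
  ultimately show False
    using emeasure_corner[of 1 k] emeasure_cell[of "2 * k" k i] \<open>k > 0\<close> corner_content_pos[of k]
    by (simp add: measure_uniform_measure measure_def divide_ennreal del: ennreal_power power_divide)
qed

section \<open>Regularly varying tolls\<close>

lemma pmf_expectation_mono:
  assumes "finite (set_pmf p)" "\<And>x. x \<in> set_pmf p \<Longrightarrow> f x \<le> (g x :: real)"
  shows "measure_pmf.expectation p f \<le> measure_pmf.expectation p g"
  using assms by (intro integral_mono_AE integrable_measure_pmf_finite AE_pmfI) auto

lemma pmf_expectation_bind_finite:
  fixes h :: "'b \<Rightarrow> 'c::{banach, second_countable_topology}"
  assumes "finite (set_pmf p)" "\<And>x. x \<in> set_pmf p \<Longrightarrow> finite (set_pmf (f x))"
  shows "measure_pmf.expectation (p \<bind> f) h = measure_pmf.expectation p (\<lambda>x. measure_pmf.expectation (f x) h)"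
  using assms by (subst pmf_expectation_bind[of "set_pmf p"]) (auto simp: integral_measure_pmf[of "set_pmf p"])

lemma finite_set_Pi_pmf:
  "finite A \<Longrightarrow> (\<And>x. x \<in> A \<Longrightarrow> finite (set_pmf (p x))) \<Longrightarrow> finite (set_pmf (Pi_pmf A dflt p))"
  by (rule finite_subset[OF set_Pi_pmf_subset']) auto

lemma expectation_prod_Pi_pmf_finite:
  fixes f :: "'a \<Rightarrow> 'b \<Rightarrow> 'c::{real_normed_field, banach, second_countable_topology}"
  assumes "finite A" "\<And>x. x \<in> A \<Longrightarrow> finite (set_pmf (p x))"
  shows "measure_pmf.expectation (Pi_pmf A dflt p) (\<lambda>y. \<Prod>x\<in>A. f x (y x)) =
    (\<Prod>x\<in>A. measure_pmf.expectation (p x) (f x))"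
  using assms
proof (induction A rule: finite_induct)
  case (insert a A)
  have fin: "finite (set_pmf (Pi_pmf A dflt p))"
    using insert by (intro finite_set_Pi_pmf) auto
  have "(\<Prod>x\<in>insert a A. f x ((h(a := y)) x)) = f a y * (\<Prod>x\<in>A. f x (h x))" for y h
    using insert.hyps by (auto intro!: prod.cong)
  then have "measure_pmf.expectation (Pi_pmf (insert a A) dflt p) (\<lambda>y. \<Prod>x\<in>insert a A. f x (y x))
      = measure_pmf.expectation (p a) (\<lambda>y. measure_pmf.expectation (Pi_pmf A dflt p) (\<lambda>h. f a y * (\<Prod>x\<in>A. f x (h x))))"
    using insert fin by (simp add: Pi_pmf_insert' pmf_expectation_bind_finite del: fun_upd_apply)
  also have "\<dots> = measure_pmf.expectation (p a) (f a) * measure_pmf.expectation (Pi_pmf A dflt p) (\<lambda>h. \<Prod>x\<in>A. f x (h x))"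
    by simp
  also have "measure_pmf.expectation (Pi_pmf A dflt p) (\<lambda>h. \<Prod>x\<in>A. f x (h x)) = (\<Prod>x\<in>A. measure_pmf.expectation (p x) (f x))"
    using insert by simp
  finally show ?case
    using insert.hyps by simp
qed simp

lemma expectation_Pi_pmf_component:
  fixes f :: "'b \<Rightarrow> 'c::{banach, second_countable_topology}"
  assumes "finite A" "x \<in> A"
  shows "measure_pmf.expectation (Pi_pmf A dflt p) (\<lambda>y. f (y x)) = measure_pmf.expectation (p x) f"
proof -
  have "measure_pmf.expectation (Pi_pmf A dflt p) (\<lambda>y. f (y x))
      = measure_pmf.expectation (map_pmf (\<lambda>y. y x) (Pi_pmf A dflt p)) f"
    by simp
  then show ?thesis using assms by (simp add: Pi_pmf_component)
qed

lemma X_pmf_expectation: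
  fixes h :: "real \<Rightarrow> 'b::{banach, second_countable_topology}"
  assumes "m \<ge> 2" "n \<ge> m - 1"
  shows "measure_pmf.expectation (X_pmf m t n) h = average (compositions m (n + 1 - m))
    (\<lambda>i. measure_pmf.expectation (Pi_pmf {..<m} (t 0) (\<lambda>j. X_pmf m t (i j))) (\<lambda>y. h ((\<Sum>j<m. y j) + t n)))"
proof -
  have "finite (set_pmf (Pi_pmf {..<m} (t 0) (\<lambda>j. X_pmf m t (i j))))" for i
    by (intro finite_set_Pi_pmf) auto
  then show ?thesis
    unfolding X_pmf_rec[OF assms] average_def using assms
    by (subst pmf_expectation_bind_pmf_of_set) (auto simp: scaleR_sum_right divide_inverse)
qed

lemma average_diff: "average A f - average A g = average A (\<lambda>x. f x - g x)"
  by (simp add: average_def sum_subtractf scaleR_right_diff_distrib)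

lemma average_add: "average A f + average A g = average A (\<lambda>x. f x + g x)"
  by (simp add: average_def sum.distrib scaleR_right_distrib)

lemma average_const [simp]: "finite A \<Longrightarrow> A \<noteq> {} \<Longrightarrow> average A (\<lambda>_. c) = c"
  by (simp add: average_def sum_constant_scaleR)

lemma average_cmult: "average A (\<lambda>x. c * f x) = c * (average A f :: 'a::real_algebra)"
  by (simp add: average_def sum_distrib_left[symmetric])

lemma average_mono: "(\<And>x. x \<in> A \<Longrightarrow> f x \<le> g x) \<Longrightarrow> average A f \<le> (average A g :: real)"
  by (auto simp: average_def intro!: divide_right_mono sum_mono)

lemma norm_average: "norm (average A f) \<le> average A (\<lambda>x. norm (f x))"
  by (simp add: average_def divide_right_mono norm_sum)

text \<open>Jensen's inequality for the convex function \<open>x ^ Suc k\<close> and the normalised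
  weights, cleared of denominators.\<close>

lemma power_weighted_sum_le:
  fixes w z :: "'a \<Rightarrow> real"
  assumes "finite I" "\<And>i. i \<in> I \<Longrightarrow> w i \<ge> 0" "\<And>i. i \<in> I \<Longrightarrow> z i \<ge> 0" and W: "(\<Sum>i\<in>I. w i) > 0"
  shows "(\<Sum>i\<in>I. w i * z i) ^ Suc k \<le> (\<Sum>i\<in>I. w i) ^ k * (\<Sum>i\<in>I. w i * z i ^ Suc k)"
proof -
  let ?W = "\<Sum>i\<in>I. w i"
  have conv: "convex_on {0::real..} (\<lambda>x. x ^ Suc k)"
    using convex_power_odd[of "Suc k"] convex_on_subset[OF convex_power_even[of "Suc k"]] by blast
  have "(\<Sum>i\<in>I. (w i / ?W) *\<^sub>R z i) ^ Suc k \<le> (\<Sum>i\<in>I. (w i / ?W) * z i ^ Suc k)"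
    using assms by (intro convex_on_sum[OF _ _ conv]) (auto simp flip: sum_divide_distrib)
  also have "(\<Sum>i\<in>I. (w i / ?W) *\<^sub>R z i) = (\<Sum>i\<in>I. w i * z i) / ?W"
    by (simp add: sum_divide_distrib)
  also have "(\<Sum>i\<in>I. (w i / ?W) * z i ^ Suc k) = (\<Sum>i\<in>I. w i * z i ^ Suc k) / ?W"
    by (simp add: sum_divide_distrib)
  finally have "?W ^ Suc k * ((\<Sum>i\<in>I. w i * z i) / ?W) ^ Suc k \<le> ?W ^ Suc k * ((\<Sum>i\<in>I. w i * z i ^ Suc k) / ?W)"
    using W by (intro mult_left_mono) auto
  then show ?thesis
    using W by (simp add: power_divide del: power_Suc) simp
qed

lemma powr_diff_le:
  fixes x y \<beta> :: real
  assumes "x \<in> {0..1}" "y \<in> {0..1}" "\<beta> \<ge> 1"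
  shows "\<bar>x powr \<beta> - y powr \<beta>\<bar> \<le> \<beta> * \<bar>x - y\<bar>"
proof -
  have *: "y powr \<beta> - x powr \<beta> \<le> \<beta> * (y - x)" if xy: "0 \<le> x" "x < y" "y \<le> 1" for x y :: real
  proof (cases "x = 0")
    case True
    have "y powr \<beta> \<le> y powr 1"
      using xy \<open>\<beta> \<ge> 1\<close> by (intro powr_mono') auto
    also have "\<dots> \<le> \<beta> * y"
      using xy \<open>\<beta> \<ge> 1\<close> by simp
    finally show ?thesis using True by simp
  next
    case False
    then have "\<exists>z. z > x \<and> z < y \<and> y powr \<beta> - x powr \<beta> = (y - x) * (\<beta> * z powr (\<beta> - 1))"
      using xy by (intro MVT2) (auto intro!: derivative_eq_intros)
    then obtain z where z: "z > x" "z < y" "y powr \<beta> - x powr \<beta> = (y - x) * (\<beta> * z powr (\<beta> - 1))"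
      by blast
    have "(y - x) * (\<beta> * z powr (\<beta> - 1)) \<le> (y - x) * (\<beta> * 1)"
      using z xy \<open>\<beta> \<ge> 1\<close> by (intro mult_left_mono powr_le1) auto
    then show ?thesis using z(3) by (simp add: mult.commute)
  qed
  have "\<bar>x powr \<beta> - y powr \<beta>\<bar> \<le> \<beta> * \<bar>x - y\<bar>" if "x < y" "x \<in> {0..1}" "y \<in> {0..1}" for x y
    using *[of x y] that powr_mono2[of \<beta> x y] \<open>\<beta> \<ge> 1\<close> by auto
  from this[of x y] this[of y x] show ?thesis
    using assms by (cases x y rule: linorder_cases) (auto simp: abs_minus_commute)
qed

text \<open>In effect \<open>limsup D <= r * limsup D\<close> for a bounded sequence. Boundedness
  comes first. If then \<open>D <= c\<close> from some index on, the finitely many earlier indices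
  carry vanishing weight by \<open>w0\<close>, so eventually \<open>D <= r * c + \<eta>\<close>;
  this step is iterated.\<close>

lemma averaged_contraction_tendsto_0:
  fixes D e :: "nat \<Rightarrow> real" and w :: "nat \<Rightarrow> nat \<Rightarrow> real" and A :: "nat \<Rightarrow> (nat \<Rightarrow> nat) set"
  assumes rec: "eventually (\<lambda>n. D n \<le> e n + average (A n) (\<lambda>i. \<Sum>j<m. w n (i j) * D (i j))) sequentially"
    and A: "eventually (\<lambda>n. finite (A n) \<and> A n \<noteq> {} \<and> (\<forall>i\<in>A n. \<forall>j<m. i j < n)) sequentially"
    and e: "e \<longlonglongrightarrow> 0"
    and r: "eventually (\<lambda>n. average (A n) (\<lambda>i. \<Sum>j<m. w n (i j)) \<le> r) sequentially" "0 \<le> r" "r < 1"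
    and w0: "\<And>l. (\<lambda>n. w n l) \<longlonglongrightarrow> 0"
    and w_nonneg: "\<And>n l. w n l \<ge> 0"
    and D_nonneg: "\<And>n. D n \<ge> 0"
  shows "D \<longlonglongrightarrow> 0"
proof -
  have e1: "eventually (\<lambda>n. e n < 1) sequentially"
    using e by (rule order_tendstoD) simp
  have "eventually (\<lambda>n. D n \<le> e n + average (A n) (\<lambda>i. \<Sum>j<m. w n (i j) * D (i j)) \<and>
    (finite (A n) \<and> A n \<noteq> {} \<and> (\<forall>i\<in>A n. \<forall>j<m. i j < n)) \<and>
    average (A n) (\<lambda>i. \<Sum>j<m. w n (i j)) \<le> r \<and> e n < 1) sequentially"
    using rec A r(1) e1 by eventually_elim simp
  then obtain N where N: "\<And>n. n \<ge> N \<Longrightarrow> D n \<le> e n + average (A n) (\<lambda>i. \<Sum>j<m. w n (i j) * D (i j))"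
    "\<And>n. n \<ge> N \<Longrightarrow> finite (A n) \<and> A n \<noteq> {} \<and> (\<forall>i\<in>A n. \<forall>j<m. i j < n)"
    "\<And>n. n \<ge> N \<Longrightarrow> average (A n) (\<lambda>i. \<Sum>j<m. w n (i j)) \<le> r"
    "\<And>n. n \<ge> N \<Longrightarrow> e n < 1"
    unfolding eventually_sequentially by blast
  \<comment> \<open>The entry \<open>1 / (1 - r)\<close> ensures \<open>1 + r * B <= B\<close>, the
    induction step beyond \<open>N\<close>.\<close>
  define B where "B = Max (insert (1 / (1 - r)) (D ` {..N}))"
  have B: "1 / (1 - r) \<le> B" "n \<le> N \<Longrightarrow> D n \<le> B" for n
    unfolding B_def by (intro Max_ge; simp)+
  have "1 / (1 - r) > 0" using r by simp
  then have "B > 0" using B(1) by linarith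
  have avg_le: "average (A n) (\<lambda>i. \<Sum>j<m. w n (i j) * D (i j)) \<le> r * c + d"
    if n: "n \<ge> N" and c: "c \<ge> 0" and le: "\<And>i. i \<in> A n \<Longrightarrow> (\<Sum>j<m. w n (i j) * D (i j)) \<le> c * (\<Sum>j<m. w n (i j)) + d"
    for n c d
  proof -
    have "average (A n) (\<lambda>i. \<Sum>j<m. w n (i j) * D (i j)) \<le> average (A n) (\<lambda>i. c * (\<Sum>j<m. w n (i j)) + d)"
      using le by (rule average_mono)
    also have "\<dots> = c * average (A n) (\<lambda>i. \<Sum>j<m. w n (i j)) + d"
      using N(2)[OF n] by (simp add: average_add[symmetric] average_cmult)
    also have "\<dots> \<le> c * r + d"
      using N(3)[OF n] c by (intro add_right_mono mult_left_mono) auto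
    finally show ?thesis by (simp add: mult.commute)
  qed
  have D_le: "D n \<le> B" for n
  proof (induction n rule: less_induct)
    case (less n)
    show ?case
    proof (cases "n \<le> N")
      case False
      then have n: "n \<ge> N" by simp
      have "average (A n) (\<lambda>i. \<Sum>j<m. w n (i j) * D (i j)) \<le> r * B + 0"
      proof (rule avg_le[OF n])
        fix i assume i: "i \<in> A n"
        have "(\<Sum>j<m. w n (i j) * D (i j)) \<le> (\<Sum>j<m. w n (i j) * B)"
          using N(2)[OF n] i less w_nonneg by (intro sum_mono mult_left_mono) auto
        then show "(\<Sum>j<m. w n (i j) * D (i j)) \<le> B * (\<Sum>j<m. w n (i j)) + 0"
          by (simp add: sum_distrib_left mult.commute)
      qed (use \<open>B > 0\<close> in simp)
      then have "D n \<le> 1 + r * B"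
        using N(1)[OF n] N(4)[OF n] by linarith
      also have "\<dots> \<le> B"
        using B(1) r(3) by (simp add: field_simps)
      finally show ?thesis .
    qed (use B in auto)
  qed
  have step: "eventually (\<lambda>n. D n \<le> r * c + \<eta>) sequentially"
    if c: "c \<ge> 0" "eventually (\<lambda>n. D n \<le> c) sequentially" and "\<eta> > 0" for c \<eta>
  proof -
    obtain M where M: "\<And>n. n \<ge> M \<Longrightarrow> D n \<le> c"
      using c(2) unfolding eventually_sequentially by blast
    have "(\<lambda>n. e n + real m * (B * (\<Sum>l<M. w n l))) \<longlonglongrightarrow> 0 + real m * (B * (\<Sum>l<M. 0))"
      by (intro tendsto_intros e w0)
    then have "eventually (\<lambda>n. e n + real m * (B * (\<Sum>l<M. w n l)) < \<eta>) sequentially"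
      using \<open>\<eta> > 0\<close> by (intro order_tendstoD) auto
    then show ?thesis
      using eventually_ge_at_top[of N]
    proof eventually_elim
      case (elim n)
      have "average (A n) (\<lambda>i. \<Sum>j<m. w n (i j) * D (i j)) \<le> r * c + real m * (B * (\<Sum>l<M. w n l))"
      proof (rule avg_le[OF elim(2) c(1)])
        fix i assume i: "i \<in> A n"
        \<comment> \<open>Indices below \<open>M\<close> obey only the crude bound \<open>B\<close>;
          the correction term, added for every \<open>l\<close> alike, makes up for it.\<close>
        have le: "w n l * D l \<le> w n l * c + B * (\<Sum>l<M. w n l)" for l
        proof (cases "l < M")
          case True
          have "w n l * D l \<le> B * w n l"
            using D_le[of l] w_nonneg[of n l] by (simp add: mult.commute[of "w n l"] mult_right_mono)
          also have "\<dots> \<le> B * (\<Sum>l<M. w n l)"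
            using True \<open>B > 0\<close> w_nonneg by (intro mult_left_mono member_le_sum) auto
          finally show ?thesis
            using mult_nonneg_nonneg[OF w_nonneg[of n l] c(1)] by linarith
        next
          case False
          then have "w n l * D l \<le> w n l * c"
            using M[of l] w_nonneg by (intro mult_left_mono) auto
          moreover have "B * (\<Sum>l<M. w n l) \<ge> 0"
            using \<open>B > 0\<close> w_nonneg by (intro mult_nonneg_nonneg sum_nonneg) auto
          ultimately show ?thesis by linarith
        qed
        have "(\<Sum>j<m. w n (i j) * D (i j)) \<le> (\<Sum>j<m. w n (i j) * c + B * (\<Sum>l<M. w n l))"
          by (intro sum_mono le)
        then show "(\<Sum>j<m. w n (i j) * D (i j)) \<le> c * (\<Sum>j<m. w n (i j)) + real m * (B * (\<Sum>l<M. w n l))"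
          by (simp add: sum.distrib sum_distrib_left mult.commute)
      qed
      then show ?case
        using N(1)[OF elim(2)] elim(1) by linarith
    qed
  qed
  have iter: "eventually (\<lambda>n. D n \<le> r ^ k * B + \<eta> / (1 - r)) sequentially" if "\<eta> > 0" for k \<eta>
  proof (induction k)
    case 0
    have "0 \<le> \<eta> / (1 - r)" using that r by simp
    then show ?case using D_le by (intro always_eventually) (auto intro: add_increasing2)
  next
    case (Suc k)
    have "r * (r ^ k * B + \<eta> / (1 - r)) + \<eta> = r ^ Suc k * B + \<eta> / (1 - r)"
      using r by (simp add: field_simps)
    moreover have "0 \<le> r ^ k * B + \<eta> / (1 - r)"
      using that r \<open>B > 0\<close> by simp
    ultimately show ?case
      using step[OF _ Suc.IH that] by simp
  qed
  show ?thesis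
  proof (rule tendstoI)
    fix \<epsilon> :: real assume "\<epsilon> > 0"
    have "(\<lambda>k. r ^ k * B) \<longlonglongrightarrow> 0 * B"
      using r by (intro tendsto_intros LIMSEQ_power_zero) auto
    then have "eventually (\<lambda>k. r ^ k * B < \<epsilon> / 2) sequentially"
      using \<open>\<epsilon> > 0\<close> by (intro order_tendstoD) auto
    then obtain k where k: "r ^ k * B < \<epsilon> / 2"
      using eventually_happens'[OF sequentially_bot] by blast
    \<comment> \<open>The errors of all iteration steps form a geometric series with sum at most
      \<open>\<eta> / (1 - r) = \<epsilon> / 2\<close>.\<close>
    define \<eta> where "\<eta> = \<epsilon> / 2 * (1 - r)"
    have "\<eta> > 0"
      using r \<open>\<epsilon> > 0\<close> by (simp add: \<eta>_def)
    have "\<eta> / (1 - r) = \<epsilon> / 2"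
      unfolding \<eta>_def using r by (intro nonzero_mult_div_cancel_right) simp
    from iter[OF \<open>\<eta> > 0\<close>, of k] show "eventually (\<lambda>n. dist (D n) 0 < \<epsilon>) sequentially"
    proof eventually_elim
      case (elim n)
      then show ?case
        using k \<open>\<eta> / (1 - r) = \<epsilon> / 2\<close> D_nonneg[of n] by simp
    qed
  qed
qed

lemma norm_iexp_diff_le: "norm (iexp x - iexp y) \<le> \<bar>x - y\<bar>"
proof -
  have "iexp x = iexp y * iexp (x - y)"
    by (simp add: algebra_simps flip: exp_add)
  then have "norm (iexp x - iexp y) = norm (iexp y * (iexp (x - y) - 1))"
    by (simp add: right_diff_distrib)
  also have "\<dots> \<le> \<bar>x - y\<bar>"
    using iexp_approx1[of "x - y" 0] by (simp add: norm_mult)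
  finally show ?thesis .
qed

text \<open>Positivity of \<open>b\<close> and the uniform estimate of its ratios are all that is
  kept of the slow variation of \<open>L\<close>.\<close>

locale regular_toll =
  fixes m :: nat and \<beta> :: real and t b :: "nat \<Rightarrow> real"
  assumes m: "m \<ge> 2" and \<beta>: "\<beta> > 1"
    and b_pos: "\<And>n. b n > 0"
    and b_ratio: "\<And>\<epsilon>. \<epsilon> > 0 \<Longrightarrow>
      eventually (\<lambda>n. \<forall>i\<le>n. \<bar>b i / b n - (real i / real n) powr \<beta>\<bar> \<le> \<epsilon>) sequentially"
    and toll: "(\<lambda>n. t n / b n) \<longlonglongrightarrow> 1"
begin

abbreviation "comps n \<equiv> compositions m (n + 1 - m)"

abbreviation "\<rho> \<equiv> contraction_factor m \<beta>"

definition ratio_error :: "nat \<Rightarrow> real" where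
  "ratio_error n = Max ((\<lambda>i. \<bar>b i / b n - (real i / real n) powr \<beta>\<bar>) ` {..n})"

lemma ratio_error: "i \<le> n \<Longrightarrow> \<bar>b i / b n - (real i / real n) powr \<beta>\<bar> \<le> ratio_error n"
  unfolding ratio_error_def by (intro Max_ge) auto

lemma ratio_error_nonneg: "ratio_error n \<ge> 0"
  using ratio_error[of 0 n] by linarith

lemma ratio_error_tendsto: "ratio_error \<longlonglongrightarrow> 0"
proof (rule tendstoI)
  fix \<epsilon> :: real assume "\<epsilon> > 0"
  then have "eventually (\<lambda>n. \<forall>i\<le>n. \<bar>b i / b n - (real i / real n) powr \<beta>\<bar> \<le> \<epsilon> / 2) sequentially"
    by (intro b_ratio) auto
  then show "eventually (\<lambda>n. dist (ratio_error n) 0 < \<epsilon>) sequentially"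
  proof eventually_elim
    case (elim n)
    then have "ratio_error n \<le> \<epsilon> / 2"
      unfolding ratio_error_def by (intro Max.boundedI) auto
    then show ?case
      using ratio_error_nonneg[of n] \<open>\<epsilon> > 0\<close> by simp
  qed
qed

lemma weight_tendsto_0: "(\<lambda>n. b l / b n) \<longlonglongrightarrow> 0"
proof (rule tendsto_sandwich)
  show "eventually (\<lambda>n. 0 \<le> b l / b n) sequentially"
    using b_pos by (intro always_eventually) (simp add: less_imp_le)
  show "eventually (\<lambda>n. b l / b n \<le> ratio_error n + (real l / real n) powr \<beta>) sequentially"
    using eventually_ge_at_top[of l]
  proof eventually_elim
    case (elim n)
    show ?case using ratio_error[OF elim] by linarith
  qed
  have "(\<lambda>n. (real l / real n) powr \<beta>) \<longlonglongrightarrow> 0 powr \<beta>"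
    using \<beta> by (intro tendsto_powr2 tendsto_const lim_const_over_n) auto
  from tendsto_add[OF ratio_error_tendsto this]
  show "(\<lambda>n. ratio_error n + (real l / real n) powr \<beta>) \<longlonglongrightarrow> 0" by simp
qed simp

lemma comps_le: "i \<in> comps n \<Longrightarrow> n \<ge> m - 1 \<Longrightarrow> i j \<le> n"
  using compositions_less[of i m n j] m by simp

definition total_weight :: "nat \<Rightarrow> (nat \<Rightarrow> nat) \<Rightarrow> real" where
  "total_weight n i = (\<Sum>j<m. b (i j) / b n)"

lemma total_weight_pos: "total_weight n i > 0"
  unfolding total_weight_def using m b_pos by (intro sum_pos) (auto simp: lessThan_empty_iff)

lemma weight_close:
  assumes "i \<in> comps n" "n \<ge> m - 1" "s \<in> std_simplex m" "j < m" "\<bar>real (i j) / real n - s j\<bar> \<le> real m / real n"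
  shows "\<bar>b (i j) / b n - s j powr \<beta>\<bar> \<le> ratio_error n + \<beta> * (real m / real n)"
proof -
  have le: "i j \<le> n" using comps_le assms by blast
  have "n > 0" using assms(2) m by simp
  have "\<bar>(real (i j) / real n) powr \<beta> - s j powr \<beta>\<bar> \<le> \<beta> * \<bar>real (i j) / real n - s j\<bar>"
    using le \<open>n > 0\<close> assms(3,4) std_simplex_le_1[OF assms(3,4)] \<beta>
    by (intro powr_diff_le) (auto simp: std_simplex_def)
  also have "\<dots> \<le> \<beta> * (real m / real n)"
    using \<beta> assms(5) by (intro mult_left_mono) auto
  finally show ?thesis
    using ratio_error[OF le] by linarith
qed

text \<open>As on the simplex, \<open>x powr \<beta> <= x\<close> for \<open>x = i j / n\<close>,
  and these fractions add up to at most 1.\<close>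

lemma total_weight_le:
  assumes "i \<in> comps n" "n \<ge> m - 1"
  shows "total_weight n i \<le> 1 + m * ratio_error n"
proof -
  have le: "i j \<le> n" for j using comps_le assms by blast
  have "n > 0" using assms(2) m by simp
  have "b (i j) / b n \<le> real (i j) / real n + ratio_error n" for j
  proof -
    have "(real (i j) / real n) powr \<beta> \<le> (real (i j) / real n) powr 1"
      using le[of j] \<open>n > 0\<close> \<beta> by (intro powr_mono') auto
    then show ?thesis
      using ratio_error[OF le[of j]] by (simp add: abs_le_iff)
  qed
  then have "total_weight n i \<le> (\<Sum>j<m. real (i j) / real n + ratio_error n)"
    unfolding total_weight_def by (intro sum_mono)
  also have "\<dots> = real (\<Sum>j<m. i j) / real n + m * ratio_error n"
    by (simp add: sum.distrib sum_divide_distrib)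
  also have "(\<Sum>j<m. i j) = n + 1 - m"
    using assms(1) by (simp add: compositions_def)
  also have "real (n + 1 - m) / real n \<le> 1"
    using m \<open>n > 0\<close> by simp
  finally show ?thesis by simp
qed

text \<open>\<open>total_weight\<close> is the discrete counterpart of the sum of the
  \<open>s j powr \<beta>\<close>, so both fit \<open>average_compositions_approx\<close> with
  errors tending to 0.\<close>

lemma average_total_weight: "(\<lambda>n. average (comps n) (total_weight n)) \<longlonglongrightarrow> \<rho>"
proof (rule LIM_zero_cancel, rule Lim_null_comparison)
  let ?e = "\<lambda>n. m * (ratio_error n + \<beta> * (real m / real n)) + 2 * (1 + m * ratio_error n) * (1 - grid_ratio (m - 1) n)"
  have "?e \<longlonglongrightarrow> real m * (0 + \<beta> * 0) + 2 * (1 + real m * 0) * (1 - 1)"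
    by (intro tendsto_intros ratio_error_tendsto grid_ratio_tendsto lim_const_over_n)
  then show "?e \<longlonglongrightarrow> 0" by simp
  show "eventually (\<lambda>n. norm (average (comps n) (total_weight n) - \<rho>) \<le> ?e n) sequentially"
    using eventually_ge_at_top[of "m - 1"]
  proof eventually_elim
    case (elim n)
    show ?case
      unfolding contraction_factor_def
    proof (rule average_compositions_approx[OF m elim])
      fix i assume i: "i \<in> comps n"
      show "norm (total_weight n i) \<le> 1 + m * ratio_error n"
        using total_weight_le[OF i elim] total_weight_pos[of n i] by simp
      fix s assume s: "s \<in> std_simplex m"
        and close: "\<And>j. j < m \<Longrightarrow> \<bar>real (i j) / real n - s j\<bar> \<le> real m / real n"
      have "norm (total_weight n i - (\<Sum>j<m. s j powr \<beta>)) \<le> (\<Sum>j<m. \<bar>b (i j) / b n - s j powr \<beta>\<bar>)"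
        by (simp add: total_weight_def sum_abs flip: sum_subtractf)
      also have "\<dots> \<le> (\<Sum>j<m. ratio_error n + \<beta> * (real m / real n))"
        using close by (intro sum_mono weight_close[OF i elim s]) auto
      finally show "norm (total_weight n i - (\<Sum>j<m. s j powr \<beta>)) \<le> m * (ratio_error n + \<beta> * (real m / real n))"
        by simp
    next
      fix s assume s: "s \<in> std_simplex m"
      have "0 \<le> (\<Sum>j<m. s j powr \<beta>)" by (intro sum_nonneg) auto
      then show "norm (\<Sum>j<m. s j powr \<beta>) \<le> 1 + m * ratio_error n"
        using sum_powr_le_1[OF s, of \<beta>] \<beta> ratio_error_nonneg[of n] by (simp add: add_increasing2)
    qed (use \<beta> ratio_error_nonneg[of n] in \<open>auto\<close>)
  qed
qed

text \<open>The bound for single compositions cannot be pushed below 1, because one part may be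
  nearly \<open>n\<close>; strict contraction is available only for the average.\<close>

lemma eventually_average_total_weight_less:
  assumes "\<epsilon> > 0"
  shows "eventually (\<lambda>n. average (comps n) (total_weight n) \<le> \<rho> + \<epsilon>) sequentially"
    and "eventually (\<lambda>n. \<forall>i\<in>comps n. total_weight n i \<le> 1 + \<epsilon>) sequentially"
proof -
  show "eventually (\<lambda>n. average (comps n) (total_weight n) \<le> \<rho> + \<epsilon>) sequentially"
    using order_tendstoD(2)[OF average_total_weight, of "\<rho> + \<epsilon>"] assms
    by (auto elim!: eventually_mono)
  have "(\<lambda>n. 1 + m * ratio_error n) \<longlonglongrightarrow> 1 + real m * 0"
    by (intro tendsto_intros ratio_error_tendsto)
  then have "eventually (\<lambda>n. 1 + m * ratio_error n < 1 + \<epsilon>) sequentially"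
    using assms by (intro order_tendstoD) auto
  then show "eventually (\<lambda>n. \<forall>i\<in>comps n. total_weight n i \<le> 1 + \<epsilon>) sequentially"
    using eventually_ge_at_top[of "m - 1"]
  proof eventually_elim
    case (elim n)
    then show ?case using total_weight_le[of _ n] by fastforce
  qed
qed

definition \<phi> :: "nat \<Rightarrow> real \<Rightarrow> complex" where
  "\<phi> n u = measure_pmf.expectation (X_pmf m t n) (\<lambda>x. iexp (u * (x / b n)))"

text \<open>Each subtree is normalised by its own \<open>b (i j)\<close>, which rescales the
  argument by \<open>b (i j) / b n\<close>; independence of the subtrees gives the product.\<close>

lemma \<phi>_rec:
  assumes "n \<ge> m - 1"
  shows "\<phi> n u = iexp (u * (t n / b n)) * average (comps n) (\<lambda>i. \<Prod>j<m. \<phi> (i j) (u * (b (i j) / b n)))"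
proof -
  have "measure_pmf.expectation (Pi_pmf {..<m} (t 0) (\<lambda>j. X_pmf m t (i j))) (\<lambda>y. iexp (u * (((\<Sum>j<m. y j) + t n) / b n)))
    = iexp (u * (t n / b n)) * (\<Prod>j<m. \<phi> (i j) (u * (b (i j) / b n)))" for i
  proof -
    have "iexp (u * (((\<Sum>j<m. y j) + t n) / b n)) = iexp (u * (t n / b n)) * (\<Prod>j<m. iexp (u * (b (i j) / b n) * (y j / b (i j))))" for y
    proof -
      have "u * (((\<Sum>j<m. y j) + t n) / b n) = u * (t n / b n) + (\<Sum>j<m. u * (b (i j) / b n) * (y j / b (i j)))"
        using b_pos by (simp add: add_divide_distrib algebra_simps sum_divide_distrib sum_distrib_left less_imp_neq[symmetric])
      then show ?thesis
        by (simp add: exp_add exp_sum sum_distrib_left algebra_simps)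
    qed
    then have "measure_pmf.expectation (Pi_pmf {..<m} (t 0) (\<lambda>j. X_pmf m t (i j))) (\<lambda>y. iexp (u * (((\<Sum>j<m. y j) + t n) / b n)))
      = iexp (u * (t n / b n)) * measure_pmf.expectation (Pi_pmf {..<m} (t 0) (\<lambda>j. X_pmf m t (i j)))
          (\<lambda>y. \<Prod>j<m. iexp (u * (b (i j) / b n) * (y j / b (i j))))"
      by (simp only: integral_mult_right_zero)
    also have "measure_pmf.expectation (Pi_pmf {..<m} (t 0) (\<lambda>j. X_pmf m t (i j)))
          (\<lambda>y. \<Prod>j<m. iexp (u * (b (i j) / b n) * (y j / b (i j)))) = (\<Prod>j<m. \<phi> (i j) (u * (b (i j) / b n)))"
      unfolding \<phi>_def by (rule expectation_prod_Pi_pmf_finite) auto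
    finally show ?thesis .
  qed
  then show ?thesis
    unfolding \<phi>_def X_pmf_expectation[OF m assms]
    by (simp add: average_cmult)
qed

lemma norm_\<phi>: "norm (\<phi> n u) \<le> 1"
proof -
  have "norm (\<phi> n u) \<le> measure_pmf.expectation (X_pmf m t n) (\<lambda>x. norm (iexp (u * (x / b n))))"
    unfolding \<phi>_def by (rule integral_norm_bound)
  then show ?thesis by simp
qed

text \<open>Makes the distance to a solution finite for every single \<open>n\<close>; uniformity in
  \<open>n\<close> then comes from the contraction.\<close>

lemma \<phi>_lipschitz_0: "norm (\<phi> n u - 1) \<le> \<bar>u\<bar> * (measure_pmf.expectation (X_pmf m t n) abs / b n)"
proof -
  have "\<phi> n u - 1 = measure_pmf.expectation (X_pmf m t n) (\<lambda>x. iexp (u * (x / b n)) - 1)"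
    unfolding \<phi>_def by (subst Bochner_Integration.integral_diff) (auto intro!: integrable_measure_pmf_finite)
  also have "norm \<dots> \<le> measure_pmf.expectation (X_pmf m t n) (\<lambda>x. norm (iexp (u * (x / b n)) - 1))"
    by (rule integral_norm_bound)
  also have "\<dots> \<le> measure_pmf.expectation (X_pmf m t n) (\<lambda>x. \<bar>u\<bar> / b n * \<bar>x\<bar>)"
  proof (intro pmf_expectation_mono finite_set_pmf_X_pmf)
    fix x
    show "norm (iexp (u * (x / b n)) - 1) \<le> \<bar>u\<bar> / b n * \<bar>x\<bar>"
      using norm_iexp_diff_le[of "u * (x / b n)" 0] b_pos[of n] by (simp add: abs_mult)
  qed
  finally show ?thesis by simp
qed

end

section \<open>Convergence of characteristic functions and bounds for moments\<close>

text \<open>Lipschitz continuity stands for a finite first moment; \<open>\<psi>\<close> need not be known to be the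
  characteristic function of a law.\<close>

definition cf_solution :: "nat \<Rightarrow> real \<Rightarrow> (real \<Rightarrow> complex) \<Rightarrow> bool" where
  "cf_solution m \<beta> \<psi> \<longleftrightarrow> (\<exists>C. \<forall>u v. norm (\<psi> u - \<psi> v) \<le> C * \<bar>u - v\<bar>) \<and> (\<forall>u. norm (\<psi> u) \<le> 1) \<and> \<psi> 0 = 1 \<and>
     (\<forall>u. \<psi> u = iexp u * (\<integral>s. (\<Prod>j<m. \<psi> (u * s j powr \<beta>)) \<partial>uniform_simplex m))"

lemma
  assumes "cf_solution m \<beta> \<psi>"
  shows cf_solution_lipschitz: "\<exists>C. \<forall>u v. norm (\<psi> u - \<psi> v) \<le> C * \<bar>u - v\<bar>"
    and cf_solution_norm: "norm (\<psi> u) \<le> 1"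
    and cf_solution_0: "\<psi> 0 = 1"
    and cf_solution_eq: "\<psi> u = iexp u * (\<integral>s. (\<Prod>j<m. \<psi> (u * s j powr \<beta>)) \<partial>uniform_simplex m)"
  using assms unfolding cf_solution_def by blast+

lemma measurable_prod_powr:
  fixes \<psi> :: "real \<Rightarrow> complex"
  assumes "continuous_on UNIV \<psi>"
  shows "(\<lambda>s. \<Prod>j<m. \<psi> (u * s j powr \<beta>)) \<in> borel_measurable (Pi\<^sub>M {..<m} (\<lambda>_. borel))"
proof (intro borel_measurable_prod)
  fix j assume "j \<in> {..<m}"
  then have "(\<lambda>s. u * s j powr \<beta>) \<in> borel_measurable (Pi\<^sub>M {..<m} (\<lambda>_. borel))"
    using measurable_component_uniform_simplex[of j m]
    by (intro borel_measurable_times powr_real_measurable) auto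
  then show "(\<lambda>s. \<psi> (u * s j powr \<beta>)) \<in> borel_measurable (Pi\<^sub>M {..<m} (\<lambda>_. borel))"
    using borel_measurable_continuous_onI[OF assms] by measurable
qed

lemma continuous_if_lipschitz:
  fixes \<psi> :: "real \<Rightarrow> complex"
  assumes "\<And>u v. norm (\<psi> u - \<psi> v) \<le> C * \<bar>u - v\<bar>"
  shows "continuous_on UNIV \<psi>"
proof -
  have "C \<ge> 0" using order_trans[OF norm_ge_zero assms[of 1 0]] by simp
  then have "C-lipschitz_on UNIV \<psi>"
    using assms by (intro lipschitz_onI) (auto simp: dist_norm dist_real_def)
  then show ?thesis by (rule lipschitz_on_continuous_on)
qed

lemma norm_prod_le_1:
  fixes f :: "'a \<Rightarrow> 'b::{comm_semiring_1, real_normed_div_algebra}"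
  assumes "\<And>j. j \<in> A \<Longrightarrow> norm (f j) \<le> 1"
  shows "norm (\<Prod>j\<in>A. f j) \<le> 1"
  unfolding prod_norm[symmetric] using assms by (intro prod_le_1) auto

text \<open>Supplies bounds of order \<open>|u|\<close>, as required by a distance in which
  \<open>|u|\<close> is divided out.\<close>

lemma norm_prod_diff_1_le:
  fixes \<psi> :: "real \<Rightarrow> complex"
  assumes "\<And>u. norm (\<psi> u - 1) \<le> C * \<bar>u\<bar>" "\<And>u. norm (\<psi> u) \<le> 1" "\<And>j. j < m \<Longrightarrow> x j \<ge> 0"
  shows "norm ((\<Prod>j<m. \<psi> (u * x j)) - 1) \<le> C * \<bar>u\<bar> * (\<Sum>j<m. x j)"
proof -
  have "norm ((\<Prod>j<m. \<psi> (u * x j)) - (\<Prod>j<m. 1)) \<le> (\<Sum>j<m. norm (\<psi> (u * x j) - 1))"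
    using assms(2) by (intro norm_prod_diff) auto
  also have "\<dots> \<le> (\<Sum>j<m. C * \<bar>u * x j\<bar>)"
    by (intro sum_mono assms(1))
  also have "\<dots> = C * \<bar>u\<bar> * (\<Sum>j<m. x j)"
    using assms(3) by (simp add: sum_distrib_left abs_mult mult.assoc)
  finally show ?thesis by simp
qed

context regular_toll
begin

text \<open>Three replacements, each with an error proportional to \<open>|u|\<close>: the toll by
  its limit 1, the functions \<open>\<phi>\<close> by \<open>\<psi>\<close> in the subtrees, and the
  average over compositions by the integral over the simplex. The second one reproduces the
  distances \<open>D\<close> of smaller indices.\<close>

lemma \<phi>_approx_rec:
  assumes sol: "cf_solution m \<beta> \<psi>"
    and C: "\<And>u v. norm (\<psi> u - \<psi> v) \<le> C * \<bar>u - v\<bar>"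
    and D: "\<And>l u. norm (\<phi> l u - \<psi> u) \<le> D l * \<bar>u\<bar>"
    and n: "n \<ge> m - 1" "ratio_error n \<le> 1 / m"
  shows "norm (\<phi> n u - \<psi> u) \<le> \<bar>u\<bar> * (\<bar>t n / b n - 1\<bar>
      + C * (m * (ratio_error n + \<beta> * (m / n))) + 4 * C * (1 - grid_ratio (m - 1) n)
      + average (comps n) (\<lambda>i. \<Sum>j<m. b (i j) / b n * D (i j)))"
proof (cases "u = 0")
  case True
  then show ?thesis using D[of n 0] by simp
next
  case False
  have "C \<ge> 0" using order_trans[OF norm_ge_zero C[of 1 0]] by simp
  have \<psi>: "norm (\<psi> v) \<le> 1" "\<psi> 0 = 1" for v
    using cf_solution_norm[OF sol] cf_solution_0[OF sol] by auto
  have C0: "norm (\<psi> v - 1) \<le> C * \<bar>v\<bar>" for v using C[of v 0] \<psi> by simp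
  let ?w = "\<lambda>i j. b (i j) / b n"
  define A1 where "A1 = average (comps n) (\<lambda>i. \<Prod>j<m. \<phi> (i j) (u * ?w i j))"
  define A2 where "A2 = average (comps n) (\<lambda>i. \<Prod>j<m. \<psi> (u * ?w i j))"
  define A3 where "A3 = (\<integral>s. (\<Prod>j<m. \<psi> (u * s j powr \<beta>)) \<partial>uniform_simplex m)"
  have w_nonneg: "?w i j \<ge> 0" for i j using b_pos by (simp add: less_imp_le)
  have "norm A1 \<le> 1"
    unfolding A1_def by (intro norm_average_le norm_prod_le_1 norm_\<phi>) (use m in simp_all)
  have 1: "norm (iexp (u * (t n / b n)) * A1 - iexp u * A1) \<le> \<bar>u\<bar> * \<bar>t n / b n - 1\<bar>"
  proof -
    have "norm (iexp (u * (t n / b n)) * A1 - iexp u * A1) = norm (iexp (u * (t n / b n)) - iexp u) * norm A1"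
      by (simp add: norm_mult flip: left_diff_distrib)
    also have "\<dots> \<le> \<bar>u * (t n / b n) - u\<bar> * 1"
      using \<open>norm A1 \<le> 1\<close> by (intro mult_mono norm_iexp_diff_le) auto
    also have "\<dots> = \<bar>u\<bar> * \<bar>t n / b n - 1\<bar>"
      by (simp add: right_diff_distrib flip: abs_mult)
    finally show ?thesis .
  qed
  have 2: "norm (A1 - A2) \<le> \<bar>u\<bar> * average (comps n) (\<lambda>i. \<Sum>j<m. ?w i j * D (i j))"
  proof -
    have "norm (A1 - A2) \<le> average (comps n) (\<lambda>i. norm ((\<Prod>j<m. \<phi> (i j) (u * ?w i j)) - (\<Prod>j<m. \<psi> (u * ?w i j))))"
      unfolding A1_def A2_def average_diff by (rule norm_average)
    also have "\<dots> \<le> average (comps n) (\<lambda>i. \<bar>u\<bar> * (\<Sum>j<m. ?w i j * D (i j)))"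
    proof (intro average_mono)
      fix i
      have "norm ((\<Prod>j<m. \<phi> (i j) (u * ?w i j)) - (\<Prod>j<m. \<psi> (u * ?w i j)))
          \<le> (\<Sum>j<m. norm (\<phi> (i j) (u * ?w i j) - \<psi> (u * ?w i j)))"
        using norm_\<phi> \<psi> by (intro norm_prod_diff) auto
      also have "\<dots> \<le> (\<Sum>j<m. D (i j) * \<bar>u * ?w i j\<bar>)"
        by (intro sum_mono D)
      also have "\<dots> = \<bar>u\<bar> * (\<Sum>j<m. ?w i j * D (i j))"
        using b_pos by (simp add: sum_distrib_left abs_mult mult_ac abs_of_pos)
      finally show "norm ((\<Prod>j<m. \<phi> (i j) (u * ?w i j)) - (\<Prod>j<m. \<psi> (u * ?w i j)))
          \<le> \<bar>u\<bar> * (\<Sum>j<m. ?w i j * D (i j))" .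
    qed
    also have "\<dots> = \<bar>u\<bar> * average (comps n) (\<lambda>i. \<Sum>j<m. ?w i j * D (i j))"
      by (rule average_cmult)
    finally show ?thesis .
  qed
  have 3: "norm (A2 - A3) \<le> \<bar>u\<bar> * (C * (m * (ratio_error n + \<beta> * (m / n))) + 4 * C * (1 - grid_ratio (m - 1) n))"
  proof -
    \<comment> \<open>Subtracting 1 makes the bound \<open>K\<close> of
      \<open>average_compositions_approx\<close> proportional to \<open>|u|\<close>; for the
      products themselves it would only be 1.\<close>
    define F where "F i = (\<Prod>j<m. \<psi> (u * ?w i j)) - 1" for i
    define G where "G s = (\<Prod>j<m. \<psi> (u * s j powr \<beta>)) - 1" for s
    have meas: "(\<lambda>s. \<Prod>j<m. \<psi> (u * s j powr \<beta>)) \<in> borel_measurable (Pi\<^sub>M {..<m} (\<lambda>_. borel))"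
      by (intro measurable_prod_powr continuous_if_lipschitz[OF C])
    interpret S: prob_space "uniform_simplex m" by (rule prob_space_uniform_simplex)
    have int: "integrable (uniform_simplex m) (\<lambda>s. \<Prod>j<m. \<psi> (u * s j powr \<beta>))"
      using meas by (intro S.integrable_const_bound[of _ 1] always_eventually allI norm_prod_le_1 \<psi>)
        (simp cong: measurable_cong_sets)
    have "norm (average (comps n) F - (\<integral>s. G s \<partial>uniform_simplex m))
      \<le> \<bar>u\<bar> * C * (m * (ratio_error n + \<beta> * (m / n))) + 2 * (2 * \<bar>u\<bar> * C) * (1 - grid_ratio (m - 1) n)"
    proof (rule average_compositions_approx[OF m n(1)])
      show "G \<in> borel_measurable (Pi\<^sub>M {..<m} (\<lambda>_. borel))"
        unfolding G_def using meas by simp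
      fix i assume i: "i \<in> comps n"
      have "norm (F i) \<le> C * \<bar>u\<bar> * total_weight n i"
        unfolding F_def total_weight_def using C0 \<psi> w_nonneg by (intro norm_prod_diff_1_le) auto
      also have "\<dots> \<le> C * \<bar>u\<bar> * 2"
      proof (rule mult_left_mono)
        show "total_weight n i \<le> 2"
          using total_weight_le[OF i n(1)] n(2) m by (simp add: field_simps)
      qed (use \<open>C \<ge> 0\<close> in simp)
      finally show "norm (F i) \<le> 2 * \<bar>u\<bar> * C"
        by (simp add: mult_ac)
      fix s assume s: "s \<in> std_simplex m"
        and close: "\<And>j. j < m \<Longrightarrow> \<bar>real (i j) / real n - s j\<bar> \<le> real m / real n"
      have "norm (F i - G s) \<le> (\<Sum>j<m. norm (\<psi> (u * ?w i j) - \<psi> (u * s j powr \<beta>)))"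
        unfolding F_def G_def using norm_prod_diff[of "{..<m}" "\<lambda>j. \<psi> (u * ?w i j)" "\<lambda>j. \<psi> (u * s j powr \<beta>)"] \<psi> by simp
      also have "\<dots> \<le> (\<Sum>j<m. C * (\<bar>u\<bar> * (ratio_error n + \<beta> * (m / n))))"
      proof (intro sum_mono)
        fix j assume "j \<in> {..<m}"
        then have "\<bar>?w i j - s j powr \<beta>\<bar> \<le> ratio_error n + \<beta> * (m / n)"
          using weight_close[OF i n(1) s] close by simp
        then have "\<bar>u * ?w i j - u * s j powr \<beta>\<bar> \<le> \<bar>u\<bar> * (ratio_error n + \<beta> * (m / n))"
          unfolding right_diff_distrib[symmetric] abs_mult by (rule mult_left_mono) simp
        then show "norm (\<psi> (u * ?w i j) - \<psi> (u * s j powr \<beta>)) \<le> C * (\<bar>u\<bar> * (ratio_error n + \<beta> * (m / n)))"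
          using C[of "u * ?w i j" "u * s j powr \<beta>"] \<open>C \<ge> 0\<close> by (meson mult_left_mono order_trans)
      qed
      finally show "norm (F i - G s) \<le> \<bar>u\<bar> * C * (m * (ratio_error n + \<beta> * (m / n)))"
        by (simp add: mult_ac)
    next
      fix s assume s: "s \<in> std_simplex m"
      have "norm (G s) \<le> C * \<bar>u\<bar> * (\<Sum>j<m. s j powr \<beta>)"
        unfolding G_def using C0 \<psi> by (intro norm_prod_diff_1_le) auto
      also have "\<dots> \<le> C * \<bar>u\<bar> * 2"
        using sum_powr_le_1[OF s, of \<beta>] \<beta> \<open>C \<ge> 0\<close> by (intro mult_left_mono) auto
      finally show "norm (G s) \<le> 2 * \<bar>u\<bar> * C"
        by (simp add: mult_ac)
    qed (use \<open>C \<ge> 0\<close> \<beta> ratio_error_nonneg[of n] in auto)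
    moreover have "average (comps n) F = A2 - 1"
      unfolding F_def A2_def using m by (simp flip: average_diff)
    moreover have "(\<integral>s. G s \<partial>uniform_simplex m) = A3 - 1"
      unfolding G_def A3_def using int by (simp add: S.prob_space)
    ultimately show ?thesis by (simp add: algebra_simps)
  qed
  have "\<phi> n u - \<psi> u = iexp (u * (t n / b n)) * A1 - iexp u * A3"
    unfolding A1_def A3_def \<phi>_rec[OF n(1), of u] by (subst (1) cf_solution_eq[OF sol]) (rule refl)
  also have "\<dots> = (iexp (u * (t n / b n)) * A1 - iexp u * A1) + iexp u * (A1 - A2) + iexp u * (A2 - A3)"
    by (simp add: algebra_simps)
  also have "norm \<dots> \<le> norm (iexp (u * (t n / b n)) * A1 - iexp u * A1) + norm (A1 - A2) + norm (A2 - A3)"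
    by (intro order_trans[OF norm_triangle_ineq] add_mono) (auto simp: norm_mult)
  also have "\<dots> \<le> \<bar>u\<bar> * \<bar>t n / b n - 1\<bar> + \<bar>u\<bar> * average (comps n) (\<lambda>i. \<Sum>j<m. ?w i j * D (i j))
      + \<bar>u\<bar> * (C * (m * (ratio_error n + \<beta> * (m / n))) + 4 * C * (1 - grid_ratio (m - 1) n))"
    by (intro add_mono 1 2 3)
  finally show ?thesis by (simp add: algebra_simps)
qed

lemma \<phi>_tendsto:
  assumes sol: "cf_solution m \<beta> \<psi>"
  shows "(\<lambda>n. \<phi> n u) \<longlonglongrightarrow> \<psi> u"
proof -
  obtain C where C: "\<And>u v. norm (\<psi> u - \<psi> v) \<le> C * \<bar>u - v\<bar>"
    using cf_solution_lipschitz[OF sol] by blast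
  have "\<psi> 0 = 1" by (rule cf_solution_0[OF sol])
  \<comment> \<open>At \<open>u = 0\<close> the quotient is 0 by the convention for division, in
    accordance with \<open>\<phi> n 0 = \<psi> 0\<close>.\<close>
  define D where "D n = (SUP u. norm (\<phi> n u - \<psi> u) / \<bar>u\<bar>)" for n
  have bdd: "norm (\<phi> n u - \<psi> u) / \<bar>u\<bar> \<le> measure_pmf.expectation (X_pmf m t n) abs / b n + C" for n u
  proof -
    have "norm (\<phi> n u - \<psi> u) \<le> norm (\<phi> n u - 1) + norm (\<psi> u - 1)"
      using norm_triangle_ineq4[of "\<phi> n u - 1" "\<psi> u - 1"] by simp
    also have "\<dots> \<le> \<bar>u\<bar> * (measure_pmf.expectation (X_pmf m t n) abs / b n) + C * \<bar>u\<bar>"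
      using \<phi>_lipschitz_0[of n u] C[of u 0] \<open>\<psi> 0 = 1\<close> by simp
    finally have *: "norm (\<phi> n u - \<psi> u) \<le> (measure_pmf.expectation (X_pmf m t n) abs / b n + C) * \<bar>u\<bar>"
      by (simp add: algebra_simps)
    have "0 \<le> measure_pmf.expectation (X_pmf m t n) abs / b n"
      using b_pos[of n] by (intro divide_nonneg_pos integral_nonneg_AE) auto
    moreover have "C \<ge> 0" using order_trans[OF norm_ge_zero C[of 1 0]] by simp
    ultimately show ?thesis
      using * by (cases "u = 0") (auto simp: field_simps)
  qed
  have bdd': "bdd_above (range (\<lambda>u. norm (\<phi> n u - \<psi> u) / \<bar>u\<bar>))" for n
    using bdd by (intro bdd_aboveI) auto
  have \<phi>_0: "\<phi> n 0 = 1" for n by (simp add: \<phi>_def)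
  have D: "norm (\<phi> n u - \<psi> u) \<le> D n * \<bar>u\<bar>" for n u
    using cSUP_upper[OF _ bdd'[of n], of u] \<phi>_0 \<open>\<psi> 0 = 1\<close>
    by (cases "u = 0") (auto simp: D_def field_simps)
  have D_nonneg: "D n \<ge> 0" for n
    using cSUP_upper[OF _ bdd'[of n], of 0] by (simp add: D_def)
  let ?e = "\<lambda>n. \<bar>t n / b n - 1\<bar> + C * (m * (ratio_error n + \<beta> * (m / n))) + 4 * C * (1 - grid_ratio (m - 1) n)"
  have "D \<longlonglongrightarrow> 0"
  proof (rule averaged_contraction_tendsto_0)
    have "eventually (\<lambda>n. ratio_error n < 1 / m) sequentially"
      using m by (intro order_tendstoD[OF ratio_error_tendsto]) auto
    then show "eventually (\<lambda>n. D n \<le> ?e n + average (comps n) (\<lambda>i. \<Sum>j<m. b (i j) / b n * D (i j))) sequentially"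
      using eventually_ge_at_top[of "m - 1"]
    proof eventually_elim
      case (elim n)
      show ?case
        unfolding D_def[of n]
      proof (rule cSUP_least)
        fix u
        let ?R = "?e n + average (comps n) (\<lambda>i. \<Sum>j<m. b (i j) / b n * D (i j))"
        have R: "norm (\<phi> n v - \<psi> v) \<le> \<bar>v\<bar> * ?R" for v
          using \<phi>_approx_rec[OF sol C D elim(2)] elim(1) by simp
        have "?R \<ge> 0"
          using order_trans[OF norm_ge_zero R[of 1]] by simp
        then show "norm (\<phi> n u - \<psi> u) / \<bar>u\<bar> \<le> ?R"
          using R[of u] by (cases "u = 0") (simp_all add: pos_divide_le_eq mult.commute)
      qed simp
    qed
    show "eventually (\<lambda>n. finite (comps n) \<and> comps n \<noteq> {} \<and> (\<forall>i\<in>comps n. \<forall>j<m. i j < n)) sequentially"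
      using eventually_ge_at_top[of "m - 1"] by eventually_elim (use m compositions_less in auto)
    have "?e \<longlonglongrightarrow> \<bar>1 - 1\<bar> + C * (m * (0 + \<beta> * 0)) + 4 * C * (1 - 1)"
      by (intro tendsto_intros toll ratio_error_tendsto grid_ratio_tendsto lim_const_over_n)
    then show "?e \<longlonglongrightarrow> 0" by simp
    \<comment> \<open>Any rate strictly between \<open>\<rho>\<close> and 1 absorbs the convergence
      error of the average; the midpoint is taken.\<close>
    show "eventually (\<lambda>n. average (comps n) (\<lambda>i. \<Sum>j<m. b (i j) / b n) \<le> (1 + \<rho>) / 2) sequentially"
      using eventually_average_total_weight_less(1)[of "(1 - \<rho>) / 2"] contraction_factor_less_1[OF m \<beta>]
      by (simp add: total_weight_def[abs_def] field_simps)
    show "0 \<le> (1 + \<rho>) / 2" "(1 + \<rho>) / 2 < 1"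
      using contraction_factor_less_1[OF m \<beta>] contraction_factor_nonneg[of m \<beta>] by auto
  qed (use weight_tendsto_0 b_pos D_nonneg in \<open>auto simp: less_imp_le\<close>)
  then have "(\<lambda>n. D n * \<bar>u\<bar>) \<longlonglongrightarrow> 0 * \<bar>u\<bar>"
    by (intro tendsto_intros)
  then have "(\<lambda>n. D n * \<bar>u\<bar>) \<longlonglongrightarrow> 0" by simp
  then have "(\<lambda>n. \<phi> n u - \<psi> u) \<longlonglongrightarrow> 0"
    by (rule Lim_null_comparison[rotated]) (simp add: D)
  then show ?thesis by (rule LIM_zero_cancel)
qed

text \<open>The toll joins the \<open>m\<close> subtrees as one more summand, of weight
  \<open>c / B\<close> and constant value \<open>B\<close>. Then every normalised summand has
  \<open>Suc k\<close>th moment at most \<open>B ^ Suc k\<close>, and Jensen's inequality leaves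
  only the power of the total weight.\<close>

lemma moment_step:
  fixes k :: nat
  assumes n: "n \<ge> m - 1" and B: "B > 0" and c: "c \<ge> \<bar>t n\<bar> / b n"
    and IH: "\<And>l. l < n \<Longrightarrow> measure_pmf.expectation (X_pmf m t l) (\<lambda>x. \<bar>x\<bar> ^ Suc k) \<le> (B * b l) ^ Suc k"
  shows "measure_pmf.expectation (X_pmf m t n) (\<lambda>x. \<bar>x\<bar> ^ Suc k)
    \<le> (B * b n) ^ Suc k * average (comps n) (\<lambda>i. (total_weight n i + c / B) ^ Suc k)"
proof -
  have "c \<ge> 0" using c b_pos[of n] by (smt (verit) divide_nonneg_pos)
  let ?P = "\<lambda>i. Pi_pmf {..<m} (t 0) (\<lambda>j. X_pmf m t (i j))"
  have "measure_pmf.expectation (?P i) (\<lambda>y. \<bar>(\<Sum>j<m. y j) + t n\<bar> ^ Suc k)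
      \<le> (B * b n) ^ Suc k * (total_weight n i + c / B) ^ Suc k" if i: "i \<in> comps n" for i
  proof -
    define w where "w j = (if j < m then b (i j) / b n else c / B)" for j
    define z where "z y j = (if j < m then \<bar>y j\<bar> / b (i j) else B)" for y :: "nat \<Rightarrow> real" and j
    let ?W = "total_weight n i + c / B"
    have W: "(\<Sum>j<Suc m. w j) = ?W"
      by (simp add: w_def total_weight_def)
    have "?W > 0"
      using total_weight_pos[of n i] \<open>c \<ge> 0\<close> B by (simp add: add_pos_nonneg)
    have w_nonneg: "w j \<ge> 0" for j
      using b_pos \<open>c \<ge> 0\<close> B by (simp add: w_def less_imp_le)
    have pointwise: "\<bar>(\<Sum>j<m. y j) + t n\<bar> ^ Suc k
        \<le> b n ^ Suc k * (?W ^ k * (\<Sum>j<Suc m. w j * z y j ^ Suc k))" for y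
    proof -
      have "\<bar>(\<Sum>j<m. y j) + t n\<bar> \<le> (\<Sum>j<m. \<bar>y j\<bar>) + \<bar>t n\<bar>"
        by (intro order_trans[OF abs_triangle_ineq] add_right_mono sum_abs)
      also have "\<bar>t n\<bar> \<le> b n * c"
        using c b_pos[of n] by (simp add: field_simps)
      also have "(\<Sum>j<m. \<bar>y j\<bar>) + b n * c = b n * (\<Sum>j<Suc m. w j * z y j)"
      proof -
        have "(\<Sum>j<m. w j * z y j) = (\<Sum>j<m. \<bar>y j\<bar> / b n)"
          using b_pos by (intro sum.cong) (auto simp: w_def z_def less_imp_neq[symmetric])
        then have "(\<Sum>j<Suc m. w j * z y j) = (\<Sum>j<m. \<bar>y j\<bar> / b n) + c"
          using B by (simp add: w_def z_def)
        then show ?thesis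
          using b_pos[of n] by (simp add: distrib_left sum_distrib_left)
      qed
      finally have "\<bar>(\<Sum>j<m. y j) + t n\<bar> ^ Suc k \<le> (b n * (\<Sum>j<Suc m. w j * z y j)) ^ Suc k"
        by (intro power_mono) auto
      also have "\<dots> = b n ^ Suc k * (\<Sum>j<Suc m. w j * z y j) ^ Suc k"
        by (rule power_mult_distrib)
      also have "(\<Sum>j<Suc m. w j * z y j) ^ Suc k \<le> (\<Sum>j<Suc m. w j) ^ k * (\<Sum>j<Suc m. w j * z y j ^ Suc k)"
        using w_nonneg b_pos B \<open>?W > 0\<close> unfolding W[symmetric]
        by (intro power_weighted_sum_le) (auto simp: z_def less_imp_le)
      finally show ?thesis
        using b_pos[of n] by (simp only: W mult_left_mono zero_le_power less_imp_le)
    qed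
    have fin: "finite (set_pmf (?P i))" by (intro finite_set_Pi_pmf) auto
    have Ez: "measure_pmf.expectation (?P i) (\<lambda>y. z y j ^ Suc k) \<le> B ^ Suc k" if "j < Suc m" for j
    proof (cases "j < m")
      case True
      then have "measure_pmf.expectation (?P i) (\<lambda>y. z y j ^ Suc k)
          = measure_pmf.expectation (X_pmf m t (i j)) (\<lambda>x. \<bar>x\<bar> ^ Suc k) / b (i j) ^ Suc k"
        using expectation_Pi_pmf_component[of "{..<m}" j "t 0" "\<lambda>j. X_pmf m t (i j)" "\<lambda>x. \<bar>x\<bar> ^ Suc k / b (i j) ^ Suc k"]
        by (simp add: z_def power_divide del: power_Suc)
      also have "\<dots> \<le> (B * b (i j)) ^ Suc k / b (i j) ^ Suc k"
        using IH[OF compositions_less[OF i m n]] b_pos[of "i j"] by (intro divide_right_mono) auto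
      also have "\<dots> = B ^ Suc k"
        using b_pos[of "i j"] by (simp add: power_mult_distrib del: power_Suc)
      finally show ?thesis .
    qed (simp add: z_def)
    have "measure_pmf.expectation (?P i) (\<lambda>y. \<bar>(\<Sum>j<m. y j) + t n\<bar> ^ Suc k)
        \<le> measure_pmf.expectation (?P i) (\<lambda>y. b n ^ Suc k * (?W ^ k * (\<Sum>j<Suc m. w j * z y j ^ Suc k)))"
      using fin pointwise by (intro pmf_expectation_mono)
    also have "\<dots> = b n ^ Suc k * (?W ^ k * (\<Sum>j<Suc m. w j * measure_pmf.expectation (?P i) (\<lambda>y. z y j ^ Suc k)))"
    proof -
      have "measure_pmf.expectation (?P i) (\<lambda>y. \<Sum>j<Suc m. w j * z y j ^ Suc k)
          = (\<Sum>j<Suc m. measure_pmf.expectation (?P i) (\<lambda>y. w j * z y j ^ Suc k))"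
        by (intro Bochner_Integration.integral_sum integrable_measure_pmf_finite[OF fin])
      then show ?thesis by (simp only: integral_mult_right_zero)
    qed
    also have "\<dots> \<le> b n ^ Suc k * (?W ^ k * (\<Sum>j<Suc m. w j * B ^ Suc k))"
      using b_pos[of n] \<open>?W > 0\<close> w_nonneg Ez
      by (intro mult_left_mono sum_mono) (auto simp: less_imp_le simp del: power_Suc)
    also have "\<dots> = (B * b n) ^ Suc k * ?W ^ Suc k"
      unfolding sum_distrib_right[symmetric] W by (simp add: power_mult_distrib mult_ac)
    finally show ?thesis .
  qed
  then have "measure_pmf.expectation (X_pmf m t n) (\<lambda>x. \<bar>x\<bar> ^ Suc k)
      \<le> average (comps n) (\<lambda>i. (B * b n) ^ Suc k * (total_weight n i + c / B) ^ Suc k)"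
    unfolding X_pmf_expectation[OF m n] by (rule average_mono)
  then show ?thesis by (simp only: average_cmult)
qed

text \<open>Of the \<open>k\<close> factors \<open>total_weight n i + 2 / B\<close>, all but one are
  bounded by \<open>1 + 2 * \<epsilon>\<close>, and the last one is averaged to at most
  \<open>\<rho> + 2 * \<epsilon>\<close>. The product is below 1, so the bound with constant
  \<open>B\<close> reproduces itself.\<close>

lemma moment_bound: "\<exists>B. \<forall>n. measure_pmf.expectation (X_pmf m t n) (\<lambda>x. \<bar>x\<bar> ^ k) \<le> (B * b n) ^ k"
proof (cases k)
  case 0
  then show ?thesis by simp
next
  case (Suc k')
  \<comment> \<open>The expression tends to \<open>\<rho> < 1\<close> as \<open>\<epsilon>\<close>
    decreases to 0, so a suitable positive \<open>\<epsilon>\<close> exists.\<close>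
  have "((\<lambda>\<epsilon>. (1 + 2 * \<epsilon>) ^ k' * (\<rho> + 2 * \<epsilon>)) \<longlongrightarrow> (1 + 2 * 0) ^ k' * (\<rho> + 2 * 0)) (at_right 0)"
    by (intro tendsto_intros)
  then have "eventually (\<lambda>\<epsilon>. (1 + 2 * \<epsilon>) ^ k' * (\<rho> + 2 * \<epsilon>) < 1) (at_right 0)"
    using contraction_factor_less_1[OF m \<beta>] by (intro order_tendstoD) auto
  then have "eventually (\<lambda>\<epsilon>. (1 + 2 * \<epsilon>) ^ k' * (\<rho> + 2 * \<epsilon>) < 1 \<and> \<epsilon> > 0) (at_right 0)"
    using eventually_at_right_less by (rule eventually_conj)
  then obtain \<epsilon> :: real where \<epsilon>: "(1 + 2 * \<epsilon>) ^ k' * (\<rho> + 2 * \<epsilon>) < 1" "\<epsilon> > 0"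
    using eventually_happens'[OF trivial_limit_at_right_real] by blast
  have "(\<lambda>n. \<bar>t n / b n\<bar>) \<longlonglongrightarrow> \<bar>1\<bar>"
    by (intro tendsto_intros toll)
  then have "eventually (\<lambda>n. \<bar>t n / b n\<bar> < 2) sequentially"
    by (intro order_tendstoD) auto
  then have "eventually (\<lambda>n. \<bar>t n\<bar> / b n \<le> 2 \<and> n \<ge> m - 1 \<and> average (comps n) (total_weight n) \<le> \<rho> + \<epsilon> \<and>
      (\<forall>i\<in>comps n. total_weight n i \<le> 1 + \<epsilon>)) sequentially"
    using eventually_average_total_weight_less[OF \<epsilon>(2)] eventually_ge_at_top[of "m - 1"]
    by eventually_elim (use b_pos in \<open>auto simp: less_imp_le\<close>)
  then obtain N where N: "\<And>n. n \<ge> N \<Longrightarrow> \<bar>t n\<bar> / b n \<le> 2 \<and> n \<ge> m - 1 \<and>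
      average (comps n) (total_weight n) \<le> \<rho> + \<epsilon> \<and> (\<forall>i\<in>comps n. total_weight n i \<le> 1 + \<epsilon>)"
    unfolding eventually_sequentially by blast
  let ?M = "\<lambda>n. measure_pmf.expectation (X_pmf m t n) (\<lambda>x. \<bar>x\<bar> ^ k)"
  \<comment> \<open>\<open>B >= 2 / \<epsilon>\<close> makes the toll's weight \<open>2 / B\<close>
    at most \<open>\<epsilon>\<close>; \<open>B >= 1\<close> allows \<open>B <= B ^ k\<close> for
    the initial indices.\<close>
  define B where "B = Max (insert 1 (insert (2 / \<epsilon>) ((\<lambda>n. ?M n / b n ^ k) ` {..N})))"
  have B: "B \<ge> 1" "2 / \<epsilon> \<le> B" "\<And>n. n \<le> N \<Longrightarrow> ?M n / b n ^ k \<le> B"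
    unfolding B_def by (intro Max_ge; simp)+
  have "2 / B \<le> \<epsilon>" using B(1,2) \<epsilon>(2) by (simp add: field_simps)
  have "?M n \<le> (B * b n) ^ k" for n
  proof (induction n rule: less_induct)
    case (less n)
    show ?case
    proof (cases "n \<le> N")
      case True
      have "B ^ 1 \<le> B ^ k"
        using B(1) Suc by (intro power_increasing) auto
      then have "?M n / b n ^ k \<le> B ^ k"
        using B(3)[OF True] by simp
      then show ?thesis
        using b_pos[of n] by (simp add: pos_divide_le_eq power_mult_distrib)
    next
      case False
      then have n: "\<bar>t n\<bar> / b n \<le> 2" "n \<ge> m - 1" "average (comps n) (total_weight n) \<le> \<rho> + \<epsilon>"
        "\<And>i. i \<in> comps n \<Longrightarrow> total_weight n i \<le> 1 + \<epsilon>"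
        using N[of n] by auto
      have "average (comps n) (\<lambda>i. (total_weight n i + 2 / B) ^ Suc k')
          \<le> average (comps n) (\<lambda>i. (1 + 2 * \<epsilon>) ^ k' * (total_weight n i + \<epsilon>))"
      proof (rule average_mono)
        fix i assume i: "i \<in> comps n"
        have "0 \<le> total_weight n i + 2 / B"
          using total_weight_pos[of n i] B(1) by (simp add: add_nonneg_nonneg less_imp_le)
        moreover have "total_weight n i + 2 / B \<le> 1 + 2 * \<epsilon>" "total_weight n i + 2 / B \<le> total_weight n i + \<epsilon>"
          using n(4)[OF i] \<open>2 / B \<le> \<epsilon>\<close> by auto
        ultimately have "(total_weight n i + 2 / B) ^ k' * (total_weight n i + 2 / B)
            \<le> (1 + 2 * \<epsilon>) ^ k' * (total_weight n i + \<epsilon>)"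
          using \<epsilon>(2) by (intro mult_mono power_mono) auto
        then show "(total_weight n i + 2 / B) ^ Suc k' \<le> (1 + 2 * \<epsilon>) ^ k' * (total_weight n i + \<epsilon>)"
          by (simp add: mult.commute)
      qed
      also have "\<dots> = (1 + 2 * \<epsilon>) ^ k' * (average (comps n) (total_weight n) + \<epsilon>)"
        using m by (simp add: average_cmult flip: average_add)
      also have "\<dots> \<le> (1 + 2 * \<epsilon>) ^ k' * (\<rho> + 2 * \<epsilon>)"
        using n(3) \<epsilon>(2) by (intro mult_left_mono) auto
      also have "\<dots> \<le> 1" using \<epsilon>(1) by simp
      finally have avg: "average (comps n) (\<lambda>i. (total_weight n i + 2 / B) ^ Suc k') \<le> 1" .
      have "?M n \<le> (B * b n) ^ Suc k' * average (comps n) (\<lambda>i. (total_weight n i + 2 / B) ^ Suc k')"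
        unfolding Suc using B(1) n less[unfolded Suc] by (intro moment_step) auto
      also have "\<dots> \<le> (B * b n) ^ Suc k' * 1"
        using avg B(1) b_pos[of n] by (intro mult_left_mono) (auto simp: less_imp_le)
      finally show ?thesis by (simp add: Suc)
    qed
  qed
  then show ?thesis by blast
qed

end

section \<open>The limit law\<close>

definition clamp_real :: "real \<Rightarrow> real \<Rightarrow> real" where
  "clamp_real a x = max (- a) (min a x)"

lemma abs_clamp_real: "a \<ge> 0 \<Longrightarrow> \<bar>clamp_real a x\<bar> = min a \<bar>x\<bar>"
  by (auto simp: clamp_real_def)

lemma clamp_real_eq: "\<bar>x\<bar> \<le> a \<Longrightarrow> clamp_real a x = x"
  by (auto simp: clamp_real_def)

lemma isCont_clamp_real [simp]: "isCont (clamp_real a) x"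
  unfolding clamp_real_def[abs_def] by (intro continuous_intros)

lemma borel_measurable_clamp_real [measurable]: "clamp_real a \<in> borel_measurable borel"
  unfolding clamp_real_def[abs_def] by measurable

text \<open>The two powers differ only where \<open>|x| > a\<close>, and there a factor
  \<open>|x| / a > 1\<close> may be inserted: one further moment is traded for smallness in
  \<open>a\<close>.\<close>

lemma clamp_real_power_diff_le:
  assumes "a > 0"
  shows "\<bar>x ^ k - clamp_real a x ^ k\<bar> \<le> 2 / a * \<bar>x\<bar> ^ Suc k"
proof (cases "\<bar>x\<bar> \<le> a")
  case False
  have "\<bar>x ^ k - clamp_real a x ^ k\<bar> \<le> \<bar>x\<bar> ^ k + \<bar>clamp_real a x\<bar> ^ k"
    by (metis abs_triangle_ineq4 power_abs)
  also have "\<bar>clamp_real a x\<bar> ^ k \<le> \<bar>x\<bar> ^ k"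
    using assms False by (intro power_mono) (auto simp: abs_clamp_real)
  also have "\<bar>x\<bar> ^ k + \<bar>x\<bar> ^ k \<le> 2 * \<bar>x\<bar> ^ k * (\<bar>x\<bar> / a)"
    using False assms mult_left_mono[of 1 "\<bar>x\<bar> / a" "2 * \<bar>x\<bar> ^ k"] by simp
  finally show ?thesis by (simp add: mult_ac)
qed (use assms in \<open>simp add: clamp_real_eq\<close>)

text \<open>Powers of the clamped variable are bounded and continuous, so their expectations
  converge. The truncation error is uniformly small by the bound on the next moment; for the limit
  this bound follows by monotone convergence in the truncation level.\<close>

lemma weak_conv_moments:
  fixes M :: "nat \<Rightarrow> real measure"
  assumes M: "\<And>n. real_distribution (M n)" and \<mu>: "real_distribution \<mu>" and conv: "weak_conv_m M \<mu>"
    and int: "\<And>n k. integrable (M n) (\<lambda>x. \<bar>x\<bar> ^ k)"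
    and C: "\<And>n k. (\<integral>x. \<bar>x\<bar> ^ k \<partial>M n) \<le> C k"
  shows "integrable \<mu> (\<lambda>x. x ^ k)" "(\<lambda>n. \<integral>x. x ^ k \<partial>M n) \<longlonglongrightarrow> (\<integral>x. x ^ k \<partial>\<mu>)"
proof -
  interpret M: real_distribution "M n" for n by (rule M)
  interpret \<mu>: real_distribution \<mu> by (rule \<mu>)
  note [measurable_cong] = M.events_eq_borel \<mu>.events_eq_borel
  have int_clamp_M: "integrable (M n) (\<lambda>x. clamp_real a x ^ k)"
    and int_clamp_\<mu>: "integrable \<mu> (\<lambda>x. clamp_real a x ^ k)"
    and int_clamp_abs_\<mu>: "integrable \<mu> (\<lambda>x. \<bar>clamp_real a x\<bar> ^ k)" if "a \<ge> 0" for n a k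
  proof -
    have "\<bar>clamp_real a x\<bar> ^ k \<le> a ^ k" for x
      using that by (intro power_mono) (auto simp: abs_clamp_real)
    then show "integrable (M n) (\<lambda>x. clamp_real a x ^ k)"
      "integrable \<mu> (\<lambda>x. clamp_real a x ^ k)" "integrable \<mu> (\<lambda>x. \<bar>clamp_real a x\<bar> ^ k)"
      by (intro M.integrable_const_bound[of _ "a ^ k"] \<mu>.integrable_const_bound[of _ "a ^ k"];
          simp add: power_abs)+
  qed
  have lim_clamp: "(\<lambda>n. \<integral>x. clamp_real a x ^ k \<partial>M n) \<longlonglongrightarrow> (\<integral>x. clamp_real a x ^ k \<partial>\<mu>)"
    "(\<lambda>n. \<integral>x. \<bar>clamp_real a x\<bar> ^ k \<partial>M n) \<longlonglongrightarrow> (\<integral>x. \<bar>clamp_real a x\<bar> ^ k \<partial>\<mu>)" if "a \<ge> 0" for a k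
  proof -
    have "\<bar>clamp_real a x\<bar> ^ k \<le> a ^ k" for x
      using that by (intro power_mono) (auto simp: abs_clamp_real)
    then show "(\<lambda>n. \<integral>x. clamp_real a x ^ k \<partial>M n) \<longlonglongrightarrow> (\<integral>x. clamp_real a x ^ k \<partial>\<mu>)"
      "(\<lambda>n. \<integral>x. \<bar>clamp_real a x\<bar> ^ k \<partial>M n) \<longlonglongrightarrow> (\<integral>x. \<bar>clamp_real a x\<bar> ^ k \<partial>\<mu>)"
      by (intro weak_conv_imp_integral_bdd_continuous_conv[OF M \<mu> conv, where B = "a ^ k"] continuous_intros;
          simp add: power_abs)+
  qed
  have abs_le: "(\<integral>x. \<bar>clamp_real a x\<bar> ^ k \<partial>\<mu>) \<le> C k" if "a \<ge> 0" for a k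
  proof (rule LIMSEQ_le_const2[OF lim_clamp(2)[OF that]])
    have "(\<integral>x. \<bar>clamp_real a x\<bar> ^ k \<partial>M n) \<le> (\<integral>x. \<bar>x\<bar> ^ k \<partial>M n)" for n
      by (intro integral_mono_AE' int always_eventually allI power_mono) (auto simp: abs_clamp_real that)
    then show "\<exists>N. \<forall>n\<ge>N. (\<integral>x. \<bar>clamp_real a x\<bar> ^ k \<partial>M n) \<le> C k"
      using C order_trans by blast
  qed
  have int_abs: "integrable \<mu> (\<lambda>x. \<bar>x\<bar> ^ k) \<and> (\<integral>x. \<bar>x\<bar> ^ k \<partial>\<mu>) \<le> C k" for k
  proof -
    let ?f = "\<lambda>i::nat. \<lambda>x. \<bar>clamp_real (real i) x\<bar> ^ k"
    have mono: "mono (\<lambda>i. ?f i x)" for x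
      by (intro monoI power_mono) (auto simp: abs_clamp_real)
    have "incseq (\<lambda>i. \<integral>x. ?f i x \<partial>\<mu>)"
      by (intro monoI integral_mono int_clamp_abs_\<mu> monoD[OF mono]) auto
    then have conv: "(\<lambda>i. \<integral>x. ?f i x \<partial>\<mu>) \<longlonglongrightarrow> (SUP i. \<integral>x. ?f i x \<partial>\<mu>)"
      using abs_le by (intro LIMSEQ_incseq_SUP bdd_aboveI2[of _ _ "C k"]) auto
    have lim: "(\<lambda>i. ?f i x) \<longlonglongrightarrow> \<bar>x\<bar> ^ k" for x
    proof (rule tendsto_eventually)
      show "eventually (\<lambda>i. ?f i x = \<bar>x\<bar> ^ k) sequentially"
        using eventually_ge_at_top[of "nat \<lceil>\<bar>x\<bar>\<rceil>"]
      proof eventually_elim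
        case (elim i)
        then have "\<bar>x\<bar> \<le> real i" by linarith
        then show ?case by (simp add: clamp_real_eq)
      qed
    qed
    note conv_thms = int_clamp_abs_\<mu>[OF of_nat_0_le_iff] always_eventually[OF allI[OF mono]] always_eventually[OF allI[OF lim]] conv
    have "integrable \<mu> (\<lambda>x. \<bar>x\<bar> ^ k)"
      by (rule integrable_monotone_convergence[OF conv_thms]) measurable
    moreover have "(\<integral>x. \<bar>x\<bar> ^ k \<partial>\<mu>) = (SUP i. \<integral>x. ?f i x \<partial>\<mu>)"
      by (rule integral_monotone_convergence[OF conv_thms]) measurable
    ultimately show ?thesis
      using abs_le by (auto intro!: cSUP_least)
  qed
  have int_M: "integrable (M n) (\<lambda>x. x ^ k)" for n k
    using int[of n k] by (rule Bochner_Integration.integrable_bound) (auto simp: power_abs)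
  show int_\<mu>: "integrable \<mu> (\<lambda>x. x ^ k)"
    using conjunct1[OF int_abs[of k]] by (rule Bochner_Integration.integrable_bound) (auto simp: power_abs)
  \<comment> \<open>The maximum with 1 keeps the truncation level \<open>6 * C' / \<epsilon>\<close>
    chosen below positive.\<close>
  define C' where "C' = max 1 (C (Suc k))"
  have close: "\<bar>(\<integral>x. x ^ k \<partial>N) - (\<integral>x. clamp_real a x ^ k \<partial>N)\<bar> \<le> 2 / a * C'"
    if "a > 0" "integrable N (\<lambda>x. x ^ k)" "integrable N (\<lambda>x. clamp_real a x ^ k)"
      "integrable N (\<lambda>x. \<bar>x\<bar> ^ Suc k)" "(\<integral>x. \<bar>x\<bar> ^ Suc k \<partial>N) \<le> C (Suc k)" for a and N :: "real measure"
  proof -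
    have "\<bar>(\<integral>x. x ^ k \<partial>N) - (\<integral>x. clamp_real a x ^ k \<partial>N)\<bar> = \<bar>\<integral>x. x ^ k - clamp_real a x ^ k \<partial>N\<bar>"
      using that by simp
    also have "\<dots> \<le> (\<integral>x. \<bar>x ^ k - clamp_real a x ^ k\<bar> \<partial>N)"
      by (rule integral_abs_bound)
    also have "\<dots> \<le> (\<integral>x. 2 / a * \<bar>x\<bar> ^ Suc k \<partial>N)"
      using that clamp_real_power_diff_le[OF that(1)]
      by (intro integral_mono integrable_abs Bochner_Integration.integrable_diff integrable_mult_right)
    also have "\<dots> = 2 / a * (\<integral>x. \<bar>x\<bar> ^ Suc k \<partial>N)"
      by (rule integral_mult_right_zero)
    also have "\<dots> \<le> 2 / a * C'"
      using that by (intro mult_left_mono) (auto simp: C'_def)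
    finally show ?thesis .
  qed
  show "(\<lambda>n. \<integral>x. x ^ k \<partial>M n) \<longlonglongrightarrow> (\<integral>x. x ^ k \<partial>\<mu>)"
  proof (rule tendstoI)
    fix \<epsilon> :: real assume "\<epsilon> > 0"
    define a where "a = 6 * C' / \<epsilon>"
    have "C' \<ge> 1" by (simp add: C'_def)
    then have "a > 0" using \<open>\<epsilon> > 0\<close> by (simp add: a_def)
    have a: "2 / a * C' = \<epsilon> / 3"
      using \<open>C' \<ge> 1\<close> \<open>\<epsilon> > 0\<close> by (simp add: a_def)
    have 1: "\<bar>(\<integral>x. x ^ k \<partial>M n) - (\<integral>x. clamp_real a x ^ k \<partial>M n)\<bar> \<le> \<epsilon> / 3" for n
      unfolding a[symmetric] using \<open>a > 0\<close> by (intro close int_M int_clamp_M int C) auto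
    have 2: "\<bar>(\<integral>x. x ^ k \<partial>\<mu>) - (\<integral>x. clamp_real a x ^ k \<partial>\<mu>)\<bar> \<le> \<epsilon> / 3"
      unfolding a[symmetric] using \<open>a > 0\<close> int_abs[of "Suc k"] by (intro close int_\<mu> int_clamp_\<mu>) auto
    have "eventually (\<lambda>n. dist (\<integral>x. clamp_real a x ^ k \<partial>M n) (\<integral>x. clamp_real a x ^ k \<partial>\<mu>) < \<epsilon> / 3) sequentially"
      using lim_clamp(1)[of a k] \<open>a > 0\<close> \<open>\<epsilon> > 0\<close> by (intro tendstoD) auto
    then show "eventually (\<lambda>n. dist (\<integral>x. x ^ k \<partial>M n) (\<integral>x. x ^ k \<partial>\<mu>) < \<epsilon>) sequentially"
    proof eventually_elim
      case (elim n)
      then show ?case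
        using 1[of n] 2 unfolding dist_real_def by argo
    qed
  qed
qed

section \<open>The distributional equation in terms of characteristic functions\<close>

lemma char_distr_affine_combination:
  assumes "real_distribution \<mu>"
  shows "(\<lambda>(s, y). (\<Sum>j<m. s j powr \<beta> * y j) + 1)
      \<in> borel_measurable (uniform_simplex m \<Otimes>\<^sub>M Pi\<^sub>M {..<m} (\<lambda>_. \<mu>))"
    and "char (distr (uniform_simplex m \<Otimes>\<^sub>M Pi\<^sub>M {..<m} (\<lambda>_. \<mu>)) borel (\<lambda>(s, y). (\<Sum>j<m. s j powr \<beta> * y j) + 1)) u
      = iexp u * (\<integral>s. (\<Prod>j<m. char \<mu> (u * s j powr \<beta>)) \<partial>uniform_simplex m)"
proof -
  interpret \<mu>: real_distribution \<mu> by fact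
  interpret S: prob_space "uniform_simplex m" by (rule prob_space_uniform_simplex)
  interpret P: product_prob_space "\<lambda>_. \<mu>" "{..<m}" ..
  interpret SP: pair_prob_space "uniform_simplex m" "Pi\<^sub>M {..<m} (\<lambda>_. \<mu>)" ..
  let ?SP = "uniform_simplex m \<Otimes>\<^sub>M Pi\<^sub>M {..<m} (\<lambda>_. \<mu>)"
  have fst: "(\<lambda>p. fst p j) \<in> borel_measurable ?SP" if "j < m" for j
  proof -
    have "(\<lambda>s. s j) \<in> borel_measurable (uniform_simplex m)"
      using measurable_component_uniform_simplex[OF that] by (simp cong: measurable_cong_sets)
    from measurable_compose[OF measurable_fst this] show ?thesis .
  qed
  have snd: "(\<lambda>p. snd p j) \<in> borel_measurable ?SP" if "j < m" for j
  proof -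
    have "(\<lambda>s. s j) \<in> Pi\<^sub>M {..<m} (\<lambda>_. \<mu>) \<rightarrow>\<^sub>M \<mu>"
      using that by (intro measurable_component_singleton) auto
    then have "(\<lambda>s. s j) \<in> borel_measurable (Pi\<^sub>M {..<m} (\<lambda>_. \<mu>))"
      by (simp cong: measurable_cong_sets)
    from measurable_compose[OF measurable_snd this] show ?thesis .
  qed
  show meas: "(\<lambda>(s, y). (\<Sum>j<m. s j powr \<beta> * y j) + 1) \<in> borel_measurable ?SP"
    unfolding case_prod_beta using fst snd
    by (intro borel_measurable_add borel_measurable_sum borel_measurable_times powr_real_measurable) auto
  have "char (distr ?SP borel (\<lambda>(s, y). (\<Sum>j<m. s j powr \<beta> * y j) + 1)) u
      = (\<integral>p. (\<lambda>(s, y). iexp (u * ((\<Sum>j<m. s j powr \<beta> * y j) + 1))) p \<partial>?SP)"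
    unfolding char_def using meas by (subst integral_distr) (auto simp: case_prod_unfold)
  also have "\<dots> = (\<integral>s. \<integral>y. iexp (u * ((\<Sum>j<m. s j powr \<beta> * y j) + 1)) \<partial>Pi\<^sub>M {..<m} (\<lambda>_. \<mu>) \<partial>uniform_simplex m)"
  proof (subst SP.integral_fst'[symmetric])
    have "(\<lambda>p. iexp (u * (case p of (s, y) \<Rightarrow> (\<Sum>j<m. s j powr \<beta> * y j) + 1))) \<in> borel_measurable ?SP"
      using meas by measurable
    then show "integrable ?SP (\<lambda>(s, y). iexp (u * ((\<Sum>j<m. s j powr \<beta> * y j) + 1)))"
      by (intro SP.P.integrable_const_bound[of _ 1]) (auto simp: case_prod_beta)
  qed simp
  also have "\<dots> = (\<integral>s. iexp u * (\<Prod>j<m. char \<mu> (u * s j powr \<beta>)) \<partial>uniform_simplex m)"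
  proof (intro Bochner_Integration.integral_cong refl)
    fix s
    have "iexp (u * ((\<Sum>j<m. s j powr \<beta> * y j) + 1)) = iexp u * (\<Prod>j<m. iexp (u * s j powr \<beta> * y j))" for y
    proof -
      have "u * ((\<Sum>j<m. s j powr \<beta> * y j) + 1) = u + (\<Sum>j<m. u * s j powr \<beta> * y j)"
        by (simp add: distrib_left sum_distrib_left mult.assoc)
      then show ?thesis
        by (simp add: exp_add exp_sum sum_distrib_left distrib_left)
    qed
    moreover have "(\<integral>y. (\<Prod>j<m. iexp (u * s j powr \<beta> * y j)) \<partial>Pi\<^sub>M {..<m} (\<lambda>_. \<mu>)) = (\<Prod>j<m. char \<mu> (u * s j powr \<beta>))"
      unfolding char_def by (intro P.product_integral_prod \<mu>.integrable_iexp) auto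
    ultimately show "(\<integral>y. iexp (u * ((\<Sum>j<m. s j powr \<beta> * y j) + 1)) \<partial>Pi\<^sub>M {..<m} (\<lambda>_. \<mu>))
        = iexp u * (\<Prod>j<m. char \<mu> (u * s j powr \<beta>))"
      by (simp only: integral_mult_right_zero)
  qed
  finally show "char (distr ?SP borel (\<lambda>(s, y). (\<Sum>j<m. s j powr \<beta> * y j) + 1)) u
      = iexp u * (\<integral>s. (\<Prod>j<m. char \<mu> (u * s j powr \<beta>)) \<partial>uniform_simplex m)"
    by simp
qed

text \<open>The finite second moment gives a finite first absolute moment, which serves as the
  Lipschitz constant of \<open>char \<mu>\<close>.\<close>

lemma cf_solution_char:
  assumes "fixed_point_law m \<beta> \<mu>"
  shows "cf_solution m \<beta> (char \<mu>)"
proof -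
  interpret \<mu>: real_distribution \<mu> using assms unfolding fixed_point_law_def by blast
  note [measurable_cong] = \<mu>.events_eq_borel
  have "integrable \<mu> (\<lambda>y. y\<^sup>2)"
    using assms unfolding fixed_point_law_def by blast
  then have "integrable \<mu> (\<lambda>y. 1 + y\<^sup>2)"
    by simp
  then have int: "integrable \<mu> abs"
  proof (rule Bochner_Integration.integrable_bound)
    have "\<bar>y\<bar> \<le> 1 + y\<^sup>2" for y :: real
      using zero_le_power2[of "\<bar>y\<bar> - 1"] zero_le_power2[of y] by (simp add: power2_diff)
    then show "AE y in \<mu>. norm \<bar>y\<bar> \<le> norm (1 + y\<^sup>2)"
      by (intro always_eventually allI) (smt (verit) real_norm_def zero_le_power2)
  qed measurable
  have "norm (char \<mu> u - char \<mu> v) \<le> (\<integral>y. \<bar>y\<bar> \<partial>\<mu>) * \<bar>u - v\<bar>" for u v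
  proof -
    have "norm (char \<mu> u - char \<mu> v) = norm (\<integral>y. iexp (u * y) - iexp (v * y) \<partial>\<mu>)"
      unfolding char_def by (subst Bochner_Integration.integral_diff) (auto intro!: \<mu>.integrable_iexp)
    also have "\<dots> \<le> (\<integral>y. norm (iexp (u * y) - iexp (v * y)) \<partial>\<mu>)"
      by (rule integral_norm_bound)
    also have "\<dots> \<le> (\<integral>y. \<bar>u - v\<bar> * \<bar>y\<bar> \<partial>\<mu>)"
    proof (rule integral_mono)
      show "integrable \<mu> (\<lambda>y. norm (iexp (u * y) - iexp (v * y)))"
        by (intro integrable_norm Bochner_Integration.integrable_diff \<mu>.integrable_iexp) auto
      show "norm (iexp (u * y) - iexp (v * y)) \<le> \<bar>u - v\<bar> * \<bar>y\<bar>" for y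
        using norm_iexp_diff_le[of "u * y" "v * y"] by (simp add: abs_mult flip: left_diff_distrib)
    qed (use int in simp)
    finally show ?thesis by (simp add: mult.commute)
  qed
  moreover have "char \<mu> u = iexp u * (\<integral>s. (\<Prod>j<m. char \<mu> (u * s j powr \<beta>)) \<partial>uniform_simplex m)" for u
  proof -
    have "\<mu> = distr (uniform_simplex m \<Otimes>\<^sub>M Pi\<^sub>M {..<m} (\<lambda>_. \<mu>)) borel (\<lambda>(s, y). (\<Sum>j<m. s j powr \<beta> * y j) + 1)"
      using assms unfolding fixed_point_law_def by blast
    then have "char \<mu> u = char (distr (uniform_simplex m \<Otimes>\<^sub>M Pi\<^sub>M {..<m} (\<lambda>_. \<mu>)) borel (\<lambda>(s, y). (\<Sum>j<m. s j powr \<beta> * y j) + 1)) u"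
      by (rule arg_cong[where f = "\<lambda>\<mu>. char \<mu> u"])
    then show ?thesis
      by (simp only: char_distr_affine_combination(2)[OF \<mu>.real_distribution_axioms])
  qed
  ultimately show ?thesis
    unfolding cf_solution_def using \<mu>.cmod_char_le_1 \<mu>.char_zero by blast
qed

lemma fixed_point_lawI:
  assumes "real_distribution \<mu>" "integrable \<mu> (\<lambda>y. y\<^sup>2)" "cf_solution m \<beta> (char \<mu>)"
  shows "fixed_point_law m \<beta> \<mu>"
proof -
  let ?T = "distr (uniform_simplex m \<Otimes>\<^sub>M Pi\<^sub>M {..<m} (\<lambda>_. \<mu>)) borel (\<lambda>(s, y). (\<Sum>j<m. s j powr \<beta> * y j) + 1)"
  interpret \<mu>: real_distribution \<mu> by fact
  interpret S: prob_space "uniform_simplex m" by (rule prob_space_uniform_simplex)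
  interpret P: product_prob_space "\<lambda>_. \<mu>" "{..<m}" ..
  interpret SP: pair_prob_space "uniform_simplex m" "Pi\<^sub>M {..<m} (\<lambda>_. \<mu>)" ..
  have "real_distribution ?T"
    by (intro SP.P.real_distribution_distr char_distr_affine_combination(1) assms)
  moreover have "char \<mu> = char ?T"
  proof
    show "char \<mu> u = char ?T u" for u
      unfolding char_distr_affine_combination(2)[OF assms(1)] by (rule cf_solution_eq[OF assms(3)])
  qed
  ultimately have eq: "\<mu> = ?T"
    by (rule Levy_uniqueness[OF assms(1)])
  show ?thesis
    unfolding fixed_point_law_def by (intro conjI assms(1,2)) (rule eq)
qed

section \<open>Solving the equation by iteration\<close>

definition cf_step :: "nat \<Rightarrow> real \<Rightarrow> (real \<Rightarrow> complex) \<Rightarrow> real \<Rightarrow> complex" where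
  "cf_step m \<beta> \<psi> u = iexp u * (\<integral>s. (\<Prod>j<m. \<psi> (u * s j powr \<beta>)) \<partial>uniform_simplex m)"

text \<open>Collects properties that \<open>cf_step\<close> preserves, up to a change of
  \<open>C\<close>, and that survive pointwise limits for fixed \<open>C\<close>.\<close>

definition cf_like :: "real \<Rightarrow> (real \<Rightarrow> complex) \<Rightarrow> bool" where
  "cf_like C \<psi> \<longleftrightarrow> (\<forall>u v. norm (\<psi> u - \<psi> v) \<le> C * \<bar>u - v\<bar>) \<and> (\<forall>u. norm (\<psi> u) \<le> 1) \<and> \<psi> 0 = 1"

lemma
  assumes "cf_like C \<psi>"
  shows cf_like_lipschitz: "norm (\<psi> u - \<psi> v) \<le> C * \<bar>u - v\<bar>"
    and cf_like_norm: "norm (\<psi> u) \<le> 1"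
    and cf_like_0: "\<psi> 0 = 1"
  using assms unfolding cf_like_def by blast+

lemma borel_measurable_cf_like:
  assumes "cf_like C \<psi>"
  shows "(\<lambda>s. \<Prod>j<m. \<psi> (u * s j powr \<beta>)) \<in> borel_measurable (uniform_simplex m)"
proof -
  have "continuous_on UNIV \<psi>"
    by (rule continuous_if_lipschitz) (rule cf_like_lipschitz[OF assms])
  from measurable_prod_powr[OF this] show ?thesis
    by (simp cong: measurable_cong_sets)
qed

lemma integrable_cf_like:
  assumes "cf_like C \<psi>"
  shows "integrable (uniform_simplex m) (\<lambda>s. \<Prod>j<m. \<psi> (u * s j powr \<beta>))"
proof -
  interpret prob_space "uniform_simplex m" by (rule prob_space_uniform_simplex)
  show ?thesis
    by (intro integrable_const_bound[of _ 1] always_eventually allI norm_prod_le_1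
        cf_like_norm[OF assms] borel_measurable_cf_like[OF assms])
qed

text \<open>Stated for two functions and two arguments to serve twice: with
  \<open>\<psi> = \<psi>'\<close> it propagates Lipschitz continuity, with \<open>u = v\<close> it
  is the contraction.\<close>

lemma norm_cf_step_diff_le:
  assumes "cf_like C \<psi>" "cf_like C' \<psi>'" "m > 0" "\<beta> \<ge> 1" "d \<ge> 0"
    and d: "\<And>x. x \<ge> 0 \<Longrightarrow> norm (\<psi> (u * x) - \<psi>' (v * x)) \<le> d * x"
  shows "norm (cf_step m \<beta> \<psi> u - cf_step m \<beta> \<psi>' v) \<le> \<bar>u - v\<bar> + d * contraction_factor m \<beta>"
proof -
  let ?A = "\<integral>s. (\<Prod>j<m. \<psi> (u * s j powr \<beta>)) \<partial>uniform_simplex m"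
  let ?B = "\<integral>s. (\<Prod>j<m. \<psi>' (v * s j powr \<beta>)) \<partial>uniform_simplex m"
  interpret prob_space "uniform_simplex m" by (rule prob_space_uniform_simplex)
  note int = integrable_cf_like[OF assms(1), of m u \<beta>] integrable_cf_like[OF assms(2), of m v \<beta>]
  have "norm ?A \<le> (\<integral>s. norm (\<Prod>j<m. \<psi> (u * s j powr \<beta>)) \<partial>uniform_simplex m)"
    by (rule integral_norm_bound)
  also have "\<dots> \<le> (\<integral>s. 1 \<partial>uniform_simplex m)"
    using int(1) by (intro integral_mono integrable_norm norm_prod_le_1 cf_like_norm[OF assms(1)]) auto
  finally have A: "norm ?A \<le> 1" by (simp add: prob_space)
  have "norm (?A - ?B) = norm (\<integral>s. (\<Prod>j<m. \<psi> (u * s j powr \<beta>)) - (\<Prod>j<m. \<psi>' (v * s j powr \<beta>)) \<partial>uniform_simplex m)"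
    using int by simp
  also have "\<dots> \<le> (\<integral>s. norm ((\<Prod>j<m. \<psi> (u * s j powr \<beta>)) - (\<Prod>j<m. \<psi>' (v * s j powr \<beta>))) \<partial>uniform_simplex m)"
    by (rule integral_norm_bound)
  also have "\<dots> \<le> (\<integral>s. d * (\<Sum>j<m. s j powr \<beta>) \<partial>uniform_simplex m)"
  proof (rule integral_mono)
    fix s
    have "norm ((\<Prod>j<m. \<psi> (u * s j powr \<beta>)) - (\<Prod>j<m. \<psi>' (v * s j powr \<beta>)))
        \<le> (\<Sum>j<m. norm (\<psi> (u * s j powr \<beta>) - \<psi>' (v * s j powr \<beta>)))"
      by (intro norm_prod_diff cf_like_norm[OF assms(1)] cf_like_norm[OF assms(2)])
    also have "\<dots> \<le> (\<Sum>j<m. d * s j powr \<beta>)"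
      by (intro sum_mono d) auto
    finally show "norm ((\<Prod>j<m. \<psi> (u * s j powr \<beta>)) - (\<Prod>j<m. \<psi>' (v * s j powr \<beta>))) \<le> d * (\<Sum>j<m. s j powr \<beta>)"
      by (simp add: sum_distrib_left)
  qed (use int integrable_sum_powr assms in auto)
  finally have AB: "norm (?A - ?B) \<le> d * contraction_factor m \<beta>"
    by (simp add: contraction_factor_def)
  have eq: "cf_step m \<beta> \<psi> u - cf_step m \<beta> \<psi>' v = (iexp u - iexp v) * ?A + iexp v * (?A - ?B)"
    by (simp add: cf_step_def algebra_simps)
  have "norm (cf_step m \<beta> \<psi> u - cf_step m \<beta> \<psi>' v) \<le> norm (iexp u - iexp v) * norm ?A + norm (?A - ?B)"
    unfolding eq by (rule order_trans[OF norm_triangle_ineq]) (simp add: norm_mult)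
  also have "\<dots> \<le> \<bar>u - v\<bar> * 1 + d * contraction_factor m \<beta>"
  proof -
    have "norm (iexp u - iexp v) * norm ?A \<le> \<bar>u - v\<bar> * 1"
      by (rule mult_mono[OF norm_iexp_diff_le[of u v] A abs_ge_zero norm_ge_zero])
    then show ?thesis using AB by (rule add_mono)
  qed
  finally show ?thesis by simp
qed

lemma cf_like_cf_step:
  assumes \<psi>: "cf_like C \<psi>" and "m > 0" "\<beta> \<ge> 1"
  shows "cf_like (1 + contraction_factor m \<beta> * C) (cf_step m \<beta> \<psi>)"
proof -
  interpret prob_space "uniform_simplex m" by (rule prob_space_uniform_simplex)
  have "C \<ge> 0" using order_trans[OF norm_ge_zero cf_like_lipschitz[OF \<psi>, of 1 0]] by simp
  have "norm (cf_step m \<beta> \<psi> u - cf_step m \<beta> \<psi> v) \<le> (1 + contraction_factor m \<beta> * C) * \<bar>u - v\<bar>" for u v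
  proof -
    have "norm (\<psi> (u * x) - \<psi> (v * x)) \<le> (C * \<bar>u - v\<bar>) * x" if "x \<ge> 0" for x
      using cf_like_lipschitz[OF \<psi>, of "u * x" "v * x"] that
      by (simp add: abs_mult mult_ac flip: left_diff_distrib)
    then have "norm (cf_step m \<beta> \<psi> u - cf_step m \<beta> \<psi> v) \<le> \<bar>u - v\<bar> + C * \<bar>u - v\<bar> * contraction_factor m \<beta>"
      using assms \<open>C \<ge> 0\<close> by (intro norm_cf_step_diff_le[OF \<psi> \<psi>]) auto
    then show ?thesis by (simp add: algebra_simps)
  qed
  moreover have "norm (cf_step m \<beta> \<psi> u) \<le> 1" for u
  proof -
    have "norm (cf_step m \<beta> \<psi> u) \<le> (\<integral>s. norm (\<Prod>j<m. \<psi> (u * s j powr \<beta>)) \<partial>uniform_simplex m)"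
      unfolding cf_step_def norm_mult norm_exp_i_times by simp
    also have "\<dots> \<le> (\<integral>s. 1 \<partial>uniform_simplex m)"
      by (intro integral_mono integrable_norm norm_prod_le_1 cf_like_norm[OF \<psi>] integrable_cf_like[OF \<psi>]) auto
    finally show ?thesis by (simp add: prob_space)
  qed
  moreover have "cf_step m \<beta> \<psi> 0 = 1"
    using cf_like_0[OF \<psi>] prob_space by (simp add: cf_step_def)
  ultimately show ?thesis by (simp add: cf_like_def)
qed

lemma cf_solution_exists:
  assumes m: "m \<ge> 2" and \<beta>: "\<beta> > 1"
  shows "\<exists>\<psi>. cf_solution m \<beta> \<psi>"
proof -
  interpret prob_space "uniform_simplex m" by (rule prob_space_uniform_simplex)
  define \<rho> where "\<rho> = contraction_factor m \<beta>"
  have \<rho>: "0 \<le> \<rho>" "\<rho> < 1"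
    using contraction_factor_less_1[OF m \<beta>] contraction_factor_nonneg by (auto simp: \<rho>_def)
  \<comment> \<open>The fixed point of \<open>C \<mapsto> 1 + \<rho> * C\<close>, so that all
    iterates share one Lipschitz constant.\<close>
  define C where "C = 1 / (1 - \<rho>)"
  have C: "C \<ge> 0" "1 + \<rho> * C = C"
    using \<rho> by (auto simp: C_def field_simps)
  \<comment> \<open>The starting function is the characteristic function of the point mass at
    0.\<close>
  define \<psi> where "\<psi> k = (cf_step m \<beta> ^^ k) (\<lambda>_. 1)" for k
  have \<psi>_Suc: "\<psi> (Suc k) = cf_step m \<beta> (\<psi> k)" for k by (simp add: \<psi>_def)
  have like: "cf_like C (\<psi> k)" for k
  proof (induction k)
    case 0
    then show ?case using C by (simp add: \<psi>_def cf_like_def)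
  next
    case (Suc k)
    then show ?case
      using cf_like_cf_step[OF Suc, of m \<beta>] m \<beta> C by (simp add: \<psi>_Suc \<rho>_def[symmetric])
  qed
  have diff: "norm (\<psi> (Suc k) u - \<psi> k u) \<le> \<rho> ^ k * \<bar>u\<bar>" for k u
  proof (induction k arbitrary: u)
    case 0
    then show ?case
      using norm_iexp_diff_le[of u 0] prob_space by (simp add: \<psi>_def cf_step_def)
  next
    case (Suc k)
    have "norm (\<psi> (Suc k) (u * x) - \<psi> k (u * x)) \<le> (\<rho> ^ k * \<bar>u\<bar>) * x" if "x \<ge> 0" for x
      using Suc.IH[of "u * x"] that by (simp add: abs_mult mult_ac)
    then have "norm (cf_step m \<beta> (\<psi> (Suc k)) u - cf_step m \<beta> (\<psi> k) u) \<le> \<bar>u - u\<bar> + \<rho> ^ k * \<bar>u\<bar> * \<rho>"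
      unfolding \<rho>_def[symmetric] using m \<beta> \<rho> by (subst \<rho>_def, intro norm_cf_step_diff_le[OF like like]) auto
    then show ?case
      by (simp add: \<psi>_Suc[symmetric] mult_ac)
  qed
  have conv: "convergent (\<lambda>k. \<psi> k u)" for u
  proof -
    have "summable (\<lambda>k. \<rho> ^ k * \<bar>u\<bar>)"
      using \<rho> by (intro summable_mult2 summable_geometric) auto
    then have "summable (\<lambda>k. \<psi> (Suc k) u - \<psi> k u)"
      by (rule summable_comparison_test'[where N = 0]) (rule diff)
    then have "convergent (\<lambda>n. \<Sum>k<n. \<psi> (Suc k) u - \<psi> k u)"
      by (simp add: summable_iff_convergent)
    then have "convergent (\<lambda>n. \<psi> n u - \<psi> 0 u)"
      by (simp only: sum_lessThan_telescope[of "\<lambda>k. \<psi> k u"])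
    then show ?thesis
      by (simp only: convergent_diff_const_right_iff)
  qed
  define L where "L u = lim (\<lambda>k. \<psi> k u)" for u
  have lim: "(\<lambda>k. \<psi> k u) \<longlonglongrightarrow> L u" for u
    unfolding L_def using conv by (simp only: convergent_LIMSEQ_iff)
  have "norm (L u - L v) \<le> C * \<bar>u - v\<bar>" for u v
    by (rule LIMSEQ_le_const2[OF tendsto_norm[OF tendsto_diff[OF lim lim]]])
      (use cf_like_lipschitz[OF like] in blast)
  moreover have "norm (L u) \<le> 1" for u
    by (rule LIMSEQ_le_const2[OF tendsto_norm[OF lim]]) (use cf_like_norm[OF like] in blast)
  moreover have "L 0 = 1"
    by (rule LIMSEQ_unique[OF lim]) (simp add: cf_like_0[OF like])
  ultimately have L: "cf_like C L" by (simp add: cf_like_def)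
  have "L u = iexp u * (\<integral>s. (\<Prod>j<m. L (u * s j powr \<beta>)) \<partial>uniform_simplex m)" for u
  proof -
    have "(\<lambda>k. \<integral>s. (\<Prod>j<m. \<psi> k (u * s j powr \<beta>)) \<partial>uniform_simplex m)
        \<longlonglongrightarrow> (\<integral>s. (\<Prod>j<m. L (u * s j powr \<beta>)) \<partial>uniform_simplex m)"
    proof (rule integral_dominated_convergence)
      show "integrable (uniform_simplex m) (\<lambda>_. 1 :: real)" by simp
      show "AE s in uniform_simplex m. (\<lambda>k. \<Prod>j<m. \<psi> k (u * s j powr \<beta>)) \<longlonglongrightarrow> (\<Prod>j<m. L (u * s j powr \<beta>))"
        by (intro always_eventually allI tendsto_prod lim)
      show "AE s in uniform_simplex m. norm (\<Prod>j<m. \<psi> k (u * s j powr \<beta>)) \<le> 1" for k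
        by (intro always_eventually allI norm_prod_le_1 cf_like_norm[OF like])
    qed (intro borel_measurable_cf_like[OF like] borel_measurable_cf_like[OF L])+
    then have "(\<lambda>k. cf_step m \<beta> (\<psi> k) u) \<longlonglongrightarrow> cf_step m \<beta> L u"
      unfolding cf_step_def by (intro tendsto_intros)
    then have "(\<lambda>k. \<psi> (Suc k) u) \<longlonglongrightarrow> cf_step m \<beta> L u"
      by (simp add: \<psi>_Suc)
    moreover have "(\<lambda>k. \<psi> (Suc k) u) \<longlonglongrightarrow> L u"
      by (rule LIMSEQ_Suc[OF lim])
    ultimately show ?thesis
      unfolding cf_step_def by (rule LIMSEQ_unique[symmetric])
  qed
  then have "cf_solution m \<beta> L"
    using L unfolding cf_solution_def cf_like_def by blast
  then show ?thesis by blast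
qed

text \<open>Chebyshev's inequality.\<close>

lemma tight_if_second_moment_bounded:
  assumes M: "\<And>n. real_distribution (M n)"
    and int: "\<And>n. integrable (M n) (\<lambda>x. x\<^sup>2)" and C: "\<And>n. (\<integral>x. x\<^sup>2 \<partial>M n) \<le> C"
  shows "tight M"
  unfolding tight_def
proof (intro conjI allI impI M)
  fix \<epsilon> :: real assume "\<epsilon> > 0"
  \<comment> \<open>With \<open>|C| + 1\<close> in place of \<open>C\<close> the estimate
    \<open>C < \<epsilon> * a^2\<close> is strict, also if \<open>C = 0\<close>.\<close>
  define a where "a = sqrt ((\<bar>C\<bar> + 1) / \<epsilon>) + 1"
  have "a > 0" by (simp add: a_def add_nonneg_pos \<open>\<epsilon> > 0\<close> less_imp_le)
  have "(sqrt ((\<bar>C\<bar> + 1) / \<epsilon>))\<^sup>2 \<le> a\<^sup>2"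
    using \<open>\<epsilon> > 0\<close> by (intro power_mono) (auto simp: a_def)
  then have "C < \<epsilon> * a\<^sup>2"
    using \<open>\<epsilon> > 0\<close> by (simp add: field_simps)
  have "measure (M n) {- a<..a} > 1 - \<epsilon>" for n
  proof -
    interpret real_distribution "M n" by (rule M)
    have "a\<^sup>2 * prob {x. a \<le> \<bar>x\<bar>} \<le> (\<integral>x. x\<^sup>2 \<partial>M n)"
    proof -
      have "a\<^sup>2 * prob {x. a \<le> \<bar>x\<bar>} = (\<integral>x. a\<^sup>2 * indicator {x. a \<le> \<bar>x\<bar>} x \<partial>M n)"
        by simp
      also have "\<dots> \<le> (\<integral>x. x\<^sup>2 \<partial>M n)"
        using int \<open>a > 0\<close>
        by (intro integral_mono integrable_mult_right integrable_real_indicator)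
          (auto simp: indicator_def less_top[symmetric] abs_le_square_iff[symmetric])
      finally show ?thesis .
    qed
    then have "a\<^sup>2 * prob {x. a \<le> \<bar>x\<bar>} < a\<^sup>2 * \<epsilon>"
      using C[of n] \<open>C < \<epsilon> * a\<^sup>2\<close> by (simp add: mult.commute)
    then have "prob {x. a \<le> \<bar>x\<bar>} < \<epsilon>"
      using \<open>a > 0\<close> by simp
    moreover have "prob (space (M n) - {- a<..a}) \<le> prob {x. a \<le> \<bar>x\<bar>}"
      by (intro finite_measure_mono) auto
    moreover have "prob (space (M n) - {- a<..a}) = 1 - prob {- a<..a}"
      by (rule prob_compl) simp
    ultimately show ?thesis by linarith
  qed
  then show "\<exists>a b. a < b \<and> (\<forall>n. 1 - \<epsilon> < measure (M n) {a<..b})"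
    using \<open>a > 0\<close> by (intro exI[of _ "- a"] exI[of _ a]) auto
qed

section \<open>Existence, uniqueness and convergence for the normalised laws\<close>

context regular_toll
begin

definition normalized_law :: "nat \<Rightarrow> real measure" where
  "normalized_law n = distr (measure_pmf (X_pmf m t n)) borel (\<lambda>x. x / b n)"

lemma real_distribution_normalized_law: "real_distribution (normalized_law n)"
  unfolding normalized_law_def by (intro prob_space.real_distribution_distr measure_pmf.prob_space_axioms) simp

lemma char_normalized_law: "char (normalized_law n) u = \<phi> n u"
  by (simp add: char_def normalized_law_def \<phi>_def integral_distr)

lemma integral_normalized_law:
  fixes f :: "real \<Rightarrow> real"
  assumes "f \<in> borel_measurable borel"
  shows "integrable (normalized_law n) f"
    and "(\<integral>x. f x \<partial>normalized_law n) = measure_pmf.expectation (X_pmf m t n) (\<lambda>x. f (x / b n))"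
  using assms by (simp_all add: normalized_law_def integral_distr integrable_distr_eq integrable_measure_pmf_finite)

lemma normalized_moment_bound: "\<exists>C. \<forall>n. (\<integral>x. \<bar>x\<bar> ^ k \<partial>normalized_law n) \<le> C"
proof -
  obtain B where B: "\<And>n. measure_pmf.expectation (X_pmf m t n) (\<lambda>x. \<bar>x\<bar> ^ k) \<le> (B * b n) ^ k"
    using moment_bound[of k] by blast
  have "(\<integral>x. \<bar>x\<bar> ^ k \<partial>normalized_law n) \<le> B ^ k" for n
  proof -
    have "(\<integral>x. \<bar>x\<bar> ^ k \<partial>normalized_law n) = measure_pmf.expectation (X_pmf m t n) (\<lambda>x. \<bar>x\<bar> ^ k) / b n ^ k"
      using b_pos[of n] by (simp add: integral_normalized_law power_divide)
    then show ?thesis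
      using B[of n] b_pos[of n] by (simp add: power_mult_distrib pos_divide_le_eq)
  qed
  then show ?thesis by blast
qed

lemma tight_normalized_law: "tight normalized_law"
proof -
  obtain C where "\<And>n. (\<integral>x. \<bar>x\<bar> ^ 2 \<partial>normalized_law n) \<le> C"
    using normalized_moment_bound[of 2] by blast
  then show ?thesis
    by (intro tight_if_second_moment_bounded real_distribution_normalized_law integral_normalized_law(1)) auto
qed

text \<open>Stated along a subsequence to serve twice: for the subsequential limit that proves
  existence, and with \<open>r = id\<close> for convergence of the moments.\<close>

lemma moments_of_limit:
  assumes "strict_mono (r :: nat \<Rightarrow> nat)" "real_distribution \<mu>" "weak_conv_m (normalized_law \<circ> r) \<mu>"
  shows "integrable \<mu> (\<lambda>x. x ^ k)" "(\<lambda>n. \<integral>x. x ^ k \<partial>normalized_law (r n)) \<longlonglongrightarrow> (\<integral>x. x ^ k \<partial>\<mu>)"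
proof -
  have "\<forall>k. \<exists>C. \<forall>n. (\<integral>x. \<bar>x\<bar> ^ k \<partial>normalized_law n) \<le> C"
    using normalized_moment_bound by blast
  then obtain C where "\<And>n k. (\<integral>x. \<bar>x\<bar> ^ k \<partial>normalized_law n) \<le> C k"
    by metis
  then have C: "(\<integral>x. \<bar>x\<bar> ^ k \<partial>(normalized_law \<circ> r) n) \<le> C k" for n k by simp
  have R: "real_distribution ((normalized_law \<circ> r) n)" for n
    by (simp add: real_distribution_normalized_law)
  have I: "integrable ((normalized_law \<circ> r) n) (\<lambda>x. \<bar>x\<bar> ^ k)" for n k
    by (simp add: integral_normalized_law)
  show "integrable \<mu> (\<lambda>x. x ^ k)"
    by (rule weak_conv_moments(1)[OF R assms(2,3) I C])
  show "(\<lambda>n. \<integral>x. x ^ k \<partial>normalized_law (r n)) \<longlonglongrightarrow> (\<integral>x. x ^ k \<partial>\<mu>)"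
    using weak_conv_moments(2)[OF R assms(2,3) I C] by simp
qed

text \<open>Both solutions are pointwise limits of the same sequence \<open>\<phi>\<close>.\<close>

lemma cf_solution_unique:
  assumes "cf_solution m \<beta> \<psi>" "cf_solution m \<beta> \<psi>'"
  shows "\<psi> = \<psi>'"
  by (rule ext, rule LIMSEQ_unique) (rule \<phi>_tendsto[OF assms(1)], rule \<phi>_tendsto[OF assms(2)])

text \<open>Existence and uniqueness do not involve \<open>t\<close> and \<open>b\<close>; the toll only serves to produce a sequence
  that converges to every solution.\<close>

lemma fixed_point_law_exists: "\<exists>\<mu>. fixed_point_law m \<beta> \<mu>"
proof -
  obtain \<psi> where \<psi>: "cf_solution m \<beta> \<psi>"
    using cf_solution_exists[OF m \<beta>] by blast
  obtain r \<mu> where r: "strict_mono (r :: nat \<Rightarrow> nat)" and \<mu>: "real_distribution \<mu>"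
    and conv: "weak_conv_m (normalized_law \<circ> r) \<mu>"
    using tight_imp_convergent_subsubsequence[OF tight_normalized_law strict_mono_id] by auto
  have "char \<mu> u = \<psi> u" for u
  proof (rule LIMSEQ_unique)
    show "(\<lambda>n. char ((normalized_law \<circ> r) n) u) \<longlonglongrightarrow> char \<mu> u"
      by (rule levy_continuity1[OF _ \<mu> conv]) (simp add: real_distribution_normalized_law)
    show "(\<lambda>n. char ((normalized_law \<circ> r) n) u) \<longlonglongrightarrow> \<psi> u"
      using LIMSEQ_subseq_LIMSEQ[OF \<phi>_tendsto[OF \<psi>] r] by (simp add: char_normalized_law comp_def)
  qed
  then have "cf_solution m \<beta> (char \<mu>)"
    using \<psi> by (metis ext)
  then show ?thesis
    using fixed_point_lawI[OF \<mu> moments_of_limit(1)[OF r \<mu> conv, of 2]] by blast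
qed

lemma fixed_point_law_unique:
  assumes "fixed_point_law m \<beta> \<mu>" "fixed_point_law m \<beta> \<nu>"
  shows "\<mu> = \<nu>"
proof (rule Levy_uniqueness)
  show "char \<mu> = char \<nu>"
    using assms by (intro cf_solution_unique cf_solution_char)
qed (use assms in \<open>unfold fixed_point_law_def, blast+\<close>)

lemma normalized_law_tendsto:
  assumes "fixed_point_law m \<beta> \<mu>"
  shows "weak_conv_m normalized_law \<mu>"
proof (rule levy_continuity[OF real_distribution_normalized_law])
  show "real_distribution \<mu>"
    using assms unfolding fixed_point_law_def by blast
  show "(\<lambda>n. char (normalized_law n) u) \<longlonglongrightarrow> char \<mu> u" for u
    unfolding char_normalized_law by (rule \<phi>_tendsto[OF cf_solution_char[OF assms]])
qed

end

text \<open>Reconciles \<open>normalizer\<close> with \<open>n powr \<beta> * L n\<close>, which is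
  0 at \<open>n = 0\<close>.\<close>

lemma weak_conv_m_cong_eventually:
  assumes "eventually (\<lambda>n. M n = N n) sequentially" "weak_conv_m M \<mu>"
  shows "weak_conv_m N \<mu>"
  unfolding weak_conv_m_def weak_conv_def
proof (intro allI impI)
  fix x assume "isCont (cdf \<mu>) x"
  then have "(\<lambda>n. cdf (M n) x) \<longlonglongrightarrow> cdf \<mu> x"
    using assms(2) by (simp add: weak_conv_m_def weak_conv_def)
  then show "(\<lambda>n. cdf (N n) x) \<longlonglongrightarrow> cdf \<mu> x"
    by (rule Lim_transform_eventually) (use assms(1) in \<open>auto elim: eventually_mono\<close>)
qed

theorem theorem6p5:
  fixes m :: nat and \<beta> :: real and t :: "nat \<Rightarrow> real" and L :: "real \<Rightarrow> real"
  assumes "m \<ge> 2"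
    and "\<beta> > 1"
    and "slowly_varying L"
    and "t \<sim>[at_top] (\<lambda>n. real n powr \<beta> * L (real n))"
  shows "(\<exists>!\<mu>. fixed_point_law m \<beta> \<mu>) \<and>
    (\<forall>\<mu>. fixed_point_law m \<beta> \<mu> \<longrightarrow>
       weak_conv_m (\<lambda>n. distr (measure_pmf (X_pmf m t n)) borel (\<lambda>x. x / (real n powr \<beta> * L (real n)))) \<mu> \<and>
       (\<forall>k::nat. integrable \<mu> (\<lambda>y. y ^ k) \<and>
          (\<lambda>n. measure_pmf.expectation (X_pmf m t n) (\<lambda>x. (x / (real n powr \<beta> * L (real n))) ^ k))
            \<longlonglongrightarrow> (\<integral>y. y ^ k \<partial>\<mu>)))"
proof -
  let ?a = "\<lambda>n. real n powr \<beta> * L (real n)"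
  have a_eq: "normalizer \<beta> L n = ?a n" if "n > 0" for n
    using that by (simp add: normalizer_def)
  have a_nz: "eventually (\<lambda>n. ?a n \<noteq> 0) sequentially"
    using eventually_gt_at_top[of "0::nat"]
  proof eventually_elim
    case (elim n)
    then show ?case
      using normalizer_pos[OF assms(3), of \<beta> n] by (metis a_eq less_irrefl)
  qed
  have "(\<lambda>n. t n / ?a n) \<longlonglongrightarrow> 1"
    by (rule asymp_equivD_strong[OF assms(4) eventually_mono[OF a_nz]]) (rule disjI2)
  then have "(\<lambda>n. t n / normalizer \<beta> L n) \<longlonglongrightarrow> 1"
    by (rule Lim_transform_eventually)
      (rule eventually_mono[OF eventually_gt_at_top[of 0]], simp add: a_eq)
  then interpret regular_toll m \<beta> t "normalizer \<beta> L"
    using assms(1-3) by unfold_locales (auto intro: normalizer_pos normalizer_ratio)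
  have law: "distr (measure_pmf (X_pmf m t n)) borel (\<lambda>x. x / ?a n) = normalized_law n" if "n > 0" for n
    using a_eq[OF that] by (simp add: normalized_law_def)
  have "weak_conv_m (\<lambda>n. distr (measure_pmf (X_pmf m t n)) borel (\<lambda>x. x / ?a n)) \<mu>"
    if "fixed_point_law m \<beta> \<mu>" for \<mu>
    by (rule weak_conv_m_cong_eventually[OF _ normalized_law_tendsto[OF that]])
      (rule eventually_mono[OF eventually_gt_at_top[of 0]], simp add: law)
  moreover have "integrable \<mu> (\<lambda>y. y ^ k)"
    "(\<lambda>n. measure_pmf.expectation (X_pmf m t n) (\<lambda>x. (x / ?a n) ^ k)) \<longlonglongrightarrow> (\<integral>y. y ^ k \<partial>\<mu>)"
    if \<mu>: "fixed_point_law m \<beta> \<mu>" for \<mu> and k :: nat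
  proof -
    have *: "real_distribution \<mu>" "weak_conv_m (normalized_law \<circ> id) \<mu>"
      using \<mu> normalized_law_tendsto[OF \<mu>] unfolding fixed_point_law_def by auto
    show "integrable \<mu> (\<lambda>y. y ^ k)"
      by (rule moments_of_limit(1)[OF strict_mono_id *])
    have "(\<lambda>n. \<integral>x. x ^ k \<partial>normalized_law n) \<longlonglongrightarrow> (\<integral>y. y ^ k \<partial>\<mu>)"
      using moments_of_limit(2)[OF strict_mono_id *] by simp
    then show "(\<lambda>n. measure_pmf.expectation (X_pmf m t n) (\<lambda>x. (x / ?a n) ^ k)) \<longlonglongrightarrow> (\<integral>y. y ^ k \<partial>\<mu>)"
    proof (rule Lim_transform_eventually)
      show "eventually (\<lambda>n. (\<integral>x. x ^ k \<partial>normalized_law n)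
          = measure_pmf.expectation (X_pmf m t n) (\<lambda>x. (x / ?a n) ^ k)) sequentially"
        using eventually_gt_at_top[of "0::nat"] by eventually_elim (simp add: integral_normalized_law a_eq)
    qed
  qed
  ultimately show ?thesis
    using fixed_point_law_exists fixed_point_law_unique by blast
qed

end
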